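(* Let $g:[0,1]^2\to\mathbb{R}^p$ be integrable, let $\varphi(\theta)=\iint_{[0,1]^2} g(x,y)\,l(x,y;\theta)\,\mathrm{d}x\,\mathrm{d}y$ be a homeomorphism between $\Theta^o$ (the interior of $\Theta$) and $\varphi(\Theta^o)$, and let the true parameter $\theta_0$ lie in $\Theta^o$. Assume moreover: (C1) $\varphi$ is continuously differentiable in some neighborhood of $\theta_0$ and its derivative matrix $D_\varphi(\theta_0)$ is invertible; (C2) there exists $\alpha>0$ such that, as $t\downarrow0$, $$t^{-1}\mathbb{P}\{1-F_1(X)\le tx,\ 1-F_2(Y)\le ty\}-R(x,y)=O(t^\alpha),$$ uniformly on the set $\{(x,y):x+y=1,\ x\ge0,\ y\ge0\}$; (C3) $k=k_n\to\infty$ and $k=o\left(n^{2\alpha/(1+2\alpha)}\right)$ as $n\to\infty$, with $\alpha$ as in (C2). Then, as $n\to\infty$, $$\sqrt{k}\,(\hat\theta_n-\theta_0)\xrightarrow{d}D_\varphi(\theta_0)^{-1}\tilde B .$$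
   Context: Let $(X,Y),(X_1,Y_1),(X_2,Y_2),\ldots$ be independent random vectors in $\mathbb{R}^2$ with common continuous distribution function $F$ and marginal distribution functions $F_1,F_2$. Assume that $F$ has a stable tail dependence function $l$, i.e. for all $x,y\ge 0$ the limit $$l(x,y)=\lim_{t\downarrow 0}t^{-1}\mathbb{P}\{1-F_1(X)\le tx\text{ or }1-F_2(Y)\le ty\}$$ exists. Assume that $l$ belongs to a parametric family of stable tail dependence functions $\{l(\cdot,\cdot;\theta):\theta\in\Theta\}$, $\Theta\subset\mathbb{R}^p$, $p\ge 1$, and $l=l(\cdot,\cdot;\theta_0)$, where $\theta_0$ is the true parameter. Put $R(x,y)=x+y-l(x,y)$ for $(x,y)\in[0,\infty)^2$ and $R(x,\infty)=R(\infty,x)=x$. Nonparametric estimator: let $R_i^X$ be the rank of $X_i$ among $X_1,\ldots,X_n$ and $R_i^Y$ the rank of $Y_i$ among $Y_1,\ldots,Y_n$. For $k=k_n\in\{1,\ldots,n\}$ put $$\hat l_n(x,y)=\frac1k\sum_{i=1}^n\mathbf{1}\left\{R_i^X>n+\tfrac12-kx\ \text{ or }\ R_i^Y>n+\tfrac12-ky\right\}.$$ Moment estimator: $\hat\theta_n=\varphi^{-1}\left(\iint_{[0,1]^2}g(x,y)\hat l_n(x,y)\,\mathrm{d}x\,\mathrm{d}y\right)$ if $\iint_{[0,1]^2} g\,\hat l_n\in\varphi(\Theta^o)$, where $\varphi^{-1}$ is the inverse of $\varphi:\Theta^o\to\varphi(\Theta^o)$; otherwise $\hat\theta_n$ is some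 arbitrary fixed value in $\Theta$. Limit: $W$ is a mean-zero Wiener process (centered Gaussian process with continuous sample paths) on $[0,\infty]^2\setminus\{(\infty,\infty)\}$ with covariance function $\mathbb{E}W(x_1,y_1)W(x_2,y_2)=R(x_1\wedge x_2,y_1\wedge y_2)$; $W_1(x)=W(x,\infty)$, $W_2(y)=W(\infty,y)$. $R_1(x,y)$ and $R_2(x,y)$ denote the right-hand partial derivatives of $R$ at $(x,y)\in[0,\infty)^2$ with respect to the first and second coordinate (they always exist since $R$ is concave). Define $$B(x,y)=W(x,y)-R_1(x,y)W_1(x)-R_2(x,y)W_2(y),\qquad \tilde B=\iint_{[0,1]^2}g(x,y)B(x,y)\,\mathrm{d}x\,\mathrm{d}y.$$ *)

theory Defs
  imports "HOL-Probability.Probability"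
begin

section \<open>Stable tail dependence functions\<close>

text \<open>The function \<open>l\<close> is only constrained on \<open>[0,\<infinity>)\<^sup>2\<close>.\<close>

definition has_stdf ::
  "'a measure \<Rightarrow> ('a \<Rightarrow> real) \<Rightarrow> ('a \<Rightarrow> real) \<Rightarrow> (real \<Rightarrow> real \<Rightarrow> real) \<Rightarrow> bool" where
  "has_stdf M X Y l \<longleftrightarrow>
     (\<forall>x\<ge>0. \<forall>y\<ge>0.
        ((\<lambda>t. \<P>(\<omega> in M. 1 - cdf (distr M borel X) (X \<omega>) \<le> t * x \<or>
                         1 - cdf (distr M borel Y) (Y \<omega>) \<le> t * y) / t)
          \<longlongrightarrow> l x y) (at_right 0))"

text \<open>Being a stable tail dependence function only depends on the law of the pair, so it is
  enough to quantify over Borel probability measures on the plane.\<close>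

definition is_stdf :: "(real \<Rightarrow> real \<Rightarrow> real) \<Rightarrow> bool" where
  "is_stdf l \<longleftrightarrow>
     (\<exists>\<mu> :: (real \<times> real) measure. prob_space \<mu> \<and> sets \<mu> = sets borel \<and>
        continuous_on UNIV (\<lambda>(u, v). \<P>(z in \<mu>. fst z \<le> u \<and> snd z \<le> v)) \<and>
        has_stdf \<mu> fst snd l)"

definition tail_R :: "(real \<Rightarrow> real \<Rightarrow> real) \<Rightarrow> real \<Rightarrow> real \<Rightarrow> real" where
  "tail_R l x y = x + y - l x y"

text \<open>\<open>R\<close> on \<open>[0,\<infinity>]\<^sup>2\<close>; the value at \<open>(\<infinity>,\<infinity>)\<close> is never used.\<close>

definition tail_R_ext :: "(real \<Rightarrow> real \<Rightarrow> real) \<Rightarrow> ennreal \<times> ennreal \<Rightarrow> real" where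
  "tail_R_ext l = (\<lambda>(x, y).
     if y = \<infinity> then enn2real x
     else if x = \<infinity> then enn2real y
     else tail_R l (enn2real x) (enn2real y))"

definition tail_R1 :: "(real \<Rightarrow> real \<Rightarrow> real) \<Rightarrow> real \<Rightarrow> real \<Rightarrow> real" where
  "tail_R1 l x y = vector_derivative (\<lambda>u. tail_R l u y) (at_right x)"

definition tail_R2 :: "(real \<Rightarrow> real \<Rightarrow> real) \<Rightarrow> real \<Rightarrow> real \<Rightarrow> real" where
  "tail_R2 l x y = vector_derivative (\<lambda>v. tail_R l x v) (at_right y)"


section \<open>The estimators\<close>

definition sample_rank :: "(nat \<Rightarrow> 'a \<Rightarrow> real) \<Rightarrow> nat \<Rightarrow> nat \<Rightarrow> 'a \<Rightarrow> nat" where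
  "sample_rank X n i \<omega> = card {j \<in> {1..n}. X j \<omega> \<le> X i \<omega>}"

definition stdf_estimator ::
  "(nat \<Rightarrow> 'a \<Rightarrow> real) \<Rightarrow> (nat \<Rightarrow> 'a \<Rightarrow> real) \<Rightarrow> nat \<Rightarrow> nat \<Rightarrow> 'a \<Rightarrow> real \<Rightarrow> real \<Rightarrow> real" where
  "stdf_estimator X Y n k \<omega> x y =
     (1 / real k) * (\<Sum>i = 1..n. of_bool
        (real (sample_rank X n i \<omega>) > real n + 1 / 2 - real k * x \<or>
         real (sample_rank Y n i \<omega>) > real n + 1 / 2 - real k * y))"

definition weighted_integral ::
  "(real \<times> real \<Rightarrow> real ^ 'p) \<Rightarrow> (real \<Rightarrow> real \<Rightarrow> real) \<Rightarrow> real ^ 'p" where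
  "weighted_integral g f = (LINT z : {0..1} \<times> {0..1} | lebesgue. f (fst z) (snd z) *\<^sub>R g z)"

text \<open>Here \<open>\<phi>\<close> is \<^term>\<open>\<lambda>\<theta>. weighted_integral g (L \<theta>)\<close>, and \<open>\<theta>'\<close> is the value used when the
  weighted integral of the nonparametric estimator falls outside the image of \<open>\<phi>\<close>.\<close>

definition moment_estimator ::
  "(real \<times> real \<Rightarrow> real ^ 'p) \<Rightarrow> (real ^ 'p \<Rightarrow> real \<Rightarrow> real \<Rightarrow> real) \<Rightarrow> (real ^ 'p) set \<Rightarrow> real ^ 'p \<Rightarrow>
   (nat \<Rightarrow> 'a \<Rightarrow> real) \<Rightarrow> (nat \<Rightarrow> 'a \<Rightarrow> real) \<Rightarrow> nat \<Rightarrow> nat \<Rightarrow> 'a \<Rightarrow> real ^ 'p" where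
  "moment_estimator g L \<Theta> \<theta>' X Y n k \<omega> =
     (let \<phi> = (\<lambda>\<theta>. weighted_integral g (L \<theta>));
          m = weighted_integral g (stdf_estimator X Y n k \<omega>)
      in if m \<in> \<phi> ` interior \<Theta> then the_inv_into (interior \<Theta>) \<phi> m else \<theta>')"


section \<open>The limiting process\<close>

text \<open>Mean zero normal law, including the degenerate law at \<open>0\<close>.\<close>

definition centered_normal :: "'b measure \<Rightarrow> ('b \<Rightarrow> real) \<Rightarrow> bool" where
  "centered_normal N Z \<longleftrightarrow>
     Z \<in> borel_measurable N \<and>
     ((AE \<omega> in N. Z \<omega> = 0) \<or> (\<exists>\<sigma>>0. distributed N lborel Z (normal_density 0 \<sigma>)))"

definition centered_gaussian_process ::
  "'b measure \<Rightarrow> 'i set \<Rightarrow> ('i \<Rightarrow> 'i \<Rightarrow> real) \<Rightarrow> ('i \<Rightarrow> 'b \<Rightarrow> real) \<Rightarrow> bool" where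
  "centered_gaussian_process N I K W \<longleftrightarrow>
     prob_space N \<and>
     (\<forall>S c. finite S \<and> S \<subseteq> I \<longrightarrow> centered_normal N (\<lambda>\<omega>. \<Sum>i\<in>S. c i * W i \<omega>)) \<and>
     (\<forall>i\<in>I. \<forall>j\<in>I. (LINT \<omega>|N. W i \<omega> * W j \<omega>) = K i j)"

text \<open>Sample paths are required to be continuous on \<open>[0,\<infinity>)\<^sup>2\<close> and along each of the two edges at
  infinity, that is, \<open>\<infinity>\<close> is treated as an isolated point of \<open>[0,\<infinity>]\<close>.  Continuity for the order
  topology of \<open>[0,\<infinity>]\<close> would be a stronger demand, which no process satisfies when
  \<open>lim R(x,y) < x\<close> as \<open>y \<rightarrow> \<infinity>\<close>, for instance under asymptotic independence, where \<open>R\<close> vanishes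
  on \<open>[0,\<infinity>)\<^sup>2\<close>.\<close>

definition tail_wiener_process ::
  "'b measure \<Rightarrow> (real \<Rightarrow> real \<Rightarrow> real) \<Rightarrow> (ennreal \<times> ennreal \<Rightarrow> 'b \<Rightarrow> real) \<Rightarrow> bool" where
  "tail_wiener_process N l W \<longleftrightarrow>
     centered_gaussian_process N (UNIV - {(\<infinity>, \<infinity>)})
       (\<lambda>(x1, y1) (x2, y2). tail_R_ext l (min x1 x2, min y1 y2)) W \<and>
     (\<forall>\<omega>\<in>space N.
        continuous_on ({..<\<infinity>} \<times> {..<\<infinity>}) (\<lambda>z. W z \<omega>) \<and>
        continuous_on {..<\<infinity>} (\<lambda>x. W (x, \<infinity>) \<omega>) \<and>
        continuous_on {..<\<infinity>} (\<lambda>y. W (\<infinity>, y) \<omega>))"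

definition limit_B ::
  "(real \<Rightarrow> real \<Rightarrow> real) \<Rightarrow> (ennreal \<times> ennreal \<Rightarrow> 'b \<Rightarrow> real) \<Rightarrow> 'b \<Rightarrow> real \<Rightarrow> real \<Rightarrow> real" where
  "limit_B l W \<omega> x y =
     W (ennreal x, ennreal y) \<omega>
       - tail_R1 l x y * W (ennreal x, \<infinity>) \<omega>
       - tail_R2 l x y * W (\<infinity>, ennreal y) \<omega>"


section \<open>Convergence in distribution\<close>

text \<open>The library's weak convergence covers laws on the real line only.\<close>

definition converges_in_distribution ::
  "'a measure \<Rightarrow> (nat \<Rightarrow> 'a \<Rightarrow> 'c :: euclidean_space) \<Rightarrow> 'b measure \<Rightarrow> ('b \<Rightarrow> 'c) \<Rightarrow> bool" where
  "converges_in_distribution M Z N Z' \<longleftrightarrow>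
     (\<forall>n. Z n \<in> borel_measurable M) \<and> Z' \<in> borel_measurable N \<and>
     (\<forall>h :: 'c \<Rightarrow> real. continuous_on UNIV h \<and> bounded (range h) \<longrightarrow>
        (\<lambda>n. LINT \<omega>|M. h (Z n \<omega>)) \<longlonglongrightarrow> (LINT \<omega>|N. h (Z' \<omega>)))"

end

theory Submission
  imports Defs
begin

text \<open>The moment estimator is \<open>\<psi> m\<^sub>n\<close>, where \<open>m\<^sub>n\<close> is the integral of \<open>g\<close> against the rank based estimator
and \<open>\<psi>\<close> is the inverse of \<open>\<phi>\<close>.  By invariance of domain \<open>\<phi> ` interior \<Theta>\<close> is open, so \<open>\<psi>\<close> is
differentiable at \<open>\<phi> \<theta>\<^sub>0\<close> with the inverse derivative (\<open>moment_equation_inverse_derivative\<close>), and the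
\<open>delta_method\<close> reduces the theorem to the asymptotic normality of \<open>m\<^sub>n\<close>, which is
\<open>weighted_estimator_clt\<close>.

By Levy's continuity theorem (\<open>levy_continuity_euclidean\<close>) it suffices to treat one
direction \<open>c\<close> at a time, that is, the scalar weight \<open>\<gamma> = c \<bullet> g\<close>.  Replace the observations by the
decreasing transforms \<open>U = 1 - F1 X\<close> and \<open>V = 1 - F2 Y\<close>, which are uniform; this leaves the ranks
alone.  The estimator at \<open>(x, y)\<close> counts the points with \<open>U\<close> or \<open>V\<close> below an order statistic, and
those random levels differ from the levels \<open>(k / n) x\<close> and \<open>(k / n) y\<close> by an amount that the marginal tail
empirical processes determine.  Expanding the tail copula \<open>R\<close> to first order at a point where it is differentiable, the
estimation error times \<open>sqrt k\<close> equals \<open>- \<nu>\<^sub>n\<close> of the influence function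
\<open>1{U \<le> (k/n) x, V \<le> (k/n) y} - R\<^sub>1 1{U \<le> (k/n) x} - R\<^sub>2 1{V \<le> (k/n) y}\<close>, up to a remainder, where \<open>\<nu>\<^sub>n\<close>
is the tail empirical process.

Only an integral of the error matters, so the remainder is controlled pointwise and in mean: it tends to \<open>0\<close>
in \<open>L\<^sup>1\<close> at every regular point (\<open>remainder_tendsto_0\<close>) and is bounded in \<open>L\<^sup>2\<close> uniformly over the unit square
(\<open>second_moment_remainder\<close>), and dominated convergence in \<open>(x, y)\<close> finishes.  The points that are
not regular form a null set, because a homogeneous \<open>R\<close> is determined by its concave section
\<open>R(\<cdot>, 1)\<close>, so that these points lie on countably many rays (\<open>AE_regular\<close>).

What is left is, after exchanging integrals, a normalized sum of independent bounded variables.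
Its characteristic function converges to that of a centered normal law
(\<open>linear_statistic_clt\<close>) whose variance is a double integral of the weight against the
covariance of \<open>W\<close>.  The integral of \<open>\<gamma>\<close> against the limit process \<open>B\<close> is normal with
exactly this variance (\<open>tail_wiener_integral\<close>), a centered normal law being symmetric.  The rate
of convergence to the tail copula and the growth condition on \<open>k\<close> make the bias negligible against \<open>1 / sqrt k\<close> (\<open>tail_bias\<close>, \<open>intermediate_sequence\<close>).\<close>

section \<open>Convergence in distribution from characteristic functions\<close>

text \<open>Finite sums of cosine waves with arbitrary frequencies and phases.  Phases replace sines, and the
class is closed under products, so it serves as the test functions whose integrals characteristic functions control.\<close>

inductive trig_poly :: "('c::real_inner \<Rightarrow> real) \<Rightarrow> bool" where
  wave: "trig_poly (\<lambda>y. a * cos (c \<bullet> y + b))"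
| add: "trig_poly p \<Longrightarrow> trig_poly q \<Longrightarrow> trig_poly (\<lambda>y. p y + q y)"

lemma trig_poly_const: "trig_poly (\<lambda>y. a)"
  using trig_poly.wave[of a 0 0] by simp

lemma trig_poly_mult:
  assumes "trig_poly p" "trig_poly q"
  shows "trig_poly (\<lambda>y. p y * q y)"
  using assms
proof (induction arbitrary: q rule: trig_poly.induct)
  case (wave a c b q)
  from wave show ?case
  proof (induction rule: trig_poly.induct)
    case (wave a' c' b')
    have "a * cos (c \<bullet> y + b) * (a' * cos (c' \<bullet> y + b')) =
        (a * a' / 2) * cos ((c - c') \<bullet> y + (b - b')) + (a * a' / 2) * cos ((c + c') \<bullet> y + (b + b'))" for y
    proof -
      have "cos (c \<bullet> y + b) * cos (c' \<bullet> y + b') =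
          (cos ((c - c') \<bullet> y + (b - b')) + cos ((c + c') \<bullet> y + (b + b'))) / 2"
        unfolding cos_times_cos by (simp add: algebra_simps)
      then show ?thesis by (simp add: field_simps)
    qed
    then show ?case
      by (simp only:) (rule trig_poly.add; rule trig_poly.wave)
  next
    case (add p q)
    then show ?case by (simp add: ring_distribs trig_poly.add)
  qed
next
  case (add p1 p2 q)
  then show ?case by (simp add: ring_distribs trig_poly.add)
qed

lemma trig_poly_sum:
  assumes "finite I" "\<And>i. i \<in> I \<Longrightarrow> trig_poly (p i)"
  shows "trig_poly (\<lambda>y. \<Sum>i\<in>I. p i y)"
  using assms by (induction I) (auto intro: trig_poly_const trig_poly.add)

text \<open>A continuous function is approximated uniformly on the cube \<open>[-T, T]\<^sup>d\<close> by a trigonometric polynomial that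
stays bounded by \<open>H + e\<close> on the whole space; the global bound controls the error outside the cube.
The reason: \<open>s y\<close>, with coordinates \<open>sin (pi y\<^sub>i / 2T)\<close>, maps the whole space into the cube \<open>[-1, 1]\<^sup>d\<close> and is
inverted by \<open>a\<close> over \<open>[-T, T]\<^sup>d\<close>, so the Stone-Weierstrass theorem for \<open>h \<circ> a\<close> on
\<open>[-1, 1]\<^sup>d\<close> gives a polynomial in the sines.\<close>

lemma trig_poly_approximates:
  fixes h :: "'c::euclidean_space \<Rightarrow> real"
  assumes h: "continuous_on UNIV h" and bd: "\<And>y. \<bar>h y\<bar> \<le> H" and T: "T > 0" and e: "e > 0"
  obtains q where "trig_poly q" "\<And>y. (\<And>i. i \<in> Basis \<Longrightarrow> \<bar>y \<bullet> i\<bar> \<le> T) \<Longrightarrow> \<bar>h y - q y\<bar> < e"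
    "\<And>y. \<bar>q y\<bar> \<le> H + e"
proof -
  define s :: "'c \<Rightarrow> 'c" where "s y = (\<Sum>i\<in>Basis. sin (pi / (2 * T) * (y \<bullet> i)) *\<^sub>R i)" for y
  define a :: "'c \<Rightarrow> 'c" where "a u = (\<Sum>i\<in>Basis. (2 * T / pi * arcsin (u \<bullet> i)) *\<^sub>R i)" for u
  define K :: "'c set" where "K = cbox (- One) One"
  have K: "u \<in> K \<longleftrightarrow> (\<forall>i\<in>Basis. -1 \<le> u \<bullet> i \<and> u \<bullet> i \<le> 1)" for u
    by (auto simp: K_def mem_box)
  have si: "s y \<bullet> i = sin (pi / (2 * T) * (y \<bullet> i))" if "i \<in> Basis" for y i
    using that by (simp add: s_def)
  have sK: "s y \<in> K" for y by (auto simp: K si)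
  have as: "a (s y) = y" if y: "\<And>i. i \<in> Basis \<Longrightarrow> \<bar>y \<bullet> i\<bar> \<le> T" for y
  proof -
    have "2 * T / pi * arcsin (s y \<bullet> i) = y \<bullet> i" if i: "i \<in> Basis" for i
    proof -
      have "\<bar>y \<bullet> i\<bar> \<le> T" using y[OF i] .
      then have "\<bar>pi / (2 * T) * (y \<bullet> i)\<bar> \<le> pi / (2 * T) * T"
        unfolding abs_mult using T by (intro mult_mono) auto
      also have "pi / (2 * T) * T = pi / 2" using T by simp
      finally have "arcsin (sin (pi / (2 * T) * (y \<bullet> i))) = pi / (2 * T) * (y \<bullet> i)"
        by (intro arcsin_sin; linarith)
      then show ?thesis using T i by (simp add: si)
    qed
    then show ?thesis by (simp add: a_def euclidean_representation)
  qed
  have cK: "continuous_on K a"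
    unfolding a_def using K by (intro continuous_intros continuous_on_arcsin) auto
  have "continuous_on K (\<lambda>u. h (a u))"
    by (rule continuous_on_compose2[OF h cK]) auto
  then obtain P where P: "real_polynomial_function P" "\<And>u. u \<in> K \<Longrightarrow> \<bar>h (a u) - P u\<bar> < e"
    using Stone_Weierstrass_real_polynomial_function[of K "\<lambda>u. h (a u)" e] e
    unfolding K_def by auto
  from P(1) have "trig_poly (\<lambda>y. P (s y))"
  proof (induction rule: real_polynomial_function.induct)
    case (linear f)
    interpret f: bounded_linear f by fact
    have "f (s y) = (\<Sum>i\<in>Basis. f i * cos ((- (pi / (2 * T)) *\<^sub>R i) \<bullet> y + pi / 2))" for y
      unfolding s_def f.sum f.scaleR
      by (intro sum.cong) (auto simp: sin_cos_eq inner_commute algebra_simps)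
    then show ?case
      by (simp only:) (intro trig_poly_sum trig_poly.wave finite_Basis)
  qed (auto intro: trig_poly_const trig_poly.add trig_poly_mult)
  moreover have "\<bar>h y - P (s y)\<bar> < e" if "\<And>i. i \<in> Basis \<Longrightarrow> \<bar>y \<bullet> i\<bar> \<le> T" for y
    using P(2)[OF sK[of y]] as[OF that] by simp
  moreover have "\<bar>P (s y)\<bar> \<le> H + e" for y
    using P(2)[OF sK[of y]] bd[of "a (s y)"] by auto
  ultimately show ?thesis using that by blast
qed

lemma trig_poly_continuous: "trig_poly q \<Longrightarrow> continuous_on UNIV q"
  by (induction rule: trig_poly.induct) (auto intro!: continuous_intros)

lemma trig_poly_bounded: "trig_poly q \<Longrightarrow> \<exists>B. \<forall>y. \<bar>q y\<bar> \<le> B"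
proof (induction rule: trig_poly.induct)
  case (wave a c b)
  have "\<bar>a * cos (c \<bullet> y + b)\<bar> \<le> \<bar>a\<bar> * 1" for y
    unfolding abs_mult by (intro mult_left_mono) auto
  then show ?case by auto
next
  case (add p q)
  then obtain A B where AB: "\<And>y. \<bar>p y\<bar> \<le> A" "\<And>y. \<bar>q y\<bar> \<le> B" by auto
  show ?case by (rule exI[of _ "A + B"]) (auto intro: order.trans[OF abs_triangle_ineq] add_mono AB)
qed

lemma cos_eq_Re_iexp: "cos (x + b) = Re (iexp b * iexp x)"
  by (simp add: Re_exp exp_add[symmetric] distrib_left[symmetric] add.commute flip: of_real_add)

text \<open>Levy's continuity theorem in several dimensions, where the limit law is already given.  Trigonometric polynomials are handled
by hypothesis, bounded continuous functions are close to them on a cube, and the mass outside the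
cube is controlled by the one-dimensional theorem applied to the coordinates.\<close>

theorem levy_continuity_euclidean:
  fixes Z :: "nat \<Rightarrow> 'a \<Rightarrow> 'c::euclidean_space" and Z' :: "'b \<Rightarrow> 'c"
  assumes M: "prob_space M" and N: "prob_space N"
    and Z[measurable]: "\<And>n. Z n \<in> borel_measurable M" and Z'[measurable]: "Z' \<in> borel_measurable N"
    and char: "\<And>c. (\<lambda>n. CLINT \<omega>|M. iexp (c \<bullet> Z n \<omega>)) \<longlonglongrightarrow> (CLINT \<omega>|N. iexp (c \<bullet> Z' \<omega>))"
  shows "converges_in_distribution M Z N Z'"
  unfolding converges_in_distribution_def
proof (intro conjI allI impI)
  interpret M: prob_space M by fact
  interpret N: prob_space N by fact
  fix h :: "'c \<Rightarrow> real" assume h: "continuous_on UNIV h \<and> bounded (range h)"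
  then obtain H where H: "\<And>y. \<bar>h y\<bar> \<le> H" by (auto simp: bounded_iff)
  have H0: "H \<ge> 0" using H[of 0] by auto
  have [measurable]: "h \<in> borel_measurable borel"
    using h by (auto intro: borel_measurable_continuous_onI)

  have trig: "(\<lambda>n. LINT \<omega>|M. q (Z n \<omega>)) \<longlonglongrightarrow> (LINT \<omega>|N. q (Z' \<omega>))" if "trig_poly q" for q
    using that
  proof (induction rule: trig_poly.induct)
    case (wave a c b)
    have "(LINT \<omega>|M. a * cos (c \<bullet> Z n \<omega> + b)) = a * Re (iexp b * (CLINT \<omega>|M. iexp (c \<bullet> Z n \<omega>)))" for n
      unfolding cos_eq_Re_iexp
      by (simp add: M.integrable_iexp)
    moreover have "(LINT \<omega>|N. a * cos (c \<bullet> Z' \<omega> + b)) = a * Re (iexp b * (CLINT \<omega>|N. iexp (c \<bullet> Z' \<omega>)))"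
      unfolding cos_eq_Re_iexp by (simp add: N.integrable_iexp)
    ultimately show ?case
      by (simp only:) (intro tendsto_intros char)
  next
    case (add p q)
    have [measurable]: "p \<in> borel_measurable borel" "q \<in> borel_measurable borel"
      using add.hyps trig_poly_continuous by (auto intro: borel_measurable_continuous_onI)
    obtain A B where AB: "\<And>y. \<bar>p y\<bar> \<le> A" "\<And>y. \<bar>q y\<bar> \<le> B"
      using add.hyps[THEN trig_poly_bounded] by auto
    have "integrable M (\<lambda>\<omega>. p (Z n \<omega>))" "integrable M (\<lambda>\<omega>. q (Z n \<omega>))" for n
      using AB by (auto intro: M.integrable_const_bound[of _ A] M.integrable_const_bound[of _ B])
    moreover have "integrable N (\<lambda>\<omega>. p (Z' \<omega>))" "integrable N (\<lambda>\<omega>. q (Z' \<omega>))"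
      using AB by (auto intro: N.integrable_const_bound[of _ A] N.integrable_const_bound[of _ B])
    ultimately show ?case
      using add.IH by (auto intro!: tendsto_add)
  qed

  have marginal: "(\<lambda>n. LINT \<omega>|M. f (c \<bullet> Z n \<omega>)) \<longlonglongrightarrow> (LINT \<omega>|N. f (c \<bullet> Z' \<omega>))"
    if f: "\<And>x. isCont f x" "\<And>x. \<bar>f x\<bar> \<le> B" for f :: "real \<Rightarrow> real" and B c
  proof -
    have [measurable]: "f \<in> borel_measurable borel"
      using f by (auto intro!: borel_measurable_continuous_onI continuous_at_imp_continuous_on)
    let ?P = "\<lambda>n. distr M borel (\<lambda>\<omega>. c \<bullet> Z n \<omega>)"
    let ?Q = "distr N borel (\<lambda>\<omega>. c \<bullet> Z' \<omega>)"
    have P: "real_distribution (?P n)" for n by (rule M.real_distribution_distr) simp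
    have Q: "real_distribution ?Q" by (rule N.real_distribution_distr) simp
    have "(\<lambda>n. char (?P n) t) \<longlonglongrightarrow> char ?Q t" for t
      using char[of "t *\<^sub>R c"] by (simp add: char_def integral_distr)
    from levy_continuity[OF P Q this] have "weak_conv_m ?P ?Q" .
    from weak_conv_imp_integral_bdd_continuous_conv[OF P Q this f(1), of B] f(2)
    show ?thesis by (simp add: integral_distr)
  qed

  show "(\<lambda>n. LINT \<omega>|M. h (Z n \<omega>)) \<longlonglongrightarrow> (LINT \<omega>|N. h (Z' \<omega>))"
  proof (rule tendstoI)
    fix e :: real assume e: "e > 0"
    (* the three errors below add up to at most (6 H + 6) d *)
    define d where "d = min 1 (e / (2 * (6 * H + 6)))"
    have d: "d > 0" "d \<le> 1" using e H0 by (auto simp: d_def)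
    have "(6 * H + 6) * d \<le> (6 * H + 6) * (e / (2 * (6 * H + 6)))"
      using H0 by (intro mult_left_mono) (auto simp: d_def)
    also have "\<dots> < e" using H0 e by (simp add: field_simps add_pos_nonneg)
    finally have de: "(6 * H + 6) * d < e" .
    (* a continuous substitute for the indicator of the complement of [-T, T] *)
    define f where "f T x = min 1 (max 0 (\<bar>x\<bar> - T))" for T x :: real
    have f: "isCont (f T) x" "\<bar>f T x\<bar> \<le> 1" "0 \<le> f T x" for T x
      unfolding f_def by (auto intro!: continuous_intros)
    have [measurable]: "f T \<in> borel_measurable borel" for T
      using f by (auto intro!: borel_measurable_continuous_onI continuous_at_imp_continuous_on)
    define \<Phi> where "\<Phi> T y = (\<Sum>i\<in>Basis. f T (i \<bullet> y))" for T and y :: 'c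
    have [measurable]: "\<Phi> T \<in> borel_measurable borel" for T unfolding \<Phi>_def by measurable
    have \<Phi>0: "0 \<le> \<Phi> T y" for T y unfolding \<Phi>_def using f by (intro sum_nonneg) auto
    have \<Phi>D: "\<Phi> T y \<le> DIM('c)" for T y
      unfolding \<Phi>_def using f sum_bounded_above[of "Basis::'c set" "\<lambda>i. f T (i \<bullet> y)" 1] by force
    have \<Phi>M: "integrable M (\<lambda>\<omega>. \<Phi> T (Z n \<omega>))" for T n
      using \<Phi>0 \<Phi>D by (auto intro!: M.integrable_const_bound[of _ "DIM('c)"])
    have \<Phi>N: "integrable N (\<lambda>\<omega>. \<Phi> T (Z' \<omega>))" for T
      using \<Phi>0 \<Phi>D by (auto intro!: N.integrable_const_bound[of _ "DIM('c)"])
    have \<Phi>lim: "(\<lambda>n. LINT \<omega>|M. \<Phi> T (Z n \<omega>)) \<longlonglongrightarrow> (LINT \<omega>|N. \<Phi> T (Z' \<omega>))" for T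
    proof -
      have "integrable M (\<lambda>\<omega>. f T (c \<bullet> Z n \<omega>))" for n c
        using f by (auto intro!: M.integrable_const_bound[of _ 1])
      moreover have "integrable N (\<lambda>\<omega>. f T (c \<bullet> Z' \<omega>))" for c
        using f by (auto intro!: N.integrable_const_bound[of _ 1])
      ultimately show ?thesis
        unfolding \<Phi>_def using f by (auto intro!: tendsto_sum marginal[of "f T" 1])
    qed
    have "(\<lambda>m. LINT \<omega>|N. \<Phi> (real m) (Z' \<omega>)) \<longlonglongrightarrow> (LINT \<omega>|N. 0)"
    proof (rule integral_dominated_convergence[where w="\<lambda>_. DIM('c)"])
      show "AE \<omega> in N. (\<lambda>m. \<Phi> (real m) (Z' \<omega>)) \<longlonglongrightarrow> 0"
      proof (rule AE_I2)
        fix \<omega>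
        have "(\<lambda>m. f (real m) x) \<longlonglongrightarrow> 0" for x
        proof (rule tendsto_eventually)
          show "\<forall>\<^sub>F m in sequentially. f (real m) x = 0"
            using eventually_ge_at_top[of "nat \<lceil>\<bar>x\<bar>\<rceil>"]
            by eventually_elim (auto simp: f_def max_def min_def; linarith)
        qed
        then show "(\<lambda>m. \<Phi> (real m) (Z' \<omega>)) \<longlonglongrightarrow> 0"
          unfolding \<Phi>_def by (intro tendsto_null_sum) auto
      qed
    qed (use \<Phi>0 \<Phi>D in auto)
    then have "\<forall>\<^sub>F m in sequentially. (LINT \<omega>|N. \<Phi> (real m) (Z' \<omega>)) < d"
      using d by (intro order_tendstoD(2)) auto
    then obtain m where m: "(LINT \<omega>|N. \<Phi> (real m) (Z' \<omega>)) < d"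
      by (auto dest!: eventually_happens)
    obtain q where q: "trig_poly q" "\<And>y. (\<And>i. i \<in> Basis \<Longrightarrow> \<bar>y \<bullet> i\<bar> \<le> real m + 1) \<Longrightarrow> \<bar>h y - q y\<bar> < d"
      "\<And>y. \<bar>q y\<bar> \<le> H + d"
      using trig_poly_approximates[of h H "real m + 1" d] h H d by auto
    have [measurable]: "q \<in> borel_measurable borel"
      using q(1) trig_poly_continuous by (auto intro: borel_measurable_continuous_onI)
    have close: "\<bar>h y - q y\<bar> \<le> d + (2 * H + 1) * \<Phi> (real m) y" for y
    proof (cases "\<forall>i\<in>Basis. \<bar>y \<bullet> i\<bar> \<le> real m + 1")
      case True
      then have "\<bar>h y - q y\<bar> \<le> d" using q(2)[of y] by auto
      also have "\<dots> \<le> d + (2 * H + 1) * \<Phi> (real m) y" using H0 \<Phi>0 by auto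
      finally show ?thesis .
    next
      case False
      then obtain i where i: "i \<in> Basis" "\<bar>y \<bullet> i\<bar> > real m + 1" by auto
      then have "1 = f (real m) (i \<bullet> y)" by (auto simp: f_def inner_commute)
      also have "\<dots> \<le> \<Phi> (real m) y" unfolding \<Phi>_def using f i by (intro member_le_sum) auto
      finally have "(2 * H + 1) * 1 \<le> (2 * H + 1) * \<Phi> (real m) y"
        using H0 by (intro mult_left_mono) auto
      moreover have "\<bar>h y - q y\<bar> \<le> H + (H + d)" using H[of y] q(3)[of y] by linarith
      then have "\<bar>h y - q y\<bar> \<le> d + (2 * H + 1) * 1" by simp
      ultimately show ?thesis by linarith
    qed
    have hM: "integrable M (\<lambda>\<omega>. h (Z n \<omega>))" "integrable M (\<lambda>\<omega>. q (Z n \<omega>))" for n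
      using H q(3) by (auto intro: M.integrable_const_bound[of _ H] M.integrable_const_bound[of _ "H + d"])
    have hN: "integrable N (\<lambda>\<omega>. h (Z' \<omega>))" "integrable N (\<lambda>\<omega>. q (Z' \<omega>))"
      using H q(3) by (auto intro: N.integrable_const_bound[of _ H] N.integrable_const_bound[of _ "H + d"])
    have closeM: "\<bar>(LINT \<omega>|M. h (Z n \<omega>)) - (LINT \<omega>|M. q (Z n \<omega>))\<bar> \<le> d + (2 * H + 1) * (LINT \<omega>|M. \<Phi> m (Z n \<omega>))" for n
    proof -
      have "\<bar>(LINT \<omega>|M. h (Z n \<omega>)) - (LINT \<omega>|M. q (Z n \<omega>))\<bar> \<le> (LINT \<omega>|M. \<bar>h (Z n \<omega>) - q (Z n \<omega>)\<bar>)"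
        using integral_abs_bound[of M "\<lambda>\<omega>. h (Z n \<omega>) - q (Z n \<omega>)"] hM by simp
      also have "\<dots> \<le> (LINT \<omega>|M. d + (2 * H + 1) * \<Phi> m (Z n \<omega>))"
        using hM \<Phi>M close by (intro integral_mono) auto
      also have "\<dots> = d + (2 * H + 1) * (LINT \<omega>|M. \<Phi> m (Z n \<omega>))"
        using \<Phi>M by (simp add: M.prob_space)
      finally show ?thesis .
    qed
    have closeN: "\<bar>(LINT \<omega>|N. h (Z' \<omega>)) - (LINT \<omega>|N. q (Z' \<omega>))\<bar> \<le> d + (2 * H + 1) * (LINT \<omega>|N. \<Phi> m (Z' \<omega>))"
    proof -
      have "\<bar>(LINT \<omega>|N. h (Z' \<omega>)) - (LINT \<omega>|N. q (Z' \<omega>))\<bar> \<le> (LINT \<omega>|N. \<bar>h (Z' \<omega>) - q (Z' \<omega>)\<bar>)"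
        using integral_abs_bound[of N "\<lambda>\<omega>. h (Z' \<omega>) - q (Z' \<omega>)"] hN by simp
      also have "\<dots> \<le> (LINT \<omega>|N. d + (2 * H + 1) * \<Phi> m (Z' \<omega>))"
        using hN \<Phi>N close by (intro integral_mono) auto
      also have "\<dots> = d + (2 * H + 1) * (LINT \<omega>|N. \<Phi> m (Z' \<omega>))"
        using \<Phi>N by (simp add: N.prob_space)
      finally show ?thesis .
    qed
    have "\<forall>\<^sub>F n in sequentially. (LINT \<omega>|M. \<Phi> m (Z n \<omega>)) < 2 * d"
      using \<Phi>lim[of m] m d by (intro order_tendstoD(2)) auto
    moreover have "\<forall>\<^sub>F n in sequentially. dist (LINT \<omega>|M. q (Z n \<omega>)) (LINT \<omega>|N. q (Z' \<omega>)) < d"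
      using trig[OF q(1)] d by (intro tendstoD) auto
    ultimately show "\<forall>\<^sub>F n in sequentially. dist (LINT \<omega>|M. h (Z n \<omega>)) (LINT \<omega>|N. h (Z' \<omega>)) < e"
    proof eventually_elim
      case (elim n)
      have "(2 * H + 1) * (LINT \<omega>|M. \<Phi> m (Z n \<omega>)) \<le> (2 * H + 1) * (2 * d)"
        "(2 * H + 1) * (LINT \<omega>|N. \<Phi> m (Z' \<omega>)) \<le> (2 * H + 1) * d"
        using elim m H0 by (auto intro!: mult_left_mono)
      with elim closeM[of n] closeN de show ?case
        unfolding dist_real_def by (simp add: algebra_simps)
    qed
  qed
qed auto

section \<open>A central limit theorem for triangular arrays of bounded functions\<close>

locale iid_sample = prob_space M for M :: "'a measure" +
  fixes Z :: "nat \<Rightarrow> 'a \<Rightarrow> 'd::topological_space" and Q :: "'d measure"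
  assumes indep: "indep_vars (\<lambda>_. borel) Z UNIV"
    and law: "\<And>i. distr M borel (Z i) = Q"
begin

lemma Z_measurable [measurable]: "Z i \<in> borel_measurable M"
  using indep by (auto simp: indep_vars_def)

lemma sets_Q [simp, measurable_cong]: "sets Q = sets borel"
  using law[of 0] by auto

lemma space_Q [simp]: "space Q = UNIV"
  using sets_eq_imp_space_eq[OF sets_Q] by simp

sublocale Q: prob_space Q
  using prob_space_distr[of "Z 0" borel] law[of 0] by simp

lemma Q_UNIV [simp]: "measure Q UNIV = 1"
  using Q.prob_space by simp

lemma integral_law:
  fixes f :: "'d \<Rightarrow> 'e::{banach, second_countable_topology}"
  shows "f \<in> borel_measurable borel \<Longrightarrow> (LINT \<omega>|M. f (Z i \<omega>)) = (LINT z|Q. f z)"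
  using law[of i] by (auto simp: integral_distr)

lemma prob_law: "S \<in> sets borel \<Longrightarrow> prob {\<omega>\<in>space M. Z i \<omega> \<in> S} = measure Q S"
  by (subst law[of i, symmetric], subst measure_distr) (auto intro!: arg_cong[where f=prob])

text \<open>The variance of the sum is \<open>n\<close> times the variance of one term, because the mixed terms vanish by
independence; the variance is bounded by the second moment.\<close>

lemma expectation_sum_squared:
  fixes f :: "'d \<Rightarrow> real"
  assumes [measurable]: "f \<in> borel_measurable borel" and bd: "\<And>z. \<bar>f z\<bar> \<le> B"
  shows "expectation (\<lambda>\<omega>. ((\<Sum>i=1..n. f (Z i \<omega>)) - n * (LINT z|Q. f z))\<^sup>2) \<le> n * (LINT z|Q. (f z)\<^sup>2)"
proof -
  define m where "m = (LINT z|Q. f z)"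
  define h where "h z = f z - m" for z
  have [measurable]: "h \<in> borel_measurable borel" unfolding h_def by measurable
  have Qf: "integrable Q f" using bd by (auto intro!: Q.integrable_const_bound[of _ B])
  have sq: "(f z)\<^sup>2 \<le> B\<^sup>2" for z using bd[of z] abs_ge_zero[of "f z"] by (metis power2_abs power_mono)
  have Qf2: "integrable Q (\<lambda>z. (f z)\<^sup>2)"
    using sq by (auto intro!: Q.integrable_const_bound[of _ "B\<^sup>2"])
  have bh: "\<bar>h z\<bar> \<le> B + \<bar>m\<bar>" for z using bd[of z] by (auto simp: h_def)
  have ih: "integrable M (\<lambda>\<omega>. h (Z i \<omega>))" for i
    using bh by (auto intro!: integrable_const_bound[of _ "B + \<bar>m\<bar>"])
  have bhh: "\<bar>h z * h z'\<bar> \<le> (B + \<bar>m\<bar>) * (B + \<bar>m\<bar>)" for z z'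
    unfolding abs_mult using bh[of z] bh[of z'] by (intro mult_mono) auto
  have ihh: "integrable M (\<lambda>\<omega>. h (Z i \<omega>) * h (Z j \<omega>))" for i j
    using bhh by (auto intro!: integrable_const_bound[of _ "(B + \<bar>m\<bar>) * (B + \<bar>m\<bar>)"])
  have h0: "(LINT z|Q. h z) = 0"
    unfolding h_def using Qf by (simp add: m_def Q.prob_space)
  have cross: "expectation (\<lambda>\<omega>. h (Z i \<omega>) * h (Z j \<omega>)) = (if i = j then (LINT z|Q. (h z)\<^sup>2) else 0)" for i j
  proof (cases "i = j")
    case True then show ?thesis using integral_law[of "\<lambda>z. (h z)\<^sup>2" j] by (simp add: power2_eq_square)
  next
    case False
    have "expectation (\<lambda>\<omega>. \<Prod>l\<in>{i, j}. h (Z l \<omega>)) = (\<Prod>l\<in>{i, j}. expectation (\<lambda>\<omega>. h (Z l \<omega>)))"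
      by (intro indep_vars_lebesgue_integral indep_vars_compose2[OF indep_vars_subset[OF indep]]) (auto simp: ih)
    then show ?thesis using False integral_law[of h] h0 by simp
  qed
  have "expectation (\<lambda>\<omega>. ((\<Sum>i=1..n. f (Z i \<omega>)) - n * m)\<^sup>2) = expectation (\<lambda>\<omega>. (\<Sum>i=1..n. \<Sum>j=1..n. h (Z i \<omega>) * h (Z j \<omega>)))"
    by (simp add: h_def power2_eq_square sum_product sum_subtractf flip: sum_product)
  also have "\<dots> = n * (LINT z|Q. (h z)\<^sup>2)"
    by (simp add: Bochner_Integration.integral_sum Bochner_Integration.integrable_sum ihh cross)
  also have "(LINT z|Q. (h z)\<^sup>2) = (LINT z|Q. (f z)\<^sup>2) - m\<^sup>2"
  proof -
    have "(LINT z|Q. (h z)\<^sup>2) = (LINT z|Q. ((f z)\<^sup>2 - 2 * m * f z) + m\<^sup>2)"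
      by (simp add: h_def power2_eq_square algebra_simps)
    also have "\<dots> = ((LINT z|Q. (f z)\<^sup>2) - 2 * m * m) + m\<^sup>2"
      using Qf Qf2 by (simp add: m_def Q.prob_space)
    finally show ?thesis by (simp add: power2_eq_square)
  qed
  also have "n * ((LINT z|Q. (f z)\<^sup>2) - m\<^sup>2) \<le> n * (LINT z|Q. (f z)\<^sup>2)"
    by (intro mult_left_mono) auto
  finally show ?thesis by (simp add: m_def)
qed

text \<open>The summands are bounded by \<open>b n \<rightarrow> 0\<close>, so the characteristic function of one of them is
\<open>1 - v n / 2\<close> up to an error \<open>b n * v n / 6\<close> with \<open>v n\<close> of order \<open>1 / n\<close>.  The \<open>n\<close>-th powers then
differ by \<open>o(1)\<close> from \<open>(1 - s / 2n)\<^sup>n\<close>.\<close>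

theorem bounded_triangular_array_clt:
  fixes f :: "nat \<Rightarrow> 'd \<Rightarrow> real"
  assumes [measurable]: "\<And>n. f n \<in> borel_measurable borel"
    and bd: "\<And>n z. \<bar>f n z\<bar> \<le> b n" and b: "b \<longlonglongrightarrow> 0"
    and mean: "\<And>n. (LINT z|Q. f n z) = 0"
    and var: "(\<lambda>n. n * (LINT z|Q. (f n z)\<^sup>2)) \<longlonglongrightarrow> s"
  shows "(\<lambda>n. CLINT \<omega>|M. iexp (\<Sum>i=1..n. f n (Z i \<omega>))) \<longlonglongrightarrow> complex_of_real (exp (- s / 2))"
proof -
  define v where "v n = (LINT z|Q. (f n z)\<^sup>2)" for n
  define \<psi> where "\<psi> n = char (distr Q borel (f n)) 1" for n
  have b0: "b n \<ge> 0" for n using bd[of n undefined] by auto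
  have sq: "(f n z)\<^sup>2 \<le> (b n)\<^sup>2" for n z
    using bd[of n z] abs_ge_zero[of "f n z"] by (metis power2_abs power_mono)
  have i1: "integrable Q (f n)" for n using bd by (auto intro!: Q.integrable_const_bound[of _ "b n"])
  have i2: "integrable Q (\<lambda>z. (f n z)\<^sup>2)" for n using sq by (auto intro!: Q.integrable_const_bound[of _ "(b n)\<^sup>2"])
  have v0: "0 \<le> v n" for n unfolding v_def by simp
  have prod: "(CLINT \<omega>|M. iexp (\<Sum>i=1..n. f n (Z i \<omega>))) = \<psi> n ^ n" for n
  proof -
    have "(CLINT \<omega>|M. iexp (\<Sum>i=1..n. f n (Z i \<omega>))) = char (distr M borel (\<lambda>\<omega>. \<Sum>i\<in>{1..n}. f n (Z i \<omega>))) 1"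
      by (simp add: char_def integral_distr)
    also have "\<dots> = (\<Prod>i\<in>{1..n}. char (distr M borel (\<lambda>\<omega>. f n (Z i \<omega>))) 1)"
      by (rule char_distr_sum, rule indep_vars_compose2[OF indep_vars_subset[OF indep]]) auto
    also have "\<dots> = (\<Prod>i\<in>{1..n}. \<psi> n)"
    proof (rule prod.cong)
      fix i
      have "distr Q borel (f n) = distr M borel (\<lambda>\<omega>. f n (Z i \<omega>))"
        unfolding law[of i, symmetric] by (subst distr_distr) (auto simp: comp_def)
      then show "char (distr M borel (\<lambda>\<omega>. f n (Z i \<omega>))) 1 = \<psi> n" by (simp add: \<psi>_def)
    qed simp
    finally show ?thesis by simp
  qed
  have approx: "cmod (\<psi> n - (1 - v n / 2)) \<le> b n * v n / 6" for n
  proof -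
    have "Q.variance (f n) = v n" by (simp add: mean v_def)
    from Q.char_approx3'[OF _ i1 i2 mean this refl, of 1]
    have "cmod (\<psi> n - (1 - v n / 2)) \<le> Q.expectation (\<lambda>x. min (6 * (f n x)\<^sup>2) (\<bar>f n x\<bar> ^ 3)) / 6"
      by (simp add: \<psi>_def)
    also have "Q.expectation (\<lambda>x. min (6 * (f n x)\<^sup>2) (\<bar>f n x\<bar> ^ 3)) \<le> Q.expectation (\<lambda>x. b n * (f n x)\<^sup>2)"
    proof (rule integral_mono)
      have *: "\<bar>min (6 * (f n x)\<^sup>2) (\<bar>f n x\<bar> ^ 3)\<bar> \<le> 6 * (b n)\<^sup>2" for x
        using sq[of n x] by (auto simp: min_def)
      show "integrable Q (\<lambda>x. min (6 * (f n x)\<^sup>2) (\<bar>f n x\<bar> ^ 3))"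
        using * by (auto intro!: Q.integrable_const_bound[of _ "6 * (b n)\<^sup>2"])
      fix x
      have "\<bar>f n x\<bar> ^ 3 = \<bar>f n x\<bar> * (f n x)\<^sup>2" by (simp add: power3_eq_cube power2_eq_square)
      also have "\<dots> \<le> b n * (f n x)\<^sup>2" using bd by (intro mult_right_mono) auto
      finally show "min (6 * (f n x)\<^sup>2) (\<bar>f n x\<bar> ^ 3) \<le> b n * (f n x)\<^sup>2" by auto
    qed (use i2 in auto)
    finally show ?thesis by (simp add: v_def)
  qed
  have s0: "0 \<le> s"
    using var by (rule LIMSEQ_le_const) (auto intro!: exI[of _ 0] mult_nonneg_nonneg)
  have "(\<lambda>n. \<psi> n ^ n - complex_of_real ((1 + (- s / 2) / n) ^ n)) \<longlonglongrightarrow> 0"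
  proof (rule Lim_null_comparison)
    show "\<forall>\<^sub>F n in sequentially. cmod (\<psi> n ^ n - complex_of_real ((1 + (- s / 2) / n) ^ n))
        \<le> b n * (n * v n) / 6 + \<bar>n * v n - s\<bar> / 2"
      (* for n > s the number 1 - s / 2n has modulus at most 1, as the comparison of powers requires *)
      using eventually_gt_at_top[of "nat \<lceil>s\<rceil>"]
    proof eventually_elim
      case (elim n)
      interpret D: real_distribution "distr Q borel (f n)" by (rule Q.real_distribution_distr) simp
      have n: "0 < n" "s \<le> n" using elim by linarith+
      have "norm (complex_of_real (1 + (- s / 2) / n)) \<le> 1"
        unfolding norm_of_real using n s0 by (auto simp: abs_le_iff field_simps)
      then have "cmod (\<psi> n ^ n - complex_of_real (1 + (- s / 2) / n) ^ n)
          \<le> n * cmod (\<psi> n - complex_of_real (1 + (- s / 2) / n))"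
        unfolding \<psi>_def by (intro norm_power_diff D.cmod_char_le_1)
      also have "cmod (\<psi> n - complex_of_real (1 + (- s / 2) / n))
          \<le> cmod (\<psi> n - (1 - v n / 2)) + cmod (complex_of_real ((1 - v n / 2) - (1 + (- s / 2) / n)))"
        using norm_triangle_ineq[of "\<psi> n - (1 - v n / 2)" "complex_of_real ((1 - v n / 2) - (1 + (- s / 2) / n))"]
        by (simp add: algebra_simps)
      also have "\<dots> \<le> b n * v n / 6 + \<bar>(1 - v n / 2) - (1 + (- s / 2) / n)\<bar>"
        using approx[of n] unfolding norm_of_real by (intro add_mono) auto
      also have "(1 - v n / 2) - (1 + (- s / 2) / n) = - (n * v n - s) / (2 * n)"
        using n by (simp add: field_simps)
      also have "n * (b n * v n / 6 + \<bar>- (n * v n - s) / (2 * n)\<bar>) = b n * (n * v n) / 6 + \<bar>n * v n - s\<bar> / 2"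
        using n by (simp add: abs_mult field_simps)
      finally show ?case using n by (simp add: mult_left_mono)
    qed
    have "(\<lambda>n. b n * (n * v n) / 6 + \<bar>n * v n - s\<bar> / 2) \<longlonglongrightarrow> 0 * s / 6 + \<bar>s - s\<bar> / 2"
      using var b unfolding v_def by (intro tendsto_intros) auto
    then show "(\<lambda>n. b n * (n * v n) / 6 + \<bar>n * v n - s\<bar> / 2) \<longlonglongrightarrow> 0" by simp
  qed
  moreover have "(\<lambda>n. complex_of_real ((1 + (- s / 2) / n) ^ n)) \<longlonglongrightarrow> complex_of_real (exp (- s / 2))"
    by (intro tendsto_of_real tendsto_exp_limit_sequentially)
  ultimately have "(\<lambda>n. (\<psi> n ^ n - complex_of_real ((1 + (- s / 2) / n) ^ n)) + complex_of_real ((1 + (- s / 2) / n) ^ n))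
      \<longlonglongrightarrow> 0 + complex_of_real (exp (- s / 2))"
    by (rule tendsto_add)
  then show ?thesis unfolding prod by simp
qed

end

section \<open>Integrals of Gaussian processes\<close>

lemma centered_normal_square_integrable:
  assumes "prob_space N" "centered_normal N Z"
  shows "integrable N (\<lambda>\<omega>. (Z \<omega>)\<^sup>2)"
proof -
  interpret prob_space N by fact
  have [measurable]: "Z \<in> borel_measurable N" using assms by (simp add: centered_normal_def)
  from assms(2) consider "AE \<omega> in N. Z \<omega> = 0" |
    \<sigma> where "\<sigma> > 0" "distributed N lborel Z (normal_density 0 \<sigma>)"
    by (auto simp: centered_normal_def)
  then show ?thesis
  proof cases
    case 1
    then have "integrable N (\<lambda>\<omega>. (Z \<omega>)\<^sup>2) \<longleftrightarrow> integrable N (\<lambda>\<omega>. 0 :: real)"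
      by (intro integrable_cong_AE) auto
    then show ?thesis by simp
  next
    case 2
    have "integrable lborel (\<lambda>x. normal_density 0 \<sigma> x * (x - 0) ^ 2)"
      using 2 by (intro integrable_normal_moment)
    then show ?thesis
      using distributed_integrable[OF 2(2), of "\<lambda>x. x\<^sup>2"] by simp
  qed
qed

lemma centered_normal_char:
  assumes "prob_space N" "centered_normal N Z"
  shows "(CLINT \<omega>|N. iexp (Z \<omega>)) = complex_of_real (exp (- (LINT \<omega>|N. (Z \<omega>)\<^sup>2) / 2))"
proof -
  interpret prob_space N by fact
  have [measurable]: "Z \<in> borel_measurable N" using assms by (simp add: centered_normal_def)
  from assms(2) consider "AE \<omega> in N. Z \<omega> = 0" |
    \<sigma> where "\<sigma> > 0" "distributed N lborel Z (normal_density 0 \<sigma>)"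
    by (auto simp: centered_normal_def)
  then show ?thesis
  proof cases
    case 1
    then have "(CLINT \<omega>|N. iexp (Z \<omega>)) = (CLINT \<omega>|N. 1)"
      by (intro integral_cong_AE) auto
    moreover have "(LINT \<omega>|N. (Z \<omega>)\<^sup>2) = (LINT \<omega>|N. 0)"
      using 1 by (intro integral_cong_AE) auto
    ultimately show ?thesis by (simp add: prob_space)
  next
    case 2
    have v: "(LINT \<omega>|N. (Z \<omega>)\<^sup>2) = \<sigma>\<^sup>2"
      using normal_distributed_variance[OF 2] normal_distributed_expectation[OF 2] by simp
    have "distributed N lborel (\<lambda>\<omega>. (Z \<omega> - 0) / \<sigma>) std_normal_density"
      using 2 normal_standard_normal_convert[OF 2(1), of Z 0] by simp
    then have d: "distr N lborel (\<lambda>\<omega>. Z \<omega> / \<sigma>) = std_normal_distribution"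
      by (simp add: distributed_distr_eq_density)
    have "(CLINT \<omega>|N. iexp (Z \<omega>)) = (CLINT \<omega>|N. iexp (\<sigma> * (Z \<omega> / \<sigma>)))"
      using 2 by simp
    also have "\<dots> = (CLINT x|distr N lborel (\<lambda>\<omega>. Z \<omega> / \<sigma>). iexp (\<sigma> * x))"
      by (subst integral_distr) auto
    also have "\<dots> = char std_normal_distribution \<sigma>"
      by (simp only: d char_def)
    also have "\<dots> = complex_of_real (exp (- (LINT \<omega>|N. (Z \<omega>)\<^sup>2) / 2))"
      by (simp add: char_std_normal_distribution v)
    finally show ?thesis .
  qed
qed

text \<open>An integral over an index that takes finitely many values is a finite linear combination; the joint
law of a Gaussian process only gives access to such combinations.\<close>

lemma finite_range_integral:
  fixes w :: "'s \<Rightarrow> real" and f :: "'i \<Rightarrow> real"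
  assumes [measurable]: "e \<in> measurable \<Lambda> (count_space UNIV)" and A: "finite A" "\<And>s. e s \<in> A"
    and w: "integrable \<Lambda> w"
  shows "(LINT s|\<Lambda>. w s * f (e s)) = (\<Sum>a\<in>A. (LINT s|\<Lambda>. w s * of_bool (e s = a)) * f a)"
proof -
  have [measurable]: "w \<in> borel_measurable \<Lambda>" using w by auto
  have i: "integrable \<Lambda> (\<lambda>s. w s * of_bool (e s = a))" for a
    by (rule Bochner_Integration.integrable_bound[OF w]) auto
  have "w s * f (e s) = (\<Sum>a\<in>A. w s * of_bool (e s = a) * f a)" for s
  proof -
    have "(\<Sum>a\<in>A. w s * of_bool (e s = a) * f a) = (\<Sum>a\<in>A. if e s = a then w s * f a else 0)"
      by (intro sum.cong) auto
    also have "\<dots> = w s * f (e s)" using A by (simp add: sum.delta)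
    finally show ?thesis by simp
  qed
  then show ?thesis using i by simp
qed

text \<open>The integral \<open>\<integral> w(s) W(e s) d\<Lambda>\<close> is centered normal with variance \<open>\<integral>\<integral> w(s) w(s') K(e s, e s')\<close>.
The index map \<open>e\<close> is approximated by maps \<open>em m\<close> with finite range.  For these the integral is a finite
linear combination and hence normal by definition of a Gaussian process.  Dominated convergence, along each
path and then for the covariance, passes to the limit, where the characteristic functions are compared.\<close>

theorem gaussian_process_integral:
  fixes W :: "'i \<Rightarrow> 'b \<Rightarrow> real" and w :: "'s \<Rightarrow> real" and e :: "'s \<Rightarrow> 'i" and em :: "nat \<Rightarrow> 's \<Rightarrow> 'i"
  assumes gp: "centered_gaussian_process N I K W" and w: "integrable \<Lambda> w"
    and em[measurable]: "\<And>m. em m \<in> measurable \<Lambda> (count_space UNIV)"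
    and fin: "\<And>m. finite (range (em m))" and sub: "\<And>m. range (em m) \<subseteq> I"
    and conv: "\<And>\<omega> s. \<omega> \<in> space N \<Longrightarrow> (\<lambda>m. W (em m s) \<omega>) \<longlonglongrightarrow> W (e s) \<omega>"
    and bd: "\<And>\<omega>. \<omega> \<in> space N \<Longrightarrow> \<exists>B. \<forall>m s. \<bar>W (em m s) \<omega>\<bar> \<le> B"
    and Kconv: "\<And>s s'. (\<lambda>m. K (em m s) (em m s')) \<longlonglongrightarrow> K (e s) (e s')"
    and Kbd: "\<And>m s s'. \<bar>K (em m s) (em m s')\<bar> \<le> C"
  shows gaussian_process_integral_measurable: "(\<lambda>\<omega>. LINT s|\<Lambda>. w s * W (e s) \<omega>) \<in> borel_measurable N"
    and gaussian_process_integral_integrable: "\<And>\<omega>. \<omega> \<in> space N \<Longrightarrow> integrable \<Lambda> (\<lambda>s. w s * W (e s) \<omega>)"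
    and gaussian_process_integral_char: "(CLINT \<omega>|N. iexp (LINT s|\<Lambda>. w s * W (e s) \<omega>)) =
      complex_of_real (exp (- (LINT s|\<Lambda>. w s * (LINT s'|\<Lambda>. w s' * K (e s) (e s'))) / 2))"
proof -
  interpret N: prob_space N using gp by (simp add: centered_gaussian_process_def)
  have [measurable]: "w \<in> borel_measurable \<Lambda>" using w by auto
  have gn: "centered_normal N (\<lambda>\<omega>. \<Sum>i\<in>S. c i * W i \<omega>)" if "finite S" "S \<subseteq> I" for S c
    using gp that by (auto simp: centered_gaussian_process_def)
  have gK: "(LINT \<omega>|N. W i \<omega> * W j \<omega>) = K i j" if "i \<in> I" "j \<in> I" for i j
    using gp that by (auto simp: centered_gaussian_process_def)
  have Wn: "centered_normal N (W i)" if "i \<in> I" for i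
    using gn[of "{i}" "\<lambda>_. 1"] that by simp
  have Wm: "W i \<in> borel_measurable N" if "i \<in> I" for i
    using Wn[OF that] by (simp add: centered_normal_def)
  have WW: "integrable N (\<lambda>\<omega>. W i \<omega> * W j \<omega>)" if "i \<in> I" "j \<in> I" for i j
  proof (rule Bochner_Integration.integrable_bound)
    show "integrable N (\<lambda>\<omega>. (W i \<omega>)\<^sup>2 + (W j \<omega>)\<^sup>2)"
      using that Wn centered_normal_square_integrable[OF N.prob_space_axioms] by auto
    show "(\<lambda>\<omega>. W i \<omega> * W j \<omega>) \<in> borel_measurable N" using Wm that by measurable
    have "\<bar>x * y\<bar> \<le> x\<^sup>2 + y\<^sup>2" for x y :: real
    proof -
      have "2 * (\<bar>x\<bar> * \<bar>y\<bar>) \<le> x\<^sup>2 + y\<^sup>2" using sum_squares_bound[of "\<bar>x\<bar>" "\<bar>y\<bar>"] by simp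
      moreover have "0 \<le> \<bar>x\<bar> * \<bar>y\<bar>" by simp
      ultimately show ?thesis unfolding abs_mult by linarith
    qed
    then show "AE \<omega> in N. norm (W i \<omega> * W j \<omega>) \<le> norm ((W i \<omega>)\<^sup>2 + (W j \<omega>)\<^sup>2)" by simp
  qed
  define c where "c m a = (LINT s|\<Lambda>. w s * of_bool (em m s = a))" for m a
  define Zm where "Zm m \<omega> = (\<Sum>a\<in>range (em m). c m a * W a \<omega>)" for m \<omega>
  have Zm_eq: "Zm m \<omega> = (LINT s|\<Lambda>. w s * W (em m s) \<omega>)" for m \<omega>
    unfolding Zm_def c_def using finite_range_integral[where e="em m" and f="\<lambda>a. W a \<omega>", OF em fin[of m] _ w] by simp
  have Zmn: "centered_normal N (Zm m)" for m
    unfolding Zm_def[abs_def] using fin sub by (intro gn) auto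
  have Zmm[measurable]: "Zm m \<in> borel_measurable N" for m
    using Zmn[of m] by (simp add: centered_normal_def)
  have Wem: "(\<lambda>s. W (em m s) \<omega>) \<in> borel_measurable \<Lambda>" for m \<omega>
    by (rule measurable_compose[OF em]) simp
  have We: "(\<lambda>s. W (e s) \<omega>) \<in> borel_measurable \<Lambda>" if "\<omega> \<in> space N" for \<omega>
    using conv[OF that] Wem by (rule borel_measurable_LIMSEQ_metric[rotated])
  have Wbd: "\<exists>B\<ge>0. (\<forall>m s. \<bar>W (em m s) \<omega>\<bar> \<le> B) \<and> (\<forall>s. \<bar>W (e s) \<omega>\<bar> \<le> B)" if \<omega>: "\<omega> \<in> space N" for \<omega>
  proof -
    obtain B where B: "\<And>m s. \<bar>W (em m s) \<omega>\<bar> \<le> B" using bd[OF \<omega>] by auto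
    have "\<bar>W (e s) \<omega>\<bar> \<le> B" for s
      by (rule LIMSEQ_le_const2[OF tendsto_rabs[OF conv[OF \<omega>, of s]]]) (use B in auto)
    then show ?thesis using B order.trans[OF abs_ge_zero B[of undefined undefined]] by (intro exI[of _ B]) auto
  qed
  show int: "integrable \<Lambda> (\<lambda>s. w s * W (e s) \<omega>)" if \<omega>: "\<omega> \<in> space N" for \<omega>
  proof -
    obtain B where B: "B \<ge> 0" "\<And>s. \<bar>W (e s) \<omega>\<bar> \<le> B" using Wbd[OF \<omega>] by auto
    have "integrable \<Lambda> (\<lambda>s. B * w s)" using w by simp
    then show ?thesis
    proof (rule Bochner_Integration.integrable_bound)
      show "(\<lambda>s. w s * W (e s) \<omega>) \<in> borel_measurable \<Lambda>" using We[OF \<omega>] by measurable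
      show "AE s in \<Lambda>. norm (w s * W (e s) \<omega>) \<le> norm (B * w s)"
        using B by (auto simp: abs_mult mult.commute[of _ "\<bar>w _\<bar>"] intro!: mult_left_mono)
    qed
  qed
  define Z where "Z \<omega> = (LINT s|\<Lambda>. w s * W (e s) \<omega>)" for \<omega>
  have ZmZ: "(\<lambda>m. Zm m \<omega>) \<longlonglongrightarrow> Z \<omega>" if \<omega>: "\<omega> \<in> space N" for \<omega>
  proof -
    obtain B where B: "B \<ge> 0" "\<And>m s. \<bar>W (em m s) \<omega>\<bar> \<le> B" using Wbd[OF \<omega>] by auto
    show ?thesis unfolding Zm_eq Z_def
    proof (rule integral_dominated_convergence[where w="\<lambda>s. B * \<bar>w s\<bar>"])
      show "AE s in \<Lambda>. norm (w s * W (em m s) \<omega>) \<le> B * \<bar>w s\<bar>" for m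
        using B by (auto simp: abs_mult mult.commute[of _ "\<bar>w _\<bar>"] intro!: mult_left_mono)
    qed (use w We[OF \<omega>] Wem conv[OF \<omega>] in \<open>auto intro!: tendsto_mult\<close>)
  qed
  show meas: "(\<lambda>\<omega>. LINT s|\<Lambda>. w s * W (e s) \<omega>) \<in> borel_measurable N"
    unfolding Z_def[symmetric] using ZmZ Zmm by (rule borel_measurable_LIMSEQ_metric[rotated])
  then have [measurable]: "Z \<in> borel_measurable N" unfolding Z_def[abs_def] .
  have var: "(LINT \<omega>|N. (Zm m \<omega>)\<^sup>2) = (LINT s|\<Lambda>. w s * (LINT s'|\<Lambda>. w s' * K (em m s) (em m s')))" for m
  proof -
    let ?A = "range (em m)"
    have "(LINT \<omega>|N. (Zm m \<omega>)\<^sup>2) = (LINT \<omega>|N. (\<Sum>a\<in>?A. \<Sum>b\<in>?A. c m a * c m b * (W a \<omega> * W b \<omega>)))"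
      unfolding Zm_def power2_eq_square sum_product by (simp add: mult_ac)
    also have "\<dots> = (\<Sum>a\<in>?A. \<Sum>b\<in>?A. c m a * c m b * K a b)"
    proof -
      have "(LINT \<omega>|N. (\<Sum>a\<in>?A. \<Sum>b\<in>?A. c m a * c m b * (W a \<omega> * W b \<omega>))) =
          (\<Sum>a\<in>?A. \<Sum>b\<in>?A. (LINT \<omega>|N. c m a * c m b * (W a \<omega> * W b \<omega>)))"
        using WW sub by (subst Bochner_Integration.integral_sum;
            (intro sum.cong refl Bochner_Integration.integral_sum Bochner_Integration.integrable_sum
              Bochner_Integration.integrable_mult_right)?) (auto simp: image_subset_iff)
      also have "\<dots> = (\<Sum>a\<in>?A. \<Sum>b\<in>?A. c m a * c m b * K a b)"
        using gK sub by (intro sum.cong refl) (auto simp: subset_iff)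
      finally show ?thesis .
    qed
    also have "\<dots> = (\<Sum>a\<in>?A. c m a * (\<Sum>b\<in>?A. c m b * K a b))"
      by (simp add: sum_distrib_left mult_ac)
    also have "\<dots> = (LINT s|\<Lambda>. w s * (\<Sum>b\<in>?A. c m b * K (em m s) b))"
      unfolding c_def[of m a for a] using finite_range_integral[where e="em m" and f="\<lambda>a. \<Sum>b\<in>?A. c m b * K a b", OF em fin[of m] _ w]
      by (simp add: c_def)
    also have "\<dots> = (LINT s|\<Lambda>. w s * (LINT s'|\<Lambda>. w s' * K (em m s) (em m s')))"
      unfolding c_def by (subst finite_range_integral[where e="em m", OF em fin[of m] _ w]) auto
    finally show ?thesis .
  qed
  have C0: "0 \<le> C" using Kbd[of undefined undefined undefined] by linarith
  have inner: "(\<lambda>m. LINT s'|\<Lambda>. w s' * K (em m s) (em m s')) \<longlonglongrightarrow> (LINT s'|\<Lambda>. w s' * K (e s) (e s'))" for s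
  proof (rule integral_dominated_convergence[where w="\<lambda>s'. C * \<bar>w s'\<bar>"])
    have *: "(\<lambda>s'. K (em m s) (em m s')) \<in> borel_measurable \<Lambda>" for m
      by (rule measurable_compose[OF em]) simp
    then have "(\<lambda>s'. K (e s) (e s')) \<in> borel_measurable \<Lambda>"
      using Kconv by (rule borel_measurable_LIMSEQ_metric)
    then show "(\<lambda>s'. w s' * K (e s) (e s')) \<in> borel_measurable \<Lambda>" by measurable
    show "(\<lambda>s'. w s' * K (em m s) (em m s')) \<in> borel_measurable \<Lambda>" for m using * by measurable
    show "AE s' in \<Lambda>. norm (w s' * K (em m s) (em m s')) \<le> C * \<bar>w s'\<bar>" for m
      using Kbd by (auto simp: abs_mult mult.commute[of _ "\<bar>w _\<bar>"] intro!: mult_left_mono)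
  qed (use w Kconv in \<open>auto intro!: tendsto_mult\<close>)
  have "(\<lambda>m. LINT s|\<Lambda>. w s * (LINT s'|\<Lambda>. w s' * K (em m s) (em m s'))) \<longlonglongrightarrow>
      (LINT s|\<Lambda>. w s * (LINT s'|\<Lambda>. w s' * K (e s) (e s')))"
  proof (rule integral_dominated_convergence[where w="\<lambda>s. (C * (LINT s'|\<Lambda>. \<bar>w s'\<bar>)) * \<bar>w s\<bar>"])
    have *: "(\<lambda>s. LINT s'|\<Lambda>. w s' * K (em m s) (em m s')) \<in> borel_measurable \<Lambda>" for m
      by (rule measurable_compose[OF em[of m], of "\<lambda>a. LINT s'|\<Lambda>. w s' * K a (em m s')"]) simp
    then have "(\<lambda>s. LINT s'|\<Lambda>. w s' * K (e s) (e s')) \<in> borel_measurable \<Lambda>"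
      using inner by (rule borel_measurable_LIMSEQ_metric)
    then show "(\<lambda>s. w s * (LINT s'|\<Lambda>. w s' * K (e s) (e s'))) \<in> borel_measurable \<Lambda>" by measurable
    show "(\<lambda>s. w s * (LINT s'|\<Lambda>. w s' * K (em m s) (em m s'))) \<in> borel_measurable \<Lambda>" for m using * by measurable
    show "AE s in \<Lambda>. norm (w s * (LINT s'|\<Lambda>. w s' * K (em m s) (em m s'))) \<le> C * (LINT s'|\<Lambda>. \<bar>w s'\<bar>) * \<bar>w s\<bar>" for m
    proof (rule AE_I2)
      fix s
      have "norm (LINT s'|\<Lambda>. w s' * K (em m s) (em m s')) \<le> (LINT s'|\<Lambda>. C * \<bar>w s'\<bar>)"
      proof (rule order.trans[OF integral_norm_bound], rule integral_mono)
        have le: "norm (w s' * K (em m s) (em m s')) \<le> C * \<bar>w s'\<bar>" for s'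
          using Kbd by (auto simp: abs_mult mult.commute[of _ "\<bar>w _\<bar>"] intro!: mult_left_mono)
        then show "norm (w s' * K (em m s) (em m s')) \<le> C * \<bar>w s'\<bar>" for s' .
        show i: "integrable \<Lambda> (\<lambda>s'. C * \<bar>w s'\<bar>)" using w by auto
        have [measurable]: "(\<lambda>s'. K (em m s) (em m s')) \<in> borel_measurable \<Lambda>"
          by (rule measurable_compose[OF em]) simp
        show "integrable \<Lambda> (\<lambda>s'. norm (w s' * K (em m s) (em m s')))"
          by (rule Bochner_Integration.integrable_bound[OF i]) (use order.trans[OF le abs_ge_self] in auto)
      qed
      then show "norm (w s * (LINT s'|\<Lambda>. w s' * K (em m s) (em m s'))) \<le> C * (LINT s'|\<Lambda>. \<bar>w s'\<bar>) * \<bar>w s\<bar>"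
        by (simp add: abs_mult mult.commute[of _ "\<bar>w s\<bar>"] mult_left_mono)
    qed
  qed (use w inner in \<open>auto intro!: tendsto_mult\<close>)
  then have "(\<lambda>m. complex_of_real (exp (- (LINT \<omega>|N. (Zm m \<omega>)\<^sup>2) / 2))) \<longlonglongrightarrow>
      complex_of_real (exp (- (LINT s|\<Lambda>. w s * (LINT s'|\<Lambda>. w s' * K (e s) (e s'))) / 2))"
    unfolding var by (intro tendsto_intros) auto
  moreover have "(\<lambda>m. CLINT \<omega>|N. iexp (Zm m \<omega>)) \<longlonglongrightarrow> (CLINT \<omega>|N. iexp (Z \<omega>))"
    by (rule integral_dominated_convergence[where w="\<lambda>_. 1"]) (auto intro!: tendsto_intros ZmZ)
  ultimately show "(CLINT \<omega>|N. iexp (LINT s|\<Lambda>. w s * W (e s) \<omega>)) =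
      complex_of_real (exp (- (LINT s|\<Lambda>. w s * (LINT s'|\<Lambda>. w s' * K (e s) (e s'))) / 2))"
    unfolding centered_normal_char[OF N.prob_space_axioms Zmn, symmetric] Z_def[symmetric]
    by (rule LIMSEQ_unique[symmetric])
qed

section \<open>Tail copulas\<close>

text \<open>The law of \<open>(U, V)\<close>, the transforms of the two coordinates to uniform variables, and the
tail copula \<open>R\<close> that describes its mass near the origin.\<close>

text \<open>The right derivative \<open>d\<close> of a convex function is monotone, so it has countably many discontinuities,
and difference quotients at \<open>x\<close> lie between \<open>d x\<close> and \<open>d y\<close>, which squeezes them at a point of continuity.\<close>

lemma convex_differentiable_off_countable:
  fixes f :: "real \<Rightarrow> real"
  assumes f: "convex_on S f" and S: "open S"
  obtains D where "countable D" "\<And>x. x \<in> S \<Longrightarrow> x \<notin> D \<Longrightarrow> f differentiable (at x)"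
proof -
  define sl where "sl x y = (f x - f y) / (x - y)" for x y
  have sl_sym: "sl x y = sl y x" for x y
    unfolding sl_def using minus_divide_divide[of "f x - f y" "x - y"] by simp
  have sl1: "sl x t \<le> sl x y" and sl2: "sl x y \<le> sl t y" if "x \<in> S" "y \<in> S" "x < t" "t < y" for x t y
    using convex_on_slope_le[OF f that] by (auto simp: sl_def)
  have sl3: "sl x t \<le> sl t y" if "x \<in> S" "y \<in> S" "x < t" "t < y" for x t y
    using sl1[OF that] sl2[OF that] by linarith
  define d where "d x = (INF y\<in>{y\<in>S. x < y}. sl x y)" for x
  have left: "\<exists>y\<in>S. y < x" and right: "\<exists>y\<in>S. x < y" if x: "x \<in> S" for x
  proof -
    obtain e where e: "e > 0" "cball x e \<subseteq> S" using S x open_contains_cball by blast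
    have "x - e \<in> S" "x + e \<in> S" using e by (auto simp: dist_real_def subset_iff)
    then show "\<exists>y\<in>S. y < x" "\<exists>y\<in>S. x < y" using e(1) by (force, force)
  qed
  have d_le: "d x \<le> sl x y" if xy: "x \<in> S" "y \<in> S" "x < y" for x y
    unfolding d_def
  proof (rule cINF_lower)
    obtain w where w: "w \<in> S" "w < x" using left[OF xy(1)] by auto
    show "bdd_below (sl x ` {y \<in> S. x < y})"
      by (rule bdd_belowI2[of _ "sl w x"]) (use sl3[OF w(1) _ w(2)] that in auto)
  qed (use that in auto)
  have le_d: "sl x y \<le> d y" if "x \<in> S" "y \<in> S" "x < y" for x y
    unfolding d_def
    by (rule cINF_greatest) (use right[OF that(2)] sl3[OF that(1) _ that(3)] in auto)
  have mono: "mono_on S d"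
  proof (rule mono_onI)
    fix x y assume "x \<in> S" "y \<in> S" "x \<le> y"
    then show "d x \<le> d y"
      using d_le[of x y] le_d[of x y] by (cases "x = y") auto
  qed
  show ?thesis
  proof
    show "countable {x\<in>S. \<not> isCont d x}"
      by (rule mono_on_ctble_discont_open[OF S mono])
  next
    fix x assume x: "x \<in> S" "x \<notin> {x\<in>S. \<not> isCont d x}"
    then have lim: "(d \<longlongrightarrow> d x) (at x)" by (auto simp: isCont_def)
    have near: "\<forall>\<^sub>F y in at x. y \<in> S"
      using S x by (simp add: eventually_at_in_open' )
    have "((\<lambda>y. sl x y) \<longlongrightarrow> d x) (at x)"
    proof (rule tendsto_sandwich)
      show "\<forall>\<^sub>F y in at x. min (d x) (d y) \<le> sl x y"
        using near eventually_neq_at_within[of x x UNIV]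
      proof eventually_elim
        case (elim y) then show ?case
          using d_le[of x y] d_le[of y x] le_d[of y x] sl_sym[of x y] x by (cases "x < y") auto
      qed
      show "\<forall>\<^sub>F y in at x. sl x y \<le> max (d x) (d y)"
        using near eventually_neq_at_within[of x x UNIV]
      proof eventually_elim
        case (elim y) then show ?case
          using le_d[of x y] le_d[of y x] sl_sym[of x y] x by (cases "x < y") auto
      qed
    qed (use tendsto_min[OF tendsto_const lim, of "d x"] tendsto_max[OF tendsto_const lim, of "d x"] in auto)
    then have "(f has_real_derivative d x) (at x)"
      by (simp only: sl_sym[of x]) (simp add: has_field_derivative_iff sl_def)
    then show "f differentiable (at x)"
      by (auto simp: real_differentiable_def)
  qed
qed

lemma sets_borel_Collect_pair:
  fixes P :: "real \<times> real \<Rightarrow> bool"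
  assumes "Measurable.pred (borel \<Otimes>\<^sub>M borel) P"
  shows "{z. P z} \<in> sets borel"
  using assms by (simp add: pred_def borel_prod)

lemma borel_rectangles [simp]:
  fixes a b c d :: real
  shows "{z :: real \<times> real. fst z \<le> a} \<in> sets borel" "{z :: real \<times> real. snd z \<le> a} \<in> sets borel"
    "{z. fst z \<le> a \<and> snd z \<le> c} \<in> sets borel" "{z. fst z \<le> a \<or> snd z \<le> c} \<in> sets borel"
    "{z :: real \<times> real. a < fst z \<and> fst z \<le> b} \<in> sets borel" "{z :: real \<times> real. a < snd z \<and> snd z \<le> b} \<in> sets borel"
    "{z. a < fst z \<and> fst z \<le> b \<and> snd z \<le> c} \<in> sets borel"
    "{z. fst z \<le> c \<and> a < snd z \<and> snd z \<le> b} \<in> sets borel"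
proof -
  note * = sets_borel_Collect_pair
  show "{z :: real \<times> real. fst z \<le> a} \<in> sets borel" by (rule *) measurable
  show "{z :: real \<times> real. snd z \<le> a} \<in> sets borel" by (rule *) measurable
  show "{z. fst z \<le> a \<and> snd z \<le> c} \<in> sets borel" by (rule *) measurable
  show "{z. fst z \<le> a \<or> snd z \<le> c} \<in> sets borel" by (rule *) measurable
  show "{z :: real \<times> real. a < fst z \<and> fst z \<le> b} \<in> sets borel" by (rule *) measurable
  show "{z :: real \<times> real. a < snd z \<and> snd z \<le> b} \<in> sets borel" by (rule *) measurable
  show "{z. a < fst z \<and> fst z \<le> b \<and> snd z \<le> c} \<in> sets borel" by (rule *) measurable
  show "{z. fst z \<le> c \<and> a < snd z \<and> snd z \<le> b} \<in> sets borel" by (rule *) measurable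
qed

locale tail_copula = prob_space Q for Q :: "(real \<times> real) measure" +
  fixes R :: "real \<Rightarrow> real \<Rightarrow> real"
  assumes sets_borel [measurable_cong, simp]: "sets Q = sets borel"
    and uniform1: "\<And>s. 0 \<le> s \<Longrightarrow> s \<le> 1 \<Longrightarrow> measure Q {z. fst z \<le> s} = s"
    and uniform2: "\<And>s. 0 \<le> s \<Longrightarrow> s \<le> 1 \<Longrightarrow> measure Q {z. snd z \<le> s} = s"
    and tail_limit: "\<And>x y. 0 \<le> x \<Longrightarrow> 0 \<le> y \<Longrightarrow>
      ((\<lambda>t. measure Q {z. fst z \<le> t * x \<and> snd z \<le> t * y} / t) \<longlongrightarrow> R x y) (at_right 0)"
begin

lemma space_eq_UNIV [simp]: "space Q = UNIV"
  using sets_eq_imp_space_eq[OF sets_borel] by simp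

definition cop :: "real \<Rightarrow> real \<Rightarrow> real" where
  "cop u v = measure Q {z. fst z \<le> u \<and> snd z \<le> v}"

lemma cop_increment1:
  assumes "u \<le> u'"
  shows "cop u' v - cop u v = measure Q {z. u < fst z \<and> fst z \<le> u' \<and> snd z \<le> v}"
proof -
  have "{z. u < fst z \<and> fst z \<le> u' \<and> snd z \<le> v} =
      {z. fst z \<le> u' \<and> snd z \<le> v} - {z::real\<times>real. fst z \<le> u \<and> snd z \<le> v}" by auto
  moreover have "measure Q ({z. fst z \<le> u' \<and> snd z \<le> v} - {z::real\<times>real. fst z \<le> u \<and> snd z \<le> v}) =
      measure Q {z. fst z \<le> u' \<and> snd z \<le> v} - measure Q {z::real\<times>real. fst z \<le> u \<and> snd z \<le> v}"
    using assms by (intro finite_measure_Diff) auto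
  ultimately show ?thesis by (simp add: cop_def)
qed

lemma cop_increment2:
  assumes "v \<le> v'"
  shows "cop u v' - cop u v = measure Q {z. fst z \<le> u \<and> v < snd z \<and> snd z \<le> v'}"
proof -
  have "{z. fst z \<le> u \<and> v < snd z \<and> snd z \<le> v'} =
      {z. fst z \<le> u \<and> snd z \<le> v'} - {z::real\<times>real. fst z \<le> u \<and> snd z \<le> v}" by auto
  moreover have "measure Q ({z. fst z \<le> u \<and> snd z \<le> v'} - {z::real\<times>real. fst z \<le> u \<and> snd z \<le> v}) =
      measure Q {z. fst z \<le> u \<and> snd z \<le> v'} - measure Q {z::real\<times>real. fst z \<le> u \<and> snd z \<le> v}"
    using assms by (intro finite_measure_Diff) auto
  ultimately show ?thesis by (simp add: cop_def)
qed

lemma uniform1_strip: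
  assumes "0 \<le> u" "u \<le> u'" "u' \<le> 1"
  shows "measure Q {z. u < fst z \<and> fst z \<le> u'} = u' - u"
proof -
  have "{z. u < fst z \<and> fst z \<le> u'} = {z. fst z \<le> u'} - {z::real\<times>real. fst z \<le> u}" by auto
  moreover have "measure Q ({z. fst z \<le> u'} - {z::real\<times>real. fst z \<le> u}) =
      measure Q {z. fst z \<le> u'} - measure Q {z::real\<times>real. fst z \<le> u}"
    using assms by (intro finite_measure_Diff) auto
  ultimately show ?thesis using assms uniform1[of u] uniform1[of u'] by simp
qed

lemma uniform2_strip:
  assumes "0 \<le> u" "u \<le> u'" "u' \<le> 1"
  shows "measure Q {z. u < snd z \<and> snd z \<le> u'} = u' - u"
proof -
  have "{z. u < snd z \<and> snd z \<le> u'} = {z. snd z \<le> u'} - {z::real\<times>real. snd z \<le> u}" by auto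
  moreover have "measure Q ({z. snd z \<le> u'} - {z::real\<times>real. snd z \<le> u}) =
      measure Q {z. snd z \<le> u'} - measure Q {z::real\<times>real. snd z \<le> u}"
    using assms by (intro finite_measure_Diff) auto
  ultimately show ?thesis using assms uniform2[of u] uniform2[of u'] by simp
qed

lemma cop_limit: "0 \<le> x \<Longrightarrow> 0 \<le> y \<Longrightarrow> ((\<lambda>t. cop (t * x) (t * y) / t) \<longlongrightarrow> R x y) (at_right 0)"
  unfolding cop_def by (rule tail_limit)

lemma eventually_scale_le_1: "\<forall>\<^sub>F t::real in at_right 0. 0 < t \<and> t * x \<le> 1"
proof (rule eventually_at_rightI)
  show "0 < t \<and> t * x \<le> 1" if "t \<in> {0<..<1 / (\<bar>x\<bar> + 1)}" for t
  proof -
    have "t * x \<le> t * (\<bar>x\<bar> + 1)" using that by (intro mult_left_mono) auto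
    also have "\<dots> \<le> 1" using that by (auto simp: field_simps)
    finally show ?thesis using that by auto
  qed
qed auto

text \<open>A strip \<open>u < U \<le> u'\<close> has mass \<open>u' - u\<close>, which makes \<open>R\<close> increasing and 1-Lipschitz in each variable.\<close>

lemma R_increment1:
  assumes "0 \<le> x" "x \<le> x'" "0 \<le> y"
  shows "0 \<le> R x' y - R x y" "R x' y - R x y \<le> x' - x"
proof -
  have lim: "((\<lambda>t. (cop (t * x') (t * y) / t - cop (t * x) (t * y) / t)) \<longlongrightarrow> R x' y - R x y) (at_right 0)"
    using assms by (intro tendsto_diff cop_limit) auto
  have ev: "\<forall>\<^sub>F t in at_right 0. 0 \<le> cop (t * x') (t * y) / t - cop (t * x) (t * y) / t \<and>
      cop (t * x') (t * y) / t - cop (t * x) (t * y) / t \<le> x' - x"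
    using eventually_scale_le_1[of x']
  proof eventually_elim
    case (elim t)
    have "cop (t * x') (t * y) - cop (t * x) (t * y) \<le> measure Q {z. t * x < fst z \<and> fst z \<le> t * x'}"
      using elim assms by (subst cop_increment1) (auto intro!: finite_measure_mono mult_left_mono)
    also have "\<dots> = t * x' - t * x"
      using elim assms by (intro uniform1_strip) (auto intro!: mult_left_mono)
    finally have "(cop (t * x') (t * y) - cop (t * x) (t * y)) / t \<le> x' - x"
      using elim by (subst divide_le_eq) (auto simp: algebra_simps)
    moreover have "0 \<le> (cop (t * x') (t * y) - cop (t * x) (t * y)) / t"
      using elim assms by (subst cop_increment1) (auto intro!: mult_left_mono)
    ultimately show ?case by (simp add: diff_divide_distrib)
  qed
  show "0 \<le> R x' y - R x y"
    by (rule tendsto_lowerbound[OF lim]) (use ev in \<open>auto elim: eventually_mono\<close>)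
  show "R x' y - R x y \<le> x' - x"
    by (rule tendsto_upperbound[OF lim]) (use ev in \<open>auto elim: eventually_mono\<close>)
qed

lemma R_increment2:
  assumes "0 \<le> y" "y \<le> y'" "0 \<le> x"
  shows "0 \<le> R x y' - R x y" "R x y' - R x y \<le> y' - y"
proof -
  have lim: "((\<lambda>t. (cop (t * x) (t * y') / t - cop (t * x) (t * y) / t)) \<longlongrightarrow> R x y' - R x y) (at_right 0)"
    using assms by (intro tendsto_diff cop_limit) auto
  have ev: "\<forall>\<^sub>F t in at_right 0. 0 \<le> cop (t * x) (t * y') / t - cop (t * x) (t * y) / t \<and>
      cop (t * x) (t * y') / t - cop (t * x) (t * y) / t \<le> y' - y"
    using eventually_scale_le_1[of y']
  proof eventually_elim
    case (elim t)
    have "cop (t * x) (t * y') - cop (t * x) (t * y) \<le> measure Q {z. t * y < snd z \<and> snd z \<le> t * y'}"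
      using elim assms by (subst cop_increment2) (auto intro!: finite_measure_mono mult_left_mono)
    also have "\<dots> = t * y' - t * y"
      using elim assms by (intro uniform2_strip) (auto intro!: mult_left_mono)
    finally have "(cop (t * x) (t * y') - cop (t * x) (t * y)) / t \<le> y' - y"
      using elim by (subst divide_le_eq) (auto simp: algebra_simps)
    moreover have "0 \<le> (cop (t * x) (t * y') - cop (t * x) (t * y)) / t"
      using elim assms by (subst cop_increment2) (auto intro!: mult_left_mono)
    ultimately show ?case by (simp add: diff_divide_distrib)
  qed
  show "0 \<le> R x y' - R x y"
    by (rule tendsto_lowerbound[OF lim]) (use ev in \<open>auto elim: eventually_mono\<close>)
  show "R x y' - R x y \<le> y' - y"
    by (rule tendsto_upperbound[OF lim]) (use ev in \<open>auto elim: eventually_mono\<close>)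
qed

text \<open>Rectangles have nonnegative mass; together with homogeneity this is the source of concavity.\<close>

lemma R_two_increasing:
  assumes "0 \<le> x" "x \<le> x'" "0 \<le> y" "y \<le> y'"
  shows "R x' y - R x y \<le> R x' y' - R x y'"
proof (rule tendsto_le)
  show "((\<lambda>t. (cop (t * x') (t * y) / t - cop (t * x) (t * y) / t)) \<longlongrightarrow> R x' y - R x y) (at_right 0)"
    "((\<lambda>t. (cop (t * x') (t * y') / t - cop (t * x) (t * y') / t)) \<longlongrightarrow> R x' y' - R x y') (at_right 0)"
    using assms by (auto intro!: tendsto_diff cop_limit)
  show "\<forall>\<^sub>F t in at_right 0. cop (t * x') (t * y) / t - cop (t * x) (t * y) / t
      \<le> cop (t * x') (t * y') / t - cop (t * x) (t * y') / t"
    using eventually_at_right_less[of 0]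
  proof eventually_elim
    case (elim t)
    have "t * x \<le> t * x'" "t * y \<le> t * y'" using elim assms by (auto intro: mult_left_mono)
    then have "cop (t * x') (t * y) - cop (t * x) (t * y) \<le> cop (t * x') (t * y') - cop (t * x) (t * y')"
      by (simp add: cop_increment1) (rule finite_measure_mono, auto)
    then show ?case using elim by (simp add: divide_right_mono flip: diff_divide_distrib)
  qed
qed simp

lemma R_homogeneous:
  assumes "0 < s" "0 \<le> x" "0 \<le> y"
  shows "R (s * x) (s * y) = s * R x y"
proof (rule tendsto_unique[of "at_right 0"])
  show "((\<lambda>t. cop (t * (s * x)) (t * (s * y)) / t) \<longlongrightarrow> R (s * x) (s * y)) (at_right 0)"
    using assms by (intro cop_limit) auto
  have "filterlim (\<lambda>t. s * t) (at_right 0) (at_right (0::real))"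
    using filtermap_times_pos_at_right[of s 0] assms by (simp add: filterlim_def)
  from filterlim_compose[OF cop_limit this, of x y] assms
  have "((\<lambda>t. s * (cop (s * t * x) (s * t * y) / (s * t))) \<longlongrightarrow> s * R x y) (at_right 0)"
    by (intro tendsto_mult_left) auto
  then show "((\<lambda>t. cop (t * (s * x)) (t * (s * y)) / t) \<longlongrightarrow> s * R x y) (at_right 0)"
    using assms by (simp add: mult_ac)
qed simp

lemma R_zero:
  assumes "0 \<le> x"
  shows "R 0 x = 0" "R x 0 = 0"
proof -
  have "cop 0 v \<le> measure Q {z. fst z \<le> 0}" "cop v 0 \<le> measure Q {z. snd z \<le> 0}" for v
    unfolding cop_def by (rule finite_measure_mono; auto)+
  moreover have "0 \<le> cop u v" for u v by (simp add: cop_def)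
  ultimately have "cop 0 v = 0" "cop v 0 = 0" for v
    using uniform1[of 0] uniform2[of 0] by (auto intro!: antisym)
  then have "((\<lambda>t. 0) \<longlongrightarrow> R 0 x) (at_right (0::real))" "((\<lambda>t. 0) \<longlongrightarrow> R x 0) (at_right (0::real))"
    using cop_limit[of 0 x] cop_limit[of x 0] assms by simp_all
  then show "R 0 x = 0" "R x 0 = 0"
    by (auto simp: tendsto_const_iff)
qed

lemma R_bounds:
  assumes "0 \<le> x" "0 \<le> y"
  shows "0 \<le> R x y" "R x y \<le> x" "R x y \<le> y"
  using R_increment1[of 0 x y] R_increment2[of 0 y x] R_zero(1)[of y] R_zero(2)[of x] assms by linarith+

lemma R_continuous:
  assumes "(a \<longlongrightarrow> x) F" "(b \<longlongrightarrow> y) F" "0 \<le> x" "0 \<le> y" "\<forall>\<^sub>F i in F. 0 \<le> a i \<and> 0 \<le> b i"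
  shows "((\<lambda>i. R (a i) (b i)) \<longlongrightarrow> R x y) F"
proof -
  have "\<bar>R u v - R x y\<bar> \<le> \<bar>u - x\<bar> + \<bar>v - y\<bar>" if "0 \<le> u" "0 \<le> v" for u v
  proof -
    have "\<bar>R u v - R x v\<bar> \<le> \<bar>u - x\<bar>"
      using R_increment1[of u x v] R_increment1[of x u v] that assms by (cases "u \<le> x") auto
    moreover have "\<bar>R x v - R x y\<bar> \<le> \<bar>v - y\<bar>"
      using R_increment2[of v y x] R_increment2[of y v x] that assms by (cases "v \<le> y") auto
    ultimately show ?thesis by linarith
  qed
  then have "\<forall>\<^sub>F i in F. norm (R (a i) (b i) - R x y) \<le> \<bar>a i - x\<bar> + \<bar>b i - y\<bar>"
    using assms(5) by (auto elim!: eventually_mono)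
  moreover have "((\<lambda>i. \<bar>a i - x\<bar> + \<bar>b i - y\<bar>) \<longlongrightarrow> \<bar>x - x\<bar> + \<bar>y - y\<bar>) F"
    using assms by (intro tendsto_intros)
  ultimately show ?thesis
    by - (rule LIM_zero_cancel, rule Lim_null_comparison, auto)
qed

text \<open>Homogeneity turns a dilation of the first argument into a contraction of the second, and \<open>R\<close>
is two-increasing.\<close>

lemma R_section_increment:
  assumes "0 < x" "x \<le> x'" "1 \<le> c"
  shows "R (c * x') 1 - R (c * x) 1 \<le> c * (R x' 1 - R x 1)"
proof -
  have "R (c * x') 1 = c * R x' (1 / c)" "R (c * x) 1 = c * R x (1 / c)"
    using R_homogeneous[of c x' "1 / c"] R_homogeneous[of c x "1 / c"] assms by simp_all
  then have "R (c * x') 1 - R (c * x) 1 = c * (R x' (1 / c) - R x (1 / c))"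
    by (simp add: algebra_simps)
  also have "\<dots> \<le> c * (R x' 1 - R x 1)"
    using assms by (intro mult_left_mono R_two_increasing) auto
  finally show ?thesis .
qed

text \<open>Formally, \<open>R_section_increment\<close> says that the derivative of the section at \<open>c * x\<close> is at most the derivative
at \<open>x\<close>.  Since the section is only known to be continuous, it is replaced by
\<open>\<Psi> h\<close>, the integral of \<open>R(u, 1) / u\<close> over \<open>[x, (1 + h) x]\<close> divided by \<open>h\<close>, which is differentiable
with a decreasing derivative and tends to \<open>R(x, 1)\<close> as \<open>h \<down> 0\<close>.\<close>

lemma R_section_concave: "concave_on {0<..} (\<lambda>u. R u 1)"
  unfolding concave_on_def
proof (rule convex_on_linorderI)
  fix s p q :: real
  assume s: "0 < s" "s < 1" and pq: "p \<in> {0<..}" "q \<in> {0<..}" "p < q"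
  let ?r = "\<lambda>u. R u 1"
  have "continuous_on {p/2..3*q} (\<lambda>u. ?r u / u)"
    unfolding continuous_on_def
  proof (intro ballI tendsto_divide)
    fix u assume u: "u \<in> {p/2..3*q}"
    show "(?r \<longlongrightarrow> ?r u) (at u within {p/2..3*q})"
      by (rule R_continuous) (use u pq in \<open>auto simp: eventually_at_filter intro!: always_eventually\<close>)
  qed (use pq in auto)
  then obtain P where P: "\<And>u. u \<in> {p/2..3*q} \<Longrightarrow> (P has_vector_derivative (?r u / u)) (at u within {p/2..3*q})"
    using antiderivative_continuous by blast
  have dP: "(P has_real_derivative (?r u / u)) (at u)" if "p/2 < u" "u < 3*q" for u
    using P[of u] that by (simp add: at_within_Icc_at has_real_derivative_iff_has_vector_derivative)
  define \<Psi> where "\<Psi> h x = (P ((1 + h) * x) - P x) / h" for h x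
  have conv: "convex_on {p..q} (\<lambda>x. - \<Psi> h x)" if h: "0 < h" "h < 1" for h
  proof (rule convex_on_realI)
    fix x assume x: "x \<in> {p..q}"
    have "(1 + h) * x < 2 * x" using x pq h by (intro mult_strict_right_mono) auto
    moreover have "2 * x \<le> 3 * q" "x \<le> (1 + h) * x" using x pq h by auto
    ultimately have hx: "x \<le> (1 + h) * x" "(1 + h) * x < 3 * q" by linarith+
    have "((\<lambda>x. - \<Psi> h x) has_real_derivative - ((?r ((1 + h) * x) / ((1 + h) * x) * (1 + h) - ?r x / x) / h)) (at x)"
    proof -
      have "((\<lambda>x. P ((1 + h) * x)) has_real_derivative ?r ((1 + h) * x) / ((1 + h) * x) * (1 + h)) (at x)"
      proof (rule DERIV_chain2[OF dP])
        have "p \<le> (1 + h) * x" using hx x by auto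
        then show "p / 2 < (1 + h) * x" using pq by auto
      qed (use hx in \<open>auto intro!: derivative_eq_intros\<close>)
      moreover have "(P has_real_derivative ?r x / x) (at x)"
        using x pq by (intro dP) auto
      ultimately show ?thesis
        unfolding \<Psi>_def by (intro DERIV_minus DERIV_cdivide DERIV_diff)
    qed
    also have "(?r ((1 + h) * x) / ((1 + h) * x) * (1 + h) - ?r x / x) / h = (?r ((1 + h) * x) - ?r x) / (h * x)"
    proof -
      have "?r ((1 + h) * x) / ((1 + h) * x) * (1 + h) = ?r ((1 + h) * x) / x" using h by simp
      then show ?thesis by (simp add: diff_divide_distrib mult.commute)
    qed
    finally show "((\<lambda>x. - \<Psi> h x) has_real_derivative - ((?r ((1 + h) * x) - ?r x) / (h * x))) (at x)" .
  next
    fix x y assume xy: "x \<in> {p..q}" "y \<in> {p..q}" "x \<le> y"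
    define c where "c = y / x"
    have c: "1 \<le> c" "y = c * x" using xy pq by (auto simp: c_def field_simps)
    have "(1 + h) * y = c * ((1 + h) * x)" unfolding c(2) by simp
    moreover have "?r (c * ((1 + h) * x)) - ?r (c * x) \<le> c * (?r ((1 + h) * x) - ?r x)"
      using c(1) xy pq h by (intro R_section_increment) auto
    ultimately have "?r ((1 + h) * y) - ?r y \<le> c * (?r ((1 + h) * x) - ?r x)"
      by (simp only: c(2)[symmetric])
    then have "(?r ((1 + h) * y) - ?r y) / (h * y) \<le> c * (?r ((1 + h) * x) - ?r x) / (h * y)"
      using xy pq h by (intro divide_right_mono) auto
    also have "\<dots> = (?r ((1 + h) * x) - ?r x) / (h * x)"
      unfolding c(2) using c(1) by simp
    finally show "- ((?r ((1 + h) * x) - ?r x) / (h * x)) \<le> - ((?r ((1 + h) * y) - ?r y) / (h * y))" by simp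
  qed simp
  have lim: "((\<lambda>h. \<Psi> h x) \<longlongrightarrow> ?r x) (at_right 0)" if x: "x \<in> {p..q}" for x
  proof -
    have "((\<lambda>h. P ((1 + h) * x)) has_real_derivative (?r x / x * x)) (at 0)"
      by (rule DERIV_chain2[where g="\<lambda>h. (1 + h) * x"]) (use x pq in \<open>auto intro!: derivative_eq_intros dP\<close>)
    then have "((\<lambda>h. \<Psi> h x) \<longlongrightarrow> ?r x / x * x) (at 0)"
      by (simp add: has_field_derivative_iff \<Psi>_def)
    then show ?thesis using x pq by (simp add: filterlim_at_split)
  qed
  have mid: "(1 - s) * p + s * q \<in> {p..q}"
  proof -
    have "0 \<le> s * (q - p)" "0 \<le> (1 - s) * (q - p)" using s pq by simp_all
    then have "0 \<le> s * q - s * p" "0 \<le> (q - s * q) - (p - s * p)"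
      by (simp_all only: left_diff_distrib right_diff_distrib mult_1)
    moreover have "(1 - s) * p = p - s * p" by (simp add: left_diff_distrib)
    ultimately have "p \<le> (1 - s) * p + s * q" "(1 - s) * p + s * q \<le> q" by linarith+
    then show ?thesis by simp
  qed
  have "- ?r ((1 - s) *\<^sub>R p + s *\<^sub>R q) \<le> (1 - s) * - ?r p + s * - ?r q"
  proof (rule tendsto_le)
    show "((\<lambda>h. - \<Psi> h ((1 - s) *\<^sub>R p + s *\<^sub>R q)) \<longlongrightarrow> - ?r ((1 - s) *\<^sub>R p + s *\<^sub>R q)) (at_right 0)"
      using mid by (intro tendsto_minus lim) auto
    show "((\<lambda>h. (1 - s) * - \<Psi> h p + s * - \<Psi> h q) \<longlongrightarrow> (1 - s) * - ?r p + s * - ?r q) (at_right 0)"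
      using pq by (intro tendsto_intros lim) auto
    show "\<forall>\<^sub>F h in at_right 0. - \<Psi> h ((1 - s) *\<^sub>R p + s *\<^sub>R q) \<le> (1 - s) * - \<Psi> h p + s * - \<Psi> h q"
      using eventually_at_right_real[of 0 1] 
    proof (rule eventually_mono)
      fix h :: real assume "h \<in> {0<..<1}"
      then show "- \<Psi> h ((1 - s) *\<^sub>R p + s *\<^sub>R q) \<le> (1 - s) * - \<Psi> h p + s * - \<Psi> h q"
        using convex_onD[OF conv, of h s p q] s pq by auto
    qed simp
  qed simp
  then show "- ?r ((1 - s) *\<^sub>R p + s *\<^sub>R q) \<le> (1 - s) * - ?r p + s * - ?r q" .
qed simp

text \<open>Borel versions of the partial derivatives of \<open>R\<close>, defined everywhere with values in \<open>[0, 1]\<close>.  They agree with the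
true derivatives at regular points.  The limit is taken along \<open>1 / Suc m\<close> so that measurability is immediate, and
the arguments are clipped because \<open>R\<close> is unspecified for negative arguments.\<close>

definition D1 :: "real \<times> real \<Rightarrow> real" where
  "D1 z = max 0 (min 1 (lim (\<lambda>m. (R (max 0 (fst z) + 1 / Suc m) (max 0 (snd z))
      - R (max 0 (fst z)) (max 0 (snd z))) * Suc m)))"

definition D2 :: "real \<times> real \<Rightarrow> real" where
  "D2 z = max 0 (min 1 (lim (\<lambda>m. (R (max 0 (fst z)) (max 0 (snd z) + 1 / Suc m)
      - R (max 0 (fst z)) (max 0 (snd z))) * Suc m)))"

lemma D_bounds: "0 \<le> D1 z" "D1 z \<le> 1" "0 \<le> D2 z" "D2 z \<le> 1"
  by (auto simp: D1_def D2_def)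

lemma R_measurable: "(\<lambda>z. R (max 0 (fst z) + a) (max 0 (snd z) + b)) \<in> borel_measurable borel"
  if "0 \<le> a" "0 \<le> b"
proof (rule borel_measurable_continuous_onI)
  show "continuous_on UNIV (\<lambda>z. R (max 0 (fst z) + a) (max 0 (snd z) + b))"
    unfolding continuous_on_def
    by (intro ballI R_continuous tendsto_intros always_eventually) (use that in auto)
qed

lemma D_measurable [measurable]: "D1 \<in> borel_measurable borel" "D2 \<in> borel_measurable borel"
proof -
  note [measurable] = R_measurable
  have [measurable]: "(\<lambda>z. R (max 0 (fst z) + 1 / Suc m) (max 0 (snd z))) \<in> borel_measurable borel"
    "(\<lambda>z. R (max 0 (fst z)) (max 0 (snd z) + 1 / Suc m)) \<in> borel_measurable borel"
    "(\<lambda>z. R (max 0 (fst z)) (max 0 (snd z))) \<in> borel_measurable borel" for m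
    using R_measurable[of "1 / Suc m" 0] R_measurable[of 0 "1 / Suc m"] R_measurable[of 0 0] by auto
  show "D1 \<in> borel_measurable borel" "D2 \<in> borel_measurable borel"
    unfolding D1_def[abs_def] D2_def[abs_def] by measurable
qed

text \<open>Gateaux differentiability at a point of the open quadrant.  This form of differentiability is the one that the
expansion of the estimator uses, which evaluates \<open>R\<close> along finitely many directions.\<close>

definition regular :: "real \<times> real \<Rightarrow> bool" where
  "regular z \<longleftrightarrow> 0 < fst z \<and> 0 < snd z \<and>
    (\<forall>a b. ((\<lambda>s. R (fst z + a * s) (snd z + b * s)) has_real_derivative (a * D1 z + b * D2 z)) (at 0))"

text \<open>In the open quadrant \<open>R(x, y) = y * R(x / y, 1)\<close>, so differentiability of the section at \<open>x / y\<close> is enough.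
The second partial derivative is then \<open>d2\<close> by the product and chain rules.\<close>

lemma regularI:
  assumes z: "0 < fst z" "0 < snd z" and r: "(\<lambda>u. R u 1) differentiable (at (fst z / snd z))"
  shows "regular z"
proof -
  define x y where "x = fst z" and "y = snd z"
  have xy: "0 < x" "0 < y" using z by (auto simp: x_def y_def)
  obtain d where d: "((\<lambda>u. R u 1) has_real_derivative d) (at (x / y))"
    using r by (auto simp: x_def y_def real_differentiable_def)
  define d2 where "d2 = R (x / y) 1 - x / y * d"
  have path: "((\<lambda>s. R (x + a * s) (y + b * s)) has_real_derivative (a * d + b * d2)) (at 0)" for a b
  proof -
    have "((\<lambda>s. (y + b * s) * R ((x + a * s) / (y + b * s)) 1) has_real_derivative
        (b * R ((x + a * 0) / (y + b * 0)) 1 + (d * ((a * (y + b * 0) - (x + a * 0) * b) / ((y + b * 0) * (y + b * 0)))) * (y + b * 0))) (at 0)"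
      using xy d by (intro DERIV_mult DERIV_chain2[where f="\<lambda>u. R u 1"] DERIV_divide) (auto intro!: derivative_eq_intros)
    moreover have "b * R ((x + a * 0) / (y + b * 0)) 1
        + (d * ((a * (y + b * 0) - (x + a * 0) * b) / ((y + b * 0) * (y + b * 0)))) * (y + b * 0) = a * d + b * d2"
      using xy by (simp add: d2_def field_simps)
    ultimately have "((\<lambda>s. (y + b * s) * R ((x + a * s) / (y + b * s)) 1) has_real_derivative (a * d + b * d2)) (at 0)"
      by (simp only:)
    moreover have "\<forall>\<^sub>F s in nhds 0. (y + b * s) * R ((x + a * s) / (y + b * s)) 1 = R (x + a * s) (y + b * s)"
    proof -
      have "open {s. 0 < y + b * s}" "open {s. 0 < x + a * s}"
        by (intro open_Collect_less continuous_intros)+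
      then have "\<forall>\<^sub>F s in nhds 0. s \<in> {s. 0 < y + b * s}" "\<forall>\<^sub>F s in nhds 0. s \<in> {s. 0 < x + a * s}"
        using eventually_nhds_in_open[of "{s. 0 < y + b * s}" 0] eventually_nhds_in_open[of "{s. 0 < x + a * s}" 0] xy
        by simp_all
      then show ?thesis
      proof eventually_elim
        case (elim s)
        then show ?case using R_homogeneous[of "y + b * s" "(x + a * s) / (y + b * s)" 1] by simp
      qed
    qed
    ultimately show ?thesis by (subst DERIV_cong_ev[OF refl _ refl, symmetric]) (auto elim: eventually_mono)
  qed
  have seq: "(\<lambda>m. (f (1 / Suc m) - f 0) * Suc m) \<longlonglongrightarrow> e" if "(f has_real_derivative e) (at 0)" for f :: "real \<Rightarrow> real" and e
  proof -
    have "((\<lambda>h. (f h - f 0) / h) \<longlongrightarrow> e) (at 0)" using that by (simp add: has_field_derivative_iff)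
    moreover have "filterlim (\<lambda>m. 1 / real (Suc m)) (at 0) sequentially"
      using LIMSEQ_Suc[OF lim_1_over_n[where 'a=real]] by (intro filterlim_atI) (auto intro!: always_eventually)
    ultimately show ?thesis by (auto dest: filterlim_compose simp: field_simps)
  qed
  have l1: "(\<lambda>m. (R (max 0 x + 1 / Suc m) (max 0 y) - R (max 0 x) (max 0 y)) * Suc m) \<longlonglongrightarrow> d"
    using seq[OF path[of 1 0]] xy by simp
  have l2: "(\<lambda>m. (R (max 0 x) (max 0 y + 1 / Suc m) - R (max 0 x) (max 0 y)) * Suc m) \<longlonglongrightarrow> d2"
    using seq[OF path[of 0 1]] xy by simp
  have scale: "0 \<le> e * Suc m \<and> e * Suc m \<le> 1" if "0 \<le> e" "e \<le> 1 / Suc m" for e :: real and m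
    using that by (simp add: field_simps)
  have "0 \<le> (R (max 0 x + 1 / Suc m) (max 0 y) - R (max 0 x) (max 0 y)) * Suc m \<and>
      (R (max 0 x + 1 / Suc m) (max 0 y) - R (max 0 x) (max 0 y)) * Suc m \<le> 1" for m
    using R_increment1[of "max 0 x" "max 0 x + 1 / Suc m" "max 0 y"] by (intro scale) simp_all
  then have d01: "0 \<le> d" "d \<le> 1" using LIMSEQ_le_const[OF l1, of 0] LIMSEQ_le_const2[OF l1, of 1] by auto
  have "0 \<le> (R (max 0 x) (max 0 y + 1 / Suc m) - R (max 0 x) (max 0 y)) * Suc m \<and>
      (R (max 0 x) (max 0 y + 1 / Suc m) - R (max 0 x) (max 0 y)) * Suc m \<le> 1" for m
    using R_increment2[of "max 0 y" "max 0 y + 1 / Suc m" "max 0 x"] by (intro scale) simp_all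
  then have d201: "0 \<le> d2" "d2 \<le> 1" using LIMSEQ_le_const[OF l2, of 0] LIMSEQ_le_const2[OF l2, of 1] by auto
  have "D1 z = d" "D2 z = d2"
    using limI[OF l1] limI[OF l2] d01 d201 by (auto simp: D1_def D2_def x_def y_def)
  then show ?thesis using path xy by (simp add: regular_def x_def y_def)
qed

text \<open>The section \<open>R(\<cdot>, 1)\<close> is concave, hence differentiable off a countable set \<open>D\<close>; the exceptional points are
those on the lines \<open>x = d y\<close> with \<open>d \<in> D\<close>.\<close>

lemma AE_regular: "AE z in lborel. 0 < fst z \<longrightarrow> 0 < snd z \<longrightarrow> regular z"
proof -
  have "convex_on {0<..} (\<lambda>u. - R u 1)" using R_section_concave by (simp add: concave_on_def)
  then obtain D where D: "countable D" "\<And>x. x \<in> {0<..} \<Longrightarrow> x \<notin> D \<Longrightarrow> (\<lambda>u. - R u 1) differentiable (at x)"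
    by (rule convex_differentiable_off_countable[OF _ open_greaterThan]) blast
  define L where "L d = {z :: real \<times> real. (1, - d) \<bullet> z = 0}" for d
  have "negligible (L d)" for d
    unfolding L_def by (rule negligible_hyperplane) (auto simp: zero_prod_def)
  moreover have "closed (L d)" for d
    unfolding L_def by (rule closed_hyperplane)
  ultimately have "L d \<in> null_sets lborel" for d
    by (auto simp: negligible_iff_null_sets null_sets_completion_iff)
  then have "AE z in lborel. \<forall>d\<in>D. z \<notin> L d"
    using D(1) by (auto simp: AE_ball_countable intro: AE_not_in)
  then show ?thesis
  proof eventually_elim
    case (elim z)
    show ?case
    proof (intro impI)
      assume z: "0 < fst z" "0 < snd z"
      then have "fst z / snd z \<notin> D"
        using elim by (auto simp: L_def inner_prod_def)
      then have "(\<lambda>u. - R u 1) differentiable (at (fst z / snd z))"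
        using D(2) z by auto
      from differentiable_minus[OF this] show "regular z"
        using z by (intro regularI) simp_all
    qed
  qed
qed

lemma regular_right_derivatives:
  assumes "regular z"
  shows "vector_derivative (\<lambda>u. R u (snd z)) (at_right (fst z)) = D1 z"
    "vector_derivative (\<lambda>v. R (fst z) v) (at_right (snd z)) = D2 z"
proof -
  have shift: "vector_derivative f (at_right x) = e"
    if "((\<lambda>s. f (x + s)) has_real_derivative e) (at 0)" for f :: "real \<Rightarrow> real" and x e
  proof -
    have "(f has_real_derivative e) (at x)" using that DERIV_shift[of f e 0 x] by (simp add: add.commute)
    then show ?thesis
      by (intro vector_derivative_within)
        (auto simp: has_real_derivative_iff_has_vector_derivative[symmetric] intro: has_field_derivative_at_within)
  qed
  have path: "((\<lambda>s. R (fst z + a * s) (snd z + b * s)) has_real_derivative (a * D1 z + b * D2 z)) (at 0)" for a b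
    using assms by (simp add: regular_def)
  show "vector_derivative (\<lambda>u. R u (snd z)) (at_right (fst z)) = D1 z"
    using path[of 1 0] by (intro shift) simp
  show "vector_derivative (\<lambda>v. R (fst z) v) (at_right (snd z)) = D2 z"
    using path[of 0 1] by (intro shift) simp
qed

text \<open>The rate is only assumed on the segment \<open>x + y = 1\<close>.  A general point is \<open>s\<close> times a point of the segment, with
\<open>s = x + y \<le> 4\<close>, and the rate at scale \<open>t\<close> follows from the one at scale \<open>t * s\<close> by homogeneity of \<open>R\<close>.
The square is taken as \<open>[0, 2]\<^sup>2\<close> in order to leave room around the points of the unit square.\<close>

lemma tail_bias:
  assumes \<alpha>: "\<alpha> > 0"
    and C: "\<forall>\<^sub>F t in at_right 0. \<forall>x\<ge>0. \<forall>y\<ge>0. x + y = 1 \<longrightarrow> \<bar>cop (t * x) (t * y) / t - R x y\<bar> \<le> C * t powr \<alpha>"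
  shows "\<exists>C'. \<forall>\<^sub>F t in at_right 0. \<forall>x\<in>{0..2}. \<forall>y\<in>{0..2}. \<bar>cop (t * x) (t * y) / t - R x y\<bar> \<le> C' * t powr \<alpha>"
proof -
  obtain t0 where t0: "t0 > 0" and C: "\<And>t x y. 0 < t \<Longrightarrow> t < t0 \<Longrightarrow> 0 \<le> x \<Longrightarrow> 0 \<le> y \<Longrightarrow> x + y = 1 \<Longrightarrow>
      \<bar>cop (t * x) (t * y) / t - R x y\<bar> \<le> C * t powr \<alpha>"
    using C by (auto simp: eventually_at_right_field)
  have C0: "0 \<le> C"
  proof -
    have "0 \<le> C * (t0/2) powr \<alpha>" using C[of "t0/2" 1 0] t0 by linarith
    then show ?thesis using t0 by (simp add: zero_le_mult_iff)
  qed
  have "\<bar>cop (t * x) (t * y) / t - R x y\<bar> \<le> (C * 4 powr \<alpha> * 4) * t powr \<alpha>"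
    if t: "0 < t" "t < t0 / 4" and xy: "x \<in> {0..2}" "y \<in> {0..2}" for t x y
  proof (cases "x + y = 0")
    case True
    then have xy0: "x = 0" "y = 0" using xy by auto
    have "cop 0 0 \<le> measure Q {z. fst z \<le> 0}" unfolding cop_def by (rule finite_measure_mono) auto
    then have "cop 0 0 = 0" using uniform1[of 0] by (auto simp: cop_def intro!: antisym)
    then show ?thesis using xy0 R_zero[of 0] C0 by simp
  next
    case False
    define s where "s = x + y"
    have s: "0 < s" "s \<le> 4" using False xy by (auto simp: s_def)
    have "t * s \<le> t * 4" using s t by (intro mult_left_mono) auto
    moreover have "t * 4 < t0" using t by simp
    ultimately have "t * s < t0" by linarith
    then have ts: "0 < t * s" "t * s < t0" using s t by simp_all
    have "\<bar>cop (t * s * (x / s)) (t * s * (y / s)) / (t * s) - R (x / s) (y / s)\<bar> \<le> C * (t * s) powr \<alpha>"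
      using ts s xy by (intro C) (auto simp: s_def add_divide_distrib[symmetric])
    also have "\<dots> \<le> C * (4 powr \<alpha> * t powr \<alpha>)"
      using ts s t \<alpha> C0 powr_mono2[of \<alpha> "t * s" "t * 4"] by (intro mult_left_mono) (auto simp: powr_mult mult.commute)
    finally have *: "\<bar>cop (t * x) (t * y) / (t * s) - R (x / s) (y / s)\<bar> \<le> C * 4 powr \<alpha> * t powr \<alpha>"
      using s by simp
    have "R x y = s * R (x / s) (y / s)"
      using R_homogeneous[of s "x / s" "y / s"] s xy by simp
    then have "cop (t * x) (t * y) / t - R x y = s * (cop (t * x) (t * y) / (t * s) - R (x / s) (y / s))"
      using s t by (simp add: right_diff_distrib)
    then have "\<bar>cop (t * x) (t * y) / t - R x y\<bar> = s * \<bar>cop (t * x) (t * y) / (t * s) - R (x / s) (y / s)\<bar>"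
      using s by (simp add: abs_mult)
    also have "\<dots> \<le> 4 * (C * 4 powr \<alpha> * t powr \<alpha>)"
      using * s by (intro mult_mono) auto
    finally show ?thesis by (simp add: mult_ac)
  qed
  then show ?thesis
    using t0 by (intro exI[of _ "C * 4 powr \<alpha> * 4"]) (auto simp: eventually_at_right_field intro!: exI[of _ "t0 / 4"])
qed

end

section \<open>Ranks and level sets\<close>

text \<open>The estimator counts a union of two such sets.  For an integer \<open>s \<le> n\<close>, and without ties, the set consists of the
indices of the \<open>s\<close> largest observations.\<close>

definition top_set :: "(nat \<Rightarrow> 'a \<Rightarrow> real) \<Rightarrow> nat \<Rightarrow> real \<Rightarrow> 'a \<Rightarrow> nat set" where
  "top_set X n s \<omega> = {i \<in> {1..n}. real (sample_rank X n i \<omega>) > real n + 1 / 2 - s}"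

lemma finite_top_set [simp]: "finite (top_set X n s \<omega>)"
  by (simp add: top_set_def)

lemma top_set_subset_range: "top_set X n s \<omega> \<subseteq> {1..n}"
  by (auto simp: top_set_def)

lemma stdf_estimator_card:
  "stdf_estimator X Y n k \<omega> x y = card (top_set X n (k * x) \<omega> \<union> top_set Y n (k * y) \<omega>) / k"
proof -
  let ?P = "\<lambda>i. real (sample_rank X n i \<omega>) > real n + 1 / 2 - k * x \<or>
      real (sample_rank Y n i \<omega>) > real n + 1 / 2 - k * y"
  have "(\<Sum>i=1..n. of_bool (?P i)) = real (card ({1..n} \<inter> {i. ?P i}))"
    by (simp only: sum_of_bool_eq finite_atLeastAtMost)
  also have "{1..n} \<inter> {i. ?P i} = top_set X n (k * x) \<omega> \<union> top_set Y n (k * y) \<omega>"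
    by (auto simp: top_set_def)
  finally show ?thesis by (simp add: stdf_estimator_def)
qed

lemma sample_rank_complement:
  assumes "i \<in> {1..n}"
  shows "sample_rank X n i \<omega> + card {j \<in> {1..n}. X i \<omega> < X j \<omega>} = n"
proof -
  have "card ({j \<in> {1..n}. X j \<omega> \<le> X i \<omega>} \<union> {j \<in> {1..n}. X i \<omega> < X j \<omega>})
      = card {j \<in> {1..n}. X j \<omega> \<le> X i \<omega>} + card {j \<in> {1..n}. X i \<omega> < X j \<omega>}"
    by (rule card_Un_disjoint) auto
  also have "{j \<in> {1..n}. X j \<omega> \<le> X i \<omega>} \<union> {j \<in> {1..n}. X i \<omega> < X j \<omega>} = {1..n}" by auto
  finally show ?thesis by (simp add: sample_rank_def)
qed

text \<open>Top sets and level sets of a decreasing function of the observations are both up-sets for the order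
of the sample, so they are nested, and comparing their cardinalities decides which one is larger.\<close>

lemma top_set_subset_level:
  assumes f: "antimono f" and N: "s - 1 / 2 \<le> card {j \<in> {1..n}. f (X j \<omega>) \<le> u}"
  shows "top_set X n s \<omega> \<subseteq> {j \<in> {1..n}. f (X j \<omega>) \<le> u}"
proof
  fix i assume i: "i \<in> top_set X n s \<omega>"
  then have i1: "i \<in> {1..n}" and r: "real (sample_rank X n i \<omega>) > real n + 1 / 2 - s" by (auto simp: top_set_def)
  have "f (X i \<omega>) \<le> u"
  proof (rule ccontr)
    assume u: "\<not> f (X i \<omega>) \<le> u"
    have "{j \<in> {1..n}. f (X j \<omega>) \<le> u} \<subseteq> {j \<in> {1..n}. X i \<omega> < X j \<omega>}"
    proof safe
      fix j assume j: "f (X j \<omega>) \<le> u"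
      show "X i \<omega> < X j \<omega>"
      proof (rule ccontr)
        assume "\<not> X i \<omega> < X j \<omega>"
        then have "f (X i \<omega>) \<le> f (X j \<omega>)" by (intro antimonoD[OF f]) simp
        with j u show False by simp
      qed
    qed
    then have "card {j \<in> {1..n}. f (X j \<omega>) \<le> u} \<le> card {j \<in> {1..n}. X i \<omega> < X j \<omega>}"
      by (intro card_mono) auto
    then show False using N r sample_rank_complement[OF i1, of X \<omega>] by linarith
  qed
  with i1 show "i \<in> {j \<in> {1..n}. f (X j \<omega>) \<le> u}" by simp
qed

lemma level_subset_top_set:
  assumes f: "antimono f" and N: "card {j \<in> {1..n}. f (X j \<omega>) \<le> u} < s + 1 / 2"
  shows "{j \<in> {1..n}. f (X j \<omega>) \<le> u} \<subseteq> top_set X n s \<omega>"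
proof
  fix i assume i: "i \<in> {j \<in> {1..n}. f (X j \<omega>) \<le> u}"
  then have i1: "i \<in> {1..n}" by simp
  have "insert i {j \<in> {1..n}. X i \<omega> < X j \<omega>} \<subseteq> {j \<in> {1..n}. f (X j \<omega>) \<le> u}"
  proof (intro insert_subsetI i subsetI)
    fix j assume j: "j \<in> {j \<in> {1..n}. X i \<omega> < X j \<omega>}"
    then have "f (X j \<omega>) \<le> f (X i \<omega>)" by (intro antimonoD[OF f]) simp
    then show "j \<in> {j \<in> {1..n}. f (X j \<omega>) \<le> u}" using i j by (simp add: order.trans[of _ "f (X i \<omega>)"])
  qed
  then have "card (insert i {j \<in> {1..n}. X i \<omega> < X j \<omega>}) \<le> card {j \<in> {1..n}. f (X j \<omega>) \<le> u}"
    by (intro card_mono) auto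
  then have "card {j \<in> {1..n}. X i \<omega> < X j \<omega>} + 1 \<le> card {j \<in> {1..n}. f (X j \<omega>) \<le> u}" by simp
  then show "i \<in> top_set X n s \<omega>"
    using N sample_rank_complement[OF i1, of X \<omega>] i1 unfolding top_set_def by simp
qed

text \<open>Without ties the ranks are a permutation of \<open>{1..n}\<close>, so counting ranks above \<open>n + 1/2 - s\<close> gives \<open>s\<close>
rounded to a nearest integer.\<close>

lemma card_top_set:
  fixes s :: real
  assumes inj: "inj_on (\<lambda>i. X i \<omega>) {1..n}" and s: "0 \<le> s" "s \<le> n"
  shows "\<bar>real (card (top_set X n s \<omega>)) - s\<bar> \<le> 1 / 2"
proof -
  let ?r = "\<lambda>i. sample_rank X n i \<omega>"
  have range: "?r i \<in> {1..n}" if "i \<in> {1..n}" for i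
  proof -
    have "card {i} \<le> ?r i" unfolding sample_rank_def using that by (intro card_mono) auto
    moreover have "?r i \<le> card {1..n}" unfolding sample_rank_def by (intro card_mono) auto
    ultimately show ?thesis by simp
  qed
  have less: "?r i < ?r j" if "i \<in> {1..n}" "j \<in> {1..n}" "X i \<omega> < X j \<omega>" for i j
    unfolding sample_rank_def
  proof (rule psubset_card_mono)
    have "{l \<in> {1..n}. X l \<omega> \<le> X i \<omega>} \<subseteq> {l \<in> {1..n}. X l \<omega> \<le> X j \<omega>}" using that(3) by auto
    moreover have "j \<in> {l \<in> {1..n}. X l \<omega> \<le> X j \<omega>}" "j \<notin> {l \<in> {1..n}. X l \<omega> \<le> X i \<omega>}"
      using that by auto
    ultimately show "{l \<in> {1..n}. X l \<omega> \<le> X i \<omega>} \<subset> {l \<in> {1..n}. X l \<omega> \<le> X j \<omega>}" by blast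
  qed simp
  have "inj_on ?r {1..n}"
  proof (rule inj_onI)
    fix i j assume ij: "i \<in> {1..n}" "j \<in> {1..n}" "?r i = ?r j"
    then have "X i \<omega> = X j \<omega>" using less[of i j] less[of j i] by (cases "X i \<omega>" "X j \<omega>" rule: linorder_cases) auto
    then show "i = j" using inj ij by (auto dest: inj_onD)
  qed
  moreover from this have "?r ` {1..n} = {1..n}"
    using range by (intro card_subset_eq) (auto simp: card_image)
  ultimately have bij: "bij_betw ?r {1..n} {1..n}" by (simp add: bij_betw_def)
  define c where "c = real n + 1 / 2 - s"
  have c: "0 \<le> c" "c < n + 1" using s by (auto simp: c_def)
  have fl: "nat \<lfloor>c\<rfloor> \<le> n" using c by linarith
  have "card (top_set X n s \<omega>) = card (?r ` top_set X n s \<omega>)"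
    using bij top_set_subset_range[of X n s \<omega>] by (intro card_image[symmetric]) (meson bij_betw_def inj_on_subset)
  also have "?r ` top_set X n s \<omega> = {r \<in> ?r ` {1..n}. c < real r}"
    unfolding top_set_def c_def[symmetric] by blast
  also have "?r ` {1..n} = {1..n}" using bij by (simp add: bij_betw_def)
  also have "{r \<in> {1..n}. c < real r} = {nat \<lfloor>c\<rfloor> + 1..n}"
  proof (intro set_eqI iffI)
    fix r assume "r \<in> {r \<in> {1..n}. c < real r}"
    then show "r \<in> {nat \<lfloor>c\<rfloor> + 1..n}" using c by simp linarith
  next
    fix r assume "r \<in> {nat \<lfloor>c\<rfloor> + 1..n}"
    then show "r \<in> {r \<in> {1..n}. c < real r}" using c by simp linarith
  qed
  also have "card \<dots> = n - nat \<lfloor>c\<rfloor>" by simp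
  finally have "real (card (top_set X n s \<omega>)) = n - real_of_int \<lfloor>c\<rfloor>" using fl c by (simp add: of_nat_diff)
  moreover have "real_of_int \<lfloor>c\<rfloor> \<le> c" "c < real_of_int \<lfloor>c\<rfloor> + 1" by linarith+
  ultimately show ?thesis unfolding c_def by linarith
qed

lemma card_Un_nested:
  assumes "finite A" "finite A'" "finite B" "A \<subseteq> A' \<or> A' \<subseteq> A"
  shows "\<bar>real (card (A \<union> B)) - card (A' \<union> B)\<bar> \<le> \<bar>real (card A) - card A'\<bar>"
proof -
  have *: "real (card (A \<union> B)) \<le> card (A' \<union> B) \<and> real (card (A' \<union> B)) - card (A \<union> B) \<le> real (card A') - card A"
    if "A \<subseteq> A'" "finite A'" for A A'
  proof -
    have fA: "finite A" using that finite_subset by blast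
    have "card (A' \<union> B) \<le> card (A \<union> B) + card (A' - A)"
      using fA that assms(3) by (intro order.trans[OF card_mono card_Un_le]) auto
    moreover have "card (A' - A) = card A' - card A" "card A \<le> card A'"
      using fA that by (auto simp: card_Diff_subset card_mono)
    moreover have "card (A \<union> B) \<le> card (A' \<union> B)"
      using that assms(3) by (intro card_mono) auto
    ultimately show ?thesis by linarith
  qed
  from assms(4) show ?thesis
  proof
    assume "A \<subseteq> A'"
    from *[OF this assms(2)] show ?thesis by linarith
  next
    assume "A' \<subseteq> A"
    from *[OF this assms(1)] show ?thesis by linarith
  qed
qed

text \<open>For nested sets the symmetric difference has exactly \<open>|card A - card A'|\<close> elements, so the two margins
contribute their counting errors and \<open>1/2\<close> each from rounding.\<close>

lemma top_set_union_error:
  fixes u u' s s' :: real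
  assumes f: "antimono f" "antimono f'"
    and inj: "inj_on (\<lambda>i. X i \<omega>) {1..n}" "inj_on (\<lambda>i. Y i \<omega>) {1..n}"
    and s: "0 \<le> s" "s \<le> n" "0 \<le> s'" "s' \<le> n"
  defines "A \<equiv> {j \<in> {1..n}. f (X j \<omega>) \<le> u}" and "B \<equiv> {j \<in> {1..n}. f' (Y j \<omega>) \<le> u'}"
  shows "\<bar>real (card (top_set X n s \<omega> \<union> top_set Y n s' \<omega>)) - card (A \<union> B)\<bar>
    \<le> \<bar>real (card A) - s\<bar> + \<bar>real (card B) - s'\<bar> + 1"
proof -
  let ?A = "top_set X n s \<omega>" and ?B = "top_set Y n s' \<omega>"
  have nest: "?A \<subseteq> A \<or> A \<subseteq> ?A"
  proof (cases "s - 1 / 2 \<le> card A")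
    case True
    then show ?thesis unfolding A_def by (intro disjI1 top_set_subset_level f)
  next
    case False
    then have "card A < s + 1 / 2" by simp
    then show ?thesis unfolding A_def by (intro disjI2 level_subset_top_set f)
  qed
  have nest': "?B \<subseteq> B \<or> B \<subseteq> ?B"
  proof (cases "s' - 1 / 2 \<le> card B")
    case True
    then show ?thesis unfolding B_def by (intro disjI1 top_set_subset_level f)
  next
    case False
    then have "card B < s' + 1 / 2" by simp
    then show ?thesis unfolding B_def by (intro disjI2 level_subset_top_set f)
  qed
  have fin: "finite A" "finite B" by (auto simp: A_def B_def)
  have "\<bar>real (card (?A \<union> ?B)) - card (A \<union> ?B)\<bar> \<le> \<bar>real (card ?A) - card A\<bar>"
    by (rule card_Un_nested[OF finite_top_set fin(1) finite_top_set nest])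
  moreover have "\<bar>real (card (A \<union> ?B)) - card (A \<union> B)\<bar> \<le> \<bar>real (card ?B) - card B\<bar>"
    using card_Un_nested[OF finite_top_set fin(2) fin(1) nest'] by (simp only: Un_commute[of A])
  ultimately show ?thesis
    using card_top_set[of X \<omega> n s] card_top_set[of Y \<omega> n s'] inj s by linarith
qed

text \<open>The level sets at the grid \<open>u j\<close> have cardinality \<open>s + q (h j + \<delta> j)\<close>, where the empirical fluctuation \<open>h j\<close> is nearly
the constant \<open>h0\<close>.  The top set has \<open>s\<close> elements up to rounding and thus sits at the grid point with \<open>\<delta> j\<close> close to
\<open>- h0\<close>; moving one step down or two steps up from the last \<open>j\<close> with \<open>\<delta> j \<le> - h0\<close> absorbs the variation
of \<open>h\<close>.  The bound on \<open>h0\<close> keeps these grid points in range.\<close>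

lemma top_set_bracket:
  fixes J :: int and \<delta> q s h0 :: real and h :: "int \<Rightarrow> real"
  assumes f: "antimono f" and \<delta>: "\<delta> > 0" and q: "q \<ge> 0"
    and count: "\<And>j. \<bar>j\<bar> \<le> J \<Longrightarrow> card {i \<in> {1..n}. f (X i \<omega>) \<le> u j} = q * h j + s + q * (\<delta> * j)"
    and close: "\<And>j. \<bar>j\<bar> \<le> J \<Longrightarrow> \<bar>h j - h0\<bar> \<le> \<delta>" and h0: "\<bar>h0\<bar> \<le> \<delta> * (J - 3)"
  obtains j where "\<bar>j - 1\<bar> \<le> J" "\<bar>j + 2\<bar> \<le> J" "\<delta> * j \<le> - h0" "- h0 < \<delta> * (j + 1)"
    "{i \<in> {1..n}. f (X i \<omega>) \<le> u (j - 1)} \<subseteq> top_set X n s \<omega>"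
    "top_set X n s \<omega> \<subseteq> {i \<in> {1..n}. f (X i \<omega>) \<le> u (j + 2)}"
proof -
  define j where "j = \<lfloor>- h0 / \<delta>\<rfloor>"
  have fl: "real_of_int j \<le> - h0 / \<delta>" "- h0 / \<delta> < real_of_int j + 1" unfolding j_def by linarith+
  have "real_of_int j * \<delta> \<le> - h0" "- h0 < (real_of_int j + 1) * \<delta>"
    using fl \<delta> by (simp_all only: pos_le_divide_eq pos_divide_less_eq)
  then have j: "\<delta> * j \<le> - h0" "- h0 < \<delta> * (real_of_int j + 1)" by (simp_all add: mult.commute)
  have "\<bar>h0\<bar> / \<delta> \<le> real_of_int J - 3" using h0 \<delta> by (simp add: pos_divide_le_eq mult.commute)
  then have "\<bar>- h0 / \<delta>\<bar> \<le> real_of_int J - 3" using \<delta> by simp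
  then have "real_of_int (j + 2) \<le> real_of_int J" "- real_of_int J < real_of_int (j - 1)"
    using fl by linarith+
  then have "j + 2 \<le> J" "- J < j - 1" by (simp_all only: of_int_le_iff of_int_less_iff flip: of_int_minus)
  then have jJ: "\<bar>j - 1\<bar> \<le> J" "\<bar>j + 2\<bar> \<le> J" by arith+
  have "q * (\<delta> * (j + 2)) + q * h (j + 2) = q * (h (j + 2) + \<delta> * (j + 2))" by (simp add: algebra_simps)
  also have "\<dots> \<ge> 0"
  proof (intro mult_nonneg_nonneg q)
    have "\<delta> * real_of_int (j + 2) = \<delta> * (real_of_int j + 1) + \<delta>" by (simp add: algebra_simps)
    then show "0 \<le> h (j + 2) + \<delta> * (j + 2)" using close[OF jJ(2)] j by linarith
  qed
  finally have "s - 1 / 2 \<le> card {i \<in> {1..n}. f (X i \<omega>) \<le> u (j + 2)}"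
    using count[OF jJ(2)] by (simp add: algebra_simps)
  note up = top_set_subset_level[where X=X and u="u (j + 2)", OF f this]
  have "q * (\<delta> * (j - 1)) + q * h (j - 1) = q * (h (j - 1) + \<delta> * (j - 1))" by (simp add: algebra_simps)
  also have "\<dots> \<le> 0"
  proof (intro mult_nonneg_nonpos q)
    have "\<delta> * (j - 1) = \<delta> * j - \<delta>" by (simp add: algebra_simps)
    then show "h (j - 1) + \<delta> * (j - 1) \<le> 0" using close[OF jJ(1)] j by linarith
  qed
  finally have "card {i \<in> {1..n}. f (X i \<omega>) \<le> u (j - 1)} < s + 1 / 2"
    using count[OF jJ(1)] by (simp add: algebra_simps)
  note lo = level_subset_top_set[where X=X and u="u (j - 1)", OF f this]
  show ?thesis by (rule that[of j]) (use jJ j lo up in simp_all)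
qed

lemma sample_rank_measurable [measurable]:
  assumes [measurable]: "\<And>i. V i \<in> borel_measurable N"
  shows "(\<lambda>\<omega>. real (sample_rank V n i \<omega>)) \<in> borel_measurable N"
proof -
  have "real (sample_rank V n i \<omega>) = (\<Sum>j=1..n. of_bool (V j \<omega> \<le> V i \<omega>))" for \<omega>
    by (simp only: sum_of_bool_eq finite_atLeastAtMost sample_rank_def) (simp add: Int_def)
  then show ?thesis by simp
qed

section \<open>A central limit theorem for integrated tail indicators\<close>

lemma integrable_pair_dominated:
  fixes w :: "'s \<Rightarrow> real" and f :: "'s \<times> 'd \<Rightarrow> real"
  assumes "sigma_finite_measure \<Lambda>" "prob_space Q" and w: "integrable \<Lambda> w"
    and f[measurable]: "f \<in> borel_measurable (\<Lambda> \<Otimes>\<^sub>M Q)"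
    and le: "\<And>s z. s \<in> space \<Lambda> \<Longrightarrow> z \<in> space Q \<Longrightarrow> \<bar>f (s, z)\<bar> \<le> C * \<bar>w s\<bar>"
  shows "integrable (\<Lambda> \<Otimes>\<^sub>M Q) f"
proof -
  interpret \<Lambda>: sigma_finite_measure \<Lambda> by fact
  interpret Q: prob_space Q by fact
  interpret pair: pair_sigma_finite \<Lambda> Q ..
  have sec: "integrable Q (\<lambda>z. f (s, z))" if s: "s \<in> space \<Lambda>" for s
    by (rule Q.integrable_const_bound[of _ "C * \<bar>w s\<bar>"]) (use le s in auto)
  show ?thesis
  proof (rule pair.Fubini_integrable)
    show "integrable \<Lambda> (\<lambda>s. LINT z|Q. norm (f (s, z)))"
    proof (rule Bochner_Integration.integrable_bound)
      show "integrable \<Lambda> (\<lambda>s. C * w s)" using w by simp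
      show "AE s in \<Lambda>. norm (LINT z|Q. norm (f (s, z))) \<le> norm (C * w s)"
      proof (rule AE_I2)
        fix s assume s: "s \<in> space \<Lambda>"
        have "(LINT z|Q. norm (f (s, z))) \<le> C * \<bar>w s\<bar>"
          using s le sec by (intro Q.integral_le_const) auto
        then show "norm (LINT z|Q. norm (f (s, z))) \<le> norm (C * w s)"
          using mult_right_mono[OF abs_ge_self[of C], of "\<bar>w s\<bar>"] by (simp add: abs_mult)
      qed
    qed measurable
    show "AE s in \<Lambda>. integrable Q (\<lambda>z. f (s, z))" using sec by auto
  qed measurable
qed

context iid_sample
begin

text \<open>By Fubini the second moment of \<open>\<zeta> n\<close> is a double integral over \<open>Q (S n s \<inter> S n s')\<close>, which after
division by \<open>k / n\<close> converges to the double integral of \<open>K\<close>.  The squared mean of \<open>\<zeta> n\<close> is \<open>O((k / n)\<^sup>2)\<close> and so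
disappears in the limit.  As \<open>\<zeta> n\<close> is bounded and \<open>k \<rightarrow> \<infinity>\<close>, the normalized summands tend
to \<open>0\<close> uniformly.\<close>

theorem linear_statistic_clt:
  fixes w :: "'s \<Rightarrow> real" and S :: "nat \<Rightarrow> 's \<Rightarrow> 'd set" and k :: "nat \<Rightarrow> nat"
  assumes \<Lambda>: "sigma_finite_measure \<Lambda>" "space \<Lambda> = UNIV" and w: "integrable \<Lambda> w"
    and S: "\<And>n. (\<lambda>p. indicator (S n (fst p)) (snd p) :: real) \<in> borel_measurable (\<Lambda> \<Otimes>\<^sub>M borel)"
    and k: "\<And>n. n \<ge> 1 \<Longrightarrow> k n \<ge> 1" "filterlim k at_top sequentially" "(\<lambda>n. k n / n) \<longlonglongrightarrow> 0"
    and small: "\<And>n s. n \<ge> 1 \<Longrightarrow> measure Q (S n s) \<le> k n / n"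
    and K: "\<And>s s'. (\<lambda>n. measure Q (S n s \<inter> S n s') / (k n / n)) \<longlonglongrightarrow> K s s'"
  defines "\<zeta> \<equiv> \<lambda>n z. LINT s|\<Lambda>. w s * indicator (S n s) z"
  shows "(\<lambda>n. CLINT \<omega>|M. iexp (((\<Sum>i=1..n. \<zeta> n (Z i \<omega>)) - n * (LINT z|Q. \<zeta> n z)) / sqrt (k n)))
    \<longlonglongrightarrow> complex_of_real (exp (- (LINT s|\<Lambda>. w s * (LINT s'|\<Lambda>. w s' * K s s')) / 2))"
proof -
  interpret \<Lambda>: sigma_finite_measure \<Lambda> by fact
  interpret pair: pair_sigma_finite \<Lambda> Q ..
  have [measurable]: "w \<in> borel_measurable \<Lambda>" using w by auto
  define I where "I n s z = (indicator (S n s) z :: real)" for n s z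
  have IQ[measurable]: "(\<lambda>p. I n (fst p) (snd p)) \<in> borel_measurable (\<Lambda> \<Otimes>\<^sub>M Q)" for n
    using S[of n] unfolding I_def by (simp cong: measurable_cong_sets sets_pair_measure_cong)
  have [measurable]: "(\<lambda>p. I n (snd p) (fst p)) \<in> borel_measurable (borel \<Otimes>\<^sub>M \<Lambda>)" for n
    using measurable_compose[OF measurable_pair_swap' S[of n]] by (simp add: I_def split_beta)
  have I01: "0 \<le> I n s z" "I n s z \<le> 1" for n s z by (auto simp: I_def)
  have Iz[measurable]: "(\<lambda>s. I n s z) \<in> borel_measurable \<Lambda>" for n z
    using measurable_compose[OF measurable_Pair2' IQ, of z n] by simp
  have Is[measurable]: "I n s \<in> borel_measurable Q" for n s
    using measurable_compose[OF measurable_Pair1' IQ, of s n] \<Lambda> by simp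
  have Ss: "S n s \<in> sets Q" for n s
    using Is[of n s] by (simp add: I_def[abs_def] borel_measurable_indicator_iff)
  define B where "B = (LINT s|\<Lambda>. \<bar>w s\<bar>)"
  have wB: "integrable \<Lambda> (\<lambda>s. \<bar>w s\<bar>)" using w by auto
  have wI: "\<bar>w s * c\<bar> \<le> \<bar>w s\<bar>" if "0 \<le> c" "c \<le> 1" for s c
    using that mult_left_mono[of c 1 "\<bar>w s\<bar>"] by (simp add: abs_mult)
  have wc: "\<bar>LINT s|\<Lambda>. w s * c s\<bar> \<le> (LINT s|\<Lambda>. \<bar>w s\<bar> * c s)"
    if [measurable]: "c \<in> borel_measurable \<Lambda>" and c: "\<And>s. 0 \<le> c s" "\<And>s. c s \<le> 1" for c
    using integral_abs_bound[of \<Lambda> "\<lambda>s. w s * c s"] c by (simp add: abs_mult)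
  have wcB: "(LINT s|\<Lambda>. \<bar>w s\<bar> * c s) \<le> C * B"
    if [measurable]: "c \<in> borel_measurable \<Lambda>" and c: "\<And>s. 0 \<le> c s" "\<And>s. c s \<le> C" for c C
  proof -
    have C: "0 \<le> C" using c[of undefined] by linarith
    have i: "integrable \<Lambda> (\<lambda>s. C * \<bar>w s\<bar>)" using wB by simp
    have "(LINT s|\<Lambda>. \<bar>w s\<bar> * c s) \<le> (LINT s|\<Lambda>. C * \<bar>w s\<bar>)"
    proof (rule integral_mono[OF _ i])
      show "integrable \<Lambda> (\<lambda>s. \<bar>w s\<bar> * c s)"
        by (rule Bochner_Integration.integrable_bound[OF i])
          (use c C in \<open>auto simp: abs_mult mult.commute[of "\<bar>w _\<bar>"] intro!: mult_right_mono\<close>)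
      show "\<bar>w s\<bar> * c s \<le> C * \<bar>w s\<bar>" for s
        using mult_right_mono[OF c(2)[of s], of "\<bar>w s\<bar>"] by (simp add: mult.commute)
    qed
    then show ?thesis by (simp add: B_def)
  qed
  have \<zeta>: "\<zeta> n z = (LINT s|\<Lambda>. w s * I n s z)" for n z by (simp add: \<zeta>_def I_def)
  have \<zeta>m'[measurable]: "\<zeta> n \<in> borel_measurable Q" for n
    unfolding \<zeta>[abs_def] by measurable
  have \<zeta>m[measurable]: "\<zeta> n \<in> borel_measurable borel" for n
    using \<zeta>m'[of n] by (simp cong: measurable_cong_sets)
  have \<zeta>B: "\<bar>\<zeta> n z\<bar> \<le> B" for n z
    using wc[of "\<lambda>s. I n s z"] wcB[of "\<lambda>s. I n s z" 1] I01 by (simp add: \<zeta>)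
  have B0: "0 \<le> B" unfolding B_def by simp
  have \<zeta>i: "integrable Q (\<zeta> n)" for n using \<zeta>B by (auto intro!: Q.integrable_const_bound[of _ B])
  (* every moment of \<zeta> n below is an instance of this exchange of integrals *)
  have swap: "(LINT z|Q. h z * \<zeta> n z) = (LINT s|\<Lambda>. w s * (LINT z|Q. h z * I n s z))"
    if [measurable]: "h \<in> borel_measurable Q" and h: "\<And>z. \<bar>h z\<bar> \<le> C" for h :: "'d \<Rightarrow> real" and C n
  proof -
    have C: "0 \<le> C" using h[of undefined] by linarith
    have int: "integrable (\<Lambda> \<Otimes>\<^sub>M Q) (\<lambda>p. h (snd p) * (w (fst p) * I n (fst p) (snd p)))"
    proof (rule integrable_pair_dominated[OF \<Lambda>(1) Q.prob_space_axioms w])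
      show "\<bar>h (snd (s, z)) * (w (fst (s, z)) * I n (fst (s, z)) (snd (s, z)))\<bar> \<le> C * \<bar>w s\<bar>" for s z
        unfolding abs_mult[of "h _"] fst_conv snd_conv using h wI I01 C by (intro mult_mono) auto
    qed measurable
    have "(LINT z|Q. h z * \<zeta> n z) = (LINT z|Q. (LINT s|\<Lambda>. h z * (w s * I n s z)))"
      unfolding \<zeta> by simp
    also have "\<dots> = (LINT s|\<Lambda>. (LINT z|Q. h z * (w s * I n s z)))"
      using pair.Fubini_integral[of "\<lambda>s z. h z * (w s * I n s z)"] int unfolding case_prod_beta by blast
    also have "\<dots> = (LINT s|\<Lambda>. w s * (LINT z|Q. h z * I n s z))"
      by (simp add: mult.left_commute flip: integral_mult_right_zero)
    finally show ?thesis .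
  qed
  define m where "m n = (LINT z|Q. \<zeta> n z)" for n
  have Iint: "(LINT z|Q. I n s z) = measure Q (S n s)" for n s
    using Ss[of n s] by (simp add: I_def)
  have IIint: "(LINT z|Q. I n s' z * I n s z) = measure Q (S n s \<inter> S n s')" for n s s'
  proof -
    have "I n s' z * I n s z = indicator (S n s \<inter> S n s') z" for z by (auto simp: I_def indicator_def)
    then show ?thesis using Ss[of n s] Ss[of n s'] by simp
  qed
  have m_eq: "m n = (LINT s|\<Lambda>. w s * measure Q (S n s))" for n
    using swap[of "\<lambda>_. 1" 1 n] by (simp add: m_def Iint)
  have Sm[measurable]: "(\<lambda>s. measure Q (S n s)) \<in> borel_measurable \<Lambda>" for n
    unfolding Iint[symmetric] by measurable
  have SSm[measurable]: "(\<lambda>s'. measure Q (S n s \<inter> S n s')) \<in> borel_measurable \<Lambda>" for n s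
    unfolding IIint[symmetric] by measurable
  have m_le: "\<bar>m n\<bar> \<le> k n / n * B" if n: "n \<ge> 1" for n
    unfolding m_eq using wc[of "\<lambda>s. measure Q (S n s)"] wcB[of "\<lambda>s. measure Q (S n s)" "k n / n"] small[OF n]
    by simp
  have second: "(LINT z|Q. (\<zeta> n z)\<^sup>2) = (LINT s|\<Lambda>. w s * (LINT s'|\<Lambda>. w s' * measure Q (S n s \<inter> S n s')))" for n
  proof -
    have "(LINT z|Q. (\<zeta> n z)\<^sup>2) = (LINT s|\<Lambda>. w s * (LINT z|Q. \<zeta> n z * I n s z))"
      using swap[of "\<zeta> n" B n] \<zeta>B by (simp add: power2_eq_square)
    also have "(\<lambda>s. LINT z|Q. \<zeta> n z * I n s z) = (\<lambda>s. LINT s'|\<Lambda>. w s' * measure Q (S n s \<inter> S n s'))"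
    proof
      show "(LINT z|Q. \<zeta> n z * I n s z) = (LINT s'|\<Lambda>. w s' * measure Q (S n s \<inter> S n s'))" for s
        using swap[of "I n s" 1 n] I01 by (simp add: IIint mult.commute Int_commute)
    qed
    finally show ?thesis .
  qed
  define V where "V = (LINT s|\<Lambda>. w s * (LINT s'|\<Lambda>. w s' * K s s'))"
  define c where "c n s s' = measure Q (S n s \<inter> S n s') / (k n / n)" for n s s'
  have cm[measurable]: "c n s \<in> borel_measurable \<Lambda>" for n s unfolding c_def[abs_def] by measurable
  have c01: "0 \<le> c n s s'" "c n s s' \<le> 1" for n s s'
  proof -
    show "0 \<le> c n s s'" by (simp add: c_def)
    show "c n s s' \<le> 1"
    proof (cases "n \<ge> 1")
      case True
      have "measure Q (S n s \<inter> S n s') \<le> measure Q (S n s)"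
        using Ss by (intro Q.finite_measure_mono) auto
      also have "\<dots> \<le> k n / n" by (rule small[OF True])
      finally have "measure Q (S n s \<inter> S n s') \<le> k n / n" .
      moreover have "0 < k n / n" using True k(1)[OF True] by simp
      ultimately show ?thesis by (simp only: c_def divide_le_eq_1_pos)
    next
      case False
      then have "n = 0" by simp
      then show ?thesis by (simp add: c_def)
    qed
  qed
  have Km[measurable]: "K s \<in> borel_measurable \<Lambda>" for s
    using K[of s] by (rule borel_measurable_LIMSEQ_metric[rotated]) (use cm in \<open>simp add: c_def[abs_def]\<close>)
  have Kc: "(\<lambda>n. c n s s') \<longlonglongrightarrow> K s s'" for s s'
    using K[of s s'] by (simp only: c_def)
  have inner: "(\<lambda>n. LINT s'|\<Lambda>. w s' * c n s s') \<longlonglongrightarrow> (LINT s'|\<Lambda>. w s' * K s s')" for s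
    by (rule integral_dominated_convergence[where w="\<lambda>s. \<bar>w s\<bar>"])
      (use wB Kc wI c01 in \<open>auto intro!: tendsto_mult\<close>)
  have cint: "(LINT s'|\<Lambda>. w s' * c n s s') = (LINT s'|\<Lambda>. w s' * measure Q (S n s \<inter> S n s')) / (k n / n)" for n s
    unfolding c_def times_divide_eq_right by (rule integral_divide_zero)
  have innerm[measurable]: "(\<lambda>s. LINT s'|\<Lambda>. w s' * c n s s') \<in> borel_measurable \<Lambda>" for n
  proof -
    have "(LINT s'|\<Lambda>. w s' * c n s s') = (LINT z|Q. \<zeta> n z * I n s z) / (k n / n)" for s
      unfolding cint using swap[of "I n s" 1 n] I01 by (simp add: IIint mult.commute Int_commute)
    then show ?thesis by simp
  qed
  have inner_le: "\<bar>LINT s'|\<Lambda>. w s' * c n s s'\<bar> \<le> B" for n s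
    using wc[of "c n s"] wcB[of "c n s" 1] c01 by simp
  have outer: "(\<lambda>n. LINT s|\<Lambda>. w s * (LINT s'|\<Lambda>. w s' * c n s s')) \<longlonglongrightarrow> V"
    unfolding V_def
  proof (rule integral_dominated_convergence[where w="\<lambda>s. \<bar>w s\<bar> * B"])
    show "(\<lambda>s. w s * (LINT s'|\<Lambda>. w s' * K s s')) \<in> borel_measurable \<Lambda>"
      using borel_measurable_LIMSEQ_metric[OF innerm inner] by measurable
    show "AE s in \<Lambda>. norm (w s * (LINT s'|\<Lambda>. w s' * c n s s')) \<le> \<bar>w s\<bar> * B" for n
      using inner_le by (auto simp: abs_mult intro!: mult_left_mono)
  qed (use wB inner in \<open>auto intro!: tendsto_mult\<close>)
  define f where "f n z = (\<zeta> n z - m n) / sqrt (k n)" for n z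
  have fm[measurable]: "f n \<in> borel_measurable borel" for n unfolding f_def[abs_def] by measurable
  have mB: "\<bar>m n\<bar> \<le> B" for n
    unfolding m_eq using wc[of "\<lambda>s. measure Q (S n s)"] wcB[of "\<lambda>s. measure Q (S n s)" 1] by simp
  have fb: "\<bar>f n z\<bar> \<le> 2 * B / sqrt (k n)" for n z
    using \<zeta>B[of n z] mB[of n] by (auto simp: f_def abs_divide intro!: divide_right_mono)
  have "filterlim (\<lambda>n. sqrt (real (k n))) at_top sequentially"
    using k(2) by (intro filterlim_compose[OF sqrt_at_top] filterlim_compose[OF filterlim_real_sequentially])
  then have b0: "(\<lambda>n. 2 * B / sqrt (k n)) \<longlonglongrightarrow> 0"
    by (intro tendsto_divide_0[OF tendsto_const] filterlim_at_top_imp_at_infinity)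
  have f0: "(LINT z|Q. f n z) = 0" for n
    using \<zeta>i[of n] by (simp add: f_def m_def)
  have fv: "(\<lambda>n. n * (LINT z|Q. (f n z)\<^sup>2)) \<longlonglongrightarrow> V"
  proof -
    have i2: "integrable Q (\<lambda>z. (\<zeta> n z)\<^sup>2)" for n
    proof (rule Q.integrable_const_bound[of _ "B\<^sup>2"])
      show "AE z in Q. norm ((\<zeta> n z)\<^sup>2) \<le> B\<^sup>2"
        using power_mono[OF \<zeta>B abs_ge_zero, of n _ 2] by simp
    qed simp
    have veq: "n * (LINT z|Q. (f n z)\<^sup>2) = (LINT s|\<Lambda>. w s * (LINT s'|\<Lambda>. w s' * c n s s')) - n / k n * (m n)\<^sup>2" if n: "n \<ge> 1" for n
    proof -
      have "(f n z)\<^sup>2 = ((\<zeta> n z)\<^sup>2 - 2 * m n * \<zeta> n z + (m n)\<^sup>2) / k n" for z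
        using k(1)[OF n] by (simp add: f_def power_divide power2_diff algebra_simps)
      then have "(LINT z|Q. (f n z)\<^sup>2) = ((LINT z|Q. (\<zeta> n z)\<^sup>2) - 2 * m n * m n + (m n)\<^sup>2) / k n"
        using i2[of n] \<zeta>i[of n] by (simp add: m_def[symmetric])
      moreover have "(LINT s|\<Lambda>. w s * (LINT s'|\<Lambda>. w s' * c n s s')) = (LINT z|Q. (\<zeta> n z)\<^sup>2) / (k n / n)"
        unfolding second cint times_divide_eq_right by (rule integral_divide_zero)
      ultimately show ?thesis by (simp only:) (simp add: algebra_simps power2_eq_square add_divide_distrib diff_divide_distrib)
    qed
    have "(\<lambda>n. n / k n * (m n)\<^sup>2) \<longlonglongrightarrow> 0"
    proof (rule Lim_null_comparison)
      show "\<forall>\<^sub>F n in sequentially. norm (n / k n * (m n)\<^sup>2) \<le> k n / n * B\<^sup>2"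
        using eventually_ge_at_top[of 1]
      proof eventually_elim
        case (elim n)
        have "(m n)\<^sup>2 \<le> (k n / n * B)\<^sup>2" using power_mono[OF m_le[OF elim] abs_ge_zero, of 2] by simp
        then have "n / k n * (m n)\<^sup>2 \<le> n / k n * (k n / n * B)\<^sup>2" by (intro mult_left_mono) auto
        also have "\<dots> = k n / n * B\<^sup>2" using elim k(1)[OF elim] by (simp add: field_simps power2_eq_square)
        finally show ?case by simp
      qed
      show "(\<lambda>n. k n / n * B\<^sup>2) \<longlonglongrightarrow> 0" using tendsto_mult_right[OF k(3), of "B\<^sup>2"] by simp
    qed
    with outer have "(\<lambda>n. (LINT s|\<Lambda>. w s * (LINT s'|\<Lambda>. w s' * c n s s')) - n / k n * (m n)\<^sup>2) \<longlonglongrightarrow> V - 0"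
      by (intro tendsto_diff)
    then have "(\<lambda>n. (LINT s|\<Lambda>. w s * (LINT s'|\<Lambda>. w s' * c n s s')) - n / k n * (m n)\<^sup>2) \<longlonglongrightarrow> V" by simp
    then show ?thesis
      by (rule Lim_transform_eventually) (intro eventually_sequentiallyI[of 1], rule veq[symmetric])
  qed
  have sum_eq: "(\<Sum>i=1..n. f n (Z i \<omega>)) = ((\<Sum>i=1..n. \<zeta> n (Z i \<omega>)) - n * m n) / sqrt (k n)" for n \<omega>
    by (simp add: f_def sum_subtractf flip: sum_divide_distrib)
  show ?thesis
    using bounded_triangular_array_clt[OF fm fb b0 f0 fv] unfolding sum_eq V_def m_def .
qed

end

section \<open>The tail empirical process and the second moment of the remainder\<close>

lemma (in tail_copula) no_atom1: "measure Q {z. fst z = u} = 0"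
proof -
  have [simp]: "{z :: real \<times> real. fst z = u} \<in> sets borel" for u
    by (rule sets_borel_Collect_pair) measurable
  consider "u \<le> 0" | "1 < u" | "0 < u" "u \<le> 1" by linarith
  then show ?thesis
  proof cases
    case 1
    then have "measure Q {z. fst z = u} \<le> measure Q {z. fst z \<le> 0}" by (intro finite_measure_mono) auto
    then show ?thesis using uniform1[of 0] by (simp add: antisym)
  next
    case 2
    then have "measure Q {z. fst z = u} \<le> measure Q (space Q - {z. fst z \<le> 1})" by (intro finite_measure_mono) auto
    also have "\<dots> = 0" using prob_compl[of "{z. fst z \<le> 1}"] uniform1[of 1] by simp
    finally show ?thesis by (simp add: antisym)
  next
    case 3
    have "measure Q {z. fst z = u} \<le> 0 + e" if "e > 0" for e
    proof -
      have "measure Q {z. fst z = u} \<le> measure Q {z. u - min e u < fst z \<and> fst z \<le> u}"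
        using that 3 by (intro finite_measure_mono) auto
      also have "\<dots> = u - (u - min e u)" using that 3 by (intro uniform1_strip) auto
      finally show ?thesis by auto
    qed
    then have "measure Q {z. fst z = u} \<le> 0" by (rule field_le_epsilon)
    then show ?thesis by (simp add: antisym)
  qed
qed

lemma (in tail_copula) no_atom2: "measure Q {z. snd z = u} = 0"
proof -
  have [simp]: "{z :: real \<times> real. snd z = u} \<in> sets borel" for u
    by (rule sets_borel_Collect_pair) measurable
  consider "u \<le> 0" | "1 < u" | "0 < u" "u \<le> 1" by linarith
  then show ?thesis
  proof cases
    case 1
    then have "measure Q {z. snd z = u} \<le> measure Q {z. snd z \<le> 0}" by (intro finite_measure_mono) auto
    then show ?thesis using uniform2[of 0] by (simp add: antisym)
  next
    case 2
    then have "measure Q {z. snd z = u} \<le> measure Q (space Q - {z. snd z \<le> 1})" by (intro finite_measure_mono) auto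
    also have "\<dots> = 0" using prob_compl[of "{z. snd z \<le> 1}"] uniform2[of 1] by simp
    finally show ?thesis by (simp add: antisym)
  next
    case 3
    have "measure Q {z. snd z = u} \<le> 0 + e" if "e > 0" for e
    proof -
      have "measure Q {z. snd z = u} \<le> measure Q {z. u - min e u < snd z \<and> snd z \<le> u}"
        using that 3 by (intro finite_measure_mono) auto
      also have "\<dots> = u - (u - min e u)" using that 3 by (intro uniform2_strip) auto
      finally show ?thesis by auto
    qed
    then have "measure Q {z. snd z = u} \<le> 0" by (rule field_le_epsilon)
    then show ?thesis by (simp add: antisym)
  qed
qed

text \<open>Two independent variables with the same atomless law coincide with probability zero, by Fubini for
the product of their laws.\<close>

lemma (in iid_sample) AE_distinct:
  fixes f :: "'d \<Rightarrow> real"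
  assumes [measurable]: "f \<in> borel_measurable borel" and atom: "\<And>u. measure Q {z. f z = u} = 0" and ij: "i \<noteq> j"
  shows "AE \<omega> in M. f (Z i \<omega>) \<noteq> f (Z j \<omega>)"
proof -
  define D where "D = distr Q borel f"
  interpret D: prob_space D unfolding D_def by (rule Q.prob_space_distr) simp
  interpret DD: pair_sigma_finite D D ..
  have dist: "distr M borel (\<lambda>\<omega>. f (Z l \<omega>)) = D" for l
    unfolding D_def law[of l, symmetric] by (subst distr_distr) (auto simp: comp_def)
  have "indep_var borel (\<lambda>\<omega>. f (Z i \<omega>)) borel (\<lambda>\<omega>. \<Sum>l\<in>{j}. f (Z l \<omega>))"
    using ij by (intro indep_vars_sum[of "{j}" i "\<lambda>l \<omega>. f (Z l \<omega>)"]
        indep_vars_compose2[OF indep_vars_subset[OF indep]]) auto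
  then have eq: "D \<Otimes>\<^sub>M D = distr M (borel \<Otimes>\<^sub>M borel) (\<lambda>\<omega>. (f (Z i \<omega>), f (Z j \<omega>)))"
    using indep_var_distribution_eq[of borel "\<lambda>\<omega>. f (Z i \<omega>)" borel "\<lambda>\<omega>. f (Z j \<omega>)"] by (simp add: dist)
  have [measurable_cong]: "sets D = sets borel" by (simp add: D_def)
  have "AE p in D \<Otimes>\<^sub>M D. fst p \<noteq> snd p"
  proof (rule DD.AE_pair_measure)
    show "{p \<in> space (D \<Otimes>\<^sub>M D). fst p \<noteq> snd p} \<in> sets (D \<Otimes>\<^sub>M D)" by measurable
    show "AE x in D. AE y in D. fst (x, y) \<noteq> snd (x, y)"
    proof (rule AE_I2)
      fix x
      have "measure D {x} = 0"
        unfolding D_def by (subst measure_distr) (auto simp: vimage_def atom)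
      then have "emeasure D {x} = 0" by (simp add: D.emeasure_eq_measure)
      then have "AE y in D. y \<notin> {x}" by (intro AE_not_in) (auto simp: null_sets_def D_def)
      then show "AE y in D. fst (x, y) \<noteq> snd (x, y)" by eventually_elim auto
    qed
  qed
  then have "AE \<omega> in M. fst (f (Z i \<omega>), f (Z j \<omega>)) \<noteq> snd (f (Z i \<omega>), f (Z j \<omega>))"
    unfolding eq by (subst (asm) AE_distr_iff) auto
  then show ?thesis by simp
qed

text \<open>Observations \<open>X i\<close>, \<open>Y i\<close> together with decreasing transforms that bring them to the law \<open>Q\<close> of
\<open>(U, V)\<close>, and an intermediate sequence for which the bias is \<open>o(1 / sqrt k)\<close>.\<close>

locale tail_sample = iid_sample M Z Q + tail: tail_copula Q R
  for M :: "'a measure" and Z :: "nat \<Rightarrow> 'a \<Rightarrow> real \<times> real" and Q and R +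
  fixes X Y :: "nat \<Rightarrow> 'a \<Rightarrow> real" and f1 f2 :: "real \<Rightarrow> real" and k :: "nat \<Rightarrow> nat" and \<beta> :: "nat \<Rightarrow> real"
  assumes X_measurable [measurable]: "\<And>i. X i \<in> borel_measurable M"
    and Y_measurable [measurable]: "\<And>i. Y i \<in> borel_measurable M"
    and f1: "antimono f1" and f2: "antimono f2"
    and Z_eq: "\<And>i \<omega>. Z i \<omega> = (f1 (X i \<omega>), f2 (Y i \<omega>))"
    and k_range: "\<And>n. n \<ge> 1 \<Longrightarrow> k n \<in> {1..n}"
    and k_top: "filterlim k at_top sequentially"
    and k_small: "(\<lambda>n. k n / n) \<longlonglongrightarrow> 0"
    and bias: "\<forall>\<^sub>F n in sequentially. \<forall>x\<in>{0..2}. \<forall>y\<in>{0..2}.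
      sqrt (k n) * \<bar>tail.cop (k n / n * x) (k n / n * y) / (k n / n) - R x y\<bar> \<le> \<beta> n"
    and \<beta>: "\<beta> \<longlonglongrightarrow> 0"
begin

definition t :: "nat \<Rightarrow> real" where "t n = real (k n) / real n"

lemma t_bounds: "n \<ge> 1 \<Longrightarrow> 0 < t n" "n \<ge> 1 \<Longrightarrow> t n \<le> 1"
  using k_range[of n] by (auto simp: t_def)

lemma n_times_t: "n \<ge> 1 \<Longrightarrow> n * t n = k n"
  by (simp add: t_def)

lemma t_tendsto_0: "t \<longlonglongrightarrow> 0"
  using k_small by (simp add: t_def[abs_def])

lemma bias_t: "\<forall>\<^sub>F n in sequentially. \<forall>x\<in>{0..2}. \<forall>y\<in>{0..2}.
      sqrt (k n) * \<bar>tail.cop (t n * x) (t n * y) / t n - R x y\<bar> \<le> \<beta> n"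
  using bias unfolding t_def .

lemma AE_no_ties: "AE \<omega> in M. inj (\<lambda>i. X i \<omega>) \<and> inj (\<lambda>i. Y i \<omega>)"
proof -
  have [measurable]: "fst \<in> borel_measurable (borel :: (real \<times> real) measure)"
    "snd \<in> borel_measurable (borel :: (real \<times> real) measure)"
    by (intro borel_measurable_continuous_onI continuous_intros)+
  have "AE \<omega> in M. \<forall>i j. i \<noteq> j \<longrightarrow> fst (Z i \<omega>) \<noteq> fst (Z j \<omega>)"
    unfolding AE_all_countable using AE_distinct[of fst] tail.no_atom1 by auto
  moreover have "AE \<omega> in M. \<forall>i j. i \<noteq> j \<longrightarrow> snd (Z i \<omega>) \<noteq> snd (Z j \<omega>)"
    unfolding AE_all_countable using AE_distinct[of snd] tail.no_atom2 by auto
  ultimately show ?thesis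
  proof eventually_elim
    case (elim \<omega>)
    have "X i \<omega> = X j \<omega> \<Longrightarrow> i = j" "Y i \<omega> = Y j \<omega> \<Longrightarrow> i = j" for i j
      using elim(1)[rule_format, of i j] elim(2)[rule_format, of i j] by (auto simp: Z_eq)
    then show ?case by (simp add: inj_on_def)
  qed
qed

text \<open>The tail empirical process: since the functions of interest live on a region of mass of order \<open>k / n\<close>, the
normalization is \<open>sqrt k\<close>.\<close>

definition \<nu> :: "nat \<Rightarrow> (real \<times> real \<Rightarrow> real) \<Rightarrow> 'a \<Rightarrow> real" where
  "\<nu> n f \<omega> = ((\<Sum>i=1..n. f (Z i \<omega>)) - n * (LINT z|Q. f z)) / sqrt (k n)"

lemma measurable_of_Z [measurable (raw)]:
  "f \<in> borel_measurable borel \<Longrightarrow> (\<lambda>\<omega>. f (Z i \<omega>)) \<in> borel_measurable M"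
  by (rule measurable_compose[OF Z_measurable])

lemma \<nu>_measurable [measurable]: "f \<in> borel_measurable borel \<Longrightarrow> \<nu> n f \<in> borel_measurable M"
  unfolding \<nu>_def[abs_def]
  by (intro borel_measurable_divide borel_measurable_diff borel_measurable_sum measurable_of_Z) auto

lemma \<nu>_diff:
  assumes [measurable]: "f \<in> borel_measurable borel" "g \<in> borel_measurable borel"
    and "\<And>z. \<bar>f z\<bar> \<le> B" "\<And>z. \<bar>g z\<bar> \<le> B"
  shows "\<nu> n (\<lambda>z. f z - g z) \<omega> = \<nu> n f \<omega> - \<nu> n g \<omega>"
proof -
  have "integrable Q f" "integrable Q g" using assms by (auto intro!: Q.integrable_const_bound[of _ B])
  then show ?thesis by (simp add: \<nu>_def sum_subtractf diff_divide_distrib right_diff_distrib)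
qed

lemma \<nu>_mult: "\<nu> n (\<lambda>z. c * f z) \<omega> = c * \<nu> n f \<omega>"
  by (simp add: \<nu>_def field_simps flip: sum_distrib_left)

lemma \<nu>_bounded:
  assumes "\<And>z. \<bar>f z\<bar> \<le> B"
  shows "\<bar>\<nu> n f \<omega>\<bar> \<le> 2 * n * B / sqrt (k n)"
proof -
  have B: "0 \<le> B" using assms[of undefined] by linarith
  have "\<bar>\<Sum>i=1..n. f (Z i \<omega>)\<bar> \<le> (\<Sum>i=1..n. \<bar>f (Z i \<omega>)\<bar>)" by (rule sum_abs)
  also have "\<dots> \<le> n * B" using sum_bounded_above[of "{1..n}" "\<lambda>i. \<bar>f (Z i \<omega>)\<bar>" B] assms by simp
  finally have 1: "\<bar>\<Sum>i=1..n. f (Z i \<omega>)\<bar> \<le> n * B" .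
  have "\<bar>LINT z|Q. f z\<bar> \<le> B"
  proof (cases "integrable Q f")
    case True
    have "\<bar>LINT z|Q. f z\<bar> \<le> (LINT z|Q. \<bar>f z\<bar>)" by (rule integral_abs_bound)
    also have "\<dots> \<le> B" using True assms by (intro Q.integral_le_const) auto
    finally show ?thesis .
  qed (simp add: not_integrable_integral_eq B)
  then have "\<bar>n * (LINT z|Q. f z)\<bar> \<le> n * B" by (simp add: abs_mult mult_left_mono)
  with 1 have "\<bar>(\<Sum>i=1..n. f (Z i \<omega>)) - n * (LINT z|Q. f z)\<bar> \<le> 2 * n * B" by linarith
  then show ?thesis by (simp add: \<nu>_def abs_divide divide_right_mono)
qed

lemma \<nu>_square_integrable:
  assumes [measurable]: "f \<in> borel_measurable borel" and "\<And>z. \<bar>f z\<bar> \<le> B"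
  shows "integrable M (\<lambda>\<omega>. (\<nu> n f \<omega>)\<^sup>2)"
proof (rule integrable_const_bound[of _ "(2 * n * B / sqrt (k n))\<^sup>2"])
  show "AE \<omega> in M. norm ((\<nu> n f \<omega>)\<^sup>2) \<le> (2 * n * B / sqrt (k n))\<^sup>2"
    using power_mono[OF \<nu>_bounded[OF assms(2)] abs_ge_zero, where n=2] by simp
qed measurable

lemma \<nu>_second_moment:
  assumes [measurable]: "f \<in> borel_measurable borel" and "\<And>z. \<bar>f z\<bar> \<le> B" and n: "n \<ge> 1"
  shows "expectation (\<lambda>\<omega>. (\<nu> n f \<omega>)\<^sup>2) \<le> (LINT z|Q. (f z)\<^sup>2) / t n"
proof -
  have "expectation (\<lambda>\<omega>. (\<nu> n f \<omega>)\<^sup>2) = expectation (\<lambda>\<omega>. ((\<Sum>i=1..n. f (Z i \<omega>)) - n * (LINT z|Q. f z))\<^sup>2) / k n"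
    unfolding \<nu>_def power_divide by simp
  also have "\<dots> \<le> n * (LINT z|Q. (f z)\<^sup>2) / k n"
    using expectation_sum_squared[OF assms(1,2)] by (intro divide_right_mono) auto
  finally show ?thesis by (simp add: t_def mult.commute)
qed

abbreviation H1 :: "real \<Rightarrow> (real \<times> real) set" where "H1 u \<equiv> {w. fst w \<le> u}"
abbreviation H2 :: "real \<Rightarrow> (real \<times> real) set" where "H2 v \<equiv> {w. snd w \<le> v}"
abbreviation HU :: "real \<Rightarrow> real \<Rightarrow> (real \<times> real) set" where "HU u v \<equiv> {w. fst w \<le> u \<or> snd w \<le> v}"
abbreviation HI :: "real \<Rightarrow> real \<Rightarrow> (real \<times> real) set" where "HI u v \<equiv> {w. fst w \<le> u \<and> snd w \<le> v}"

abbreviation \<nu>S :: "nat \<Rightarrow> (real \<times> real) set \<Rightarrow> 'a \<Rightarrow> real" where "\<nu>S n S \<equiv> \<nu> n (indicat_real S)"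

lemma measure_HU:
  assumes "0 \<le> u" "u \<le> 1" "0 \<le> v" "v \<le> 1"
  shows "measure Q (HU u v) = u + v - tail.cop u v"
proof -
  have "measure Q (H1 u \<union> H2 v) = measure Q (H1 u) + measure Q (H2 v) - measure Q (H1 u \<inter> H2 v)"
    by (rule measure_Un3) (auto simp: Q.fmeasurable_eq_sets)
  moreover have "H1 u \<union> H2 v = HU u v" "H1 u \<inter> H2 v = HI u v" by auto
  ultimately show ?thesis using assms by (simp add: tail.uniform1 tail.uniform2 tail.cop_def)
qed

text \<open>Second moments of increments of indicators, which \<open>\<nu>_second_moment\<close> turns into the continuity modulus of the tail empirical
process.\<close>

lemma second_moment_H1:
  assumes "0 \<le> u" "u \<le> 1" "0 \<le> u'" "u' \<le> 1"
  shows "(LINT w|Q. (indicat_real (H1 u') w - indicat_real (H1 u) w)\<^sup>2) = \<bar>u' - u\<bar>"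
proof -
  have *: "(LINT w|Q. (indicat_real (H1 b) w - indicat_real (H1 a) w)\<^sup>2) = b - a" if "0 \<le> a" "a \<le> b" "b \<le> 1" for a b
  proof -
    have "(indicat_real (H1 b) w - indicat_real (H1 a) w)\<^sup>2 = indicat_real {w. a < fst w \<and> fst w \<le> b} w" for w :: "real \<times> real"
      using that by (auto simp: indicator_def)
    then show ?thesis using that by (simp add: tail.uniform1_strip)
  qed
  show ?thesis
    using *[of u u'] *[of u' u] assms by (cases "u \<le> u'") (auto simp: power2_commute[of "indicat_real (H1 u') _"])
qed

lemma second_moment_H2:
  assumes "0 \<le> u" "u \<le> 1" "0 \<le> u'" "u' \<le> 1"
  shows "(LINT w|Q. (indicat_real (H2 u') w - indicat_real (H2 u) w)\<^sup>2) = \<bar>u' - u\<bar>"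
proof -
  have *: "(LINT w|Q. (indicat_real (H2 b) w - indicat_real (H2 a) w)\<^sup>2) = b - a" if "0 \<le> a" "a \<le> b" "b \<le> 1" for a b
  proof -
    have "(indicat_real (H2 b) w - indicat_real (H2 a) w)\<^sup>2 = indicat_real {w. a < snd w \<and> snd w \<le> b} w" for w :: "real \<times> real"
      using that by (auto simp: indicator_def)
    then show ?thesis using that by (simp add: tail.uniform2_strip)
  qed
  show ?thesis
    using *[of u u'] *[of u' u] assms by (cases "u \<le> u'") (auto simp: power2_commute[of "indicat_real (H2 u') _"])
qed

lemma square_indicator_diff_integrable:
  "A \<in> sets borel \<Longrightarrow> B \<in> sets borel \<Longrightarrow> integrable Q (\<lambda>w. (indicat_real A w - indicat_real B w)\<^sup>2)"
  by (rule Q.integrable_const_bound[of _ 1]) (auto simp: indicator_def)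

lemma second_moment_HU:
  assumes "0 \<le> u" "u \<le> 1" "0 \<le> u'" "u' \<le> 1" "0 \<le> v" "v \<le> 1" "0 \<le> v'" "v' \<le> 1"
  shows "(LINT w|Q. (indicat_real (HU u' v') w - indicat_real (HU u v) w)\<^sup>2) \<le> \<bar>u' - u\<bar> + \<bar>v' - v\<bar>"
proof -
  have "(LINT w|Q. (indicat_real (HU u' v') w - indicat_real (HU u v) w)\<^sup>2)
      \<le> (LINT w|Q. (indicat_real (H1 u') w - indicat_real (H1 u) w)\<^sup>2 + (indicat_real (H2 v') w - indicat_real (H2 v) w)\<^sup>2)"
    by (intro integral_mono Bochner_Integration.integrable_add square_indicator_diff_integrable)
      (auto simp: indicator_def)
  also have "\<dots> = \<bar>u' - u\<bar> + \<bar>v' - v\<bar>"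
    using assms by (subst Bochner_Integration.integral_add)
      (auto intro: square_indicator_diff_integrable simp: second_moment_H1 second_moment_H2)
  finally show ?thesis .
qed

lemma count_eq:
  assumes "n \<ge> 1" "S \<in> sets borel"
  shows "real (card {i \<in> {1..n}. Z i \<omega> \<in> S}) = sqrt (k n) * \<nu>S n S \<omega> + n * measure Q S"
proof -
  have "(\<Sum>i=1..n. indicator S (Z i \<omega>)) = real (card ({1..n} \<inter> {i. Z i \<omega> \<in> S}))"
    unfolding indicator_def by (simp only: sum_of_bool_eq finite_atLeastAtMost)
  moreover have "{1..n} \<inter> {i. Z i \<omega> \<in> S} = {i \<in> {1..n}. Z i \<omega> \<in> S}" by auto
  ultimately show ?thesis using assms k_range[of n] by (simp add: \<nu>_def)
qed

text \<open>The summand of the linear expansion: \<open>\<nu> n (influence n z)\<close> is the empirical counterpart of the limit process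
\<open>B\<close> at \<open>z\<close>.\<close>

definition influence :: "nat \<Rightarrow> real \<times> real \<Rightarrow> real \<times> real \<Rightarrow> real" where
  "influence n z w = indicator (HI (t n * fst z) (t n * snd z)) w
    - tail.D1 z * indicator (H1 (t n * fst z)) w - tail.D2 z * indicator (H2 (t n * snd z)) w"

lemma influence_measurable [measurable]: "influence n z \<in> borel_measurable borel"
  unfolding influence_def[abs_def] by (intro borel_measurable_diff borel_measurable_times borel_measurable_indicator) auto

lemma influence_bound: "\<bar>influence n z w\<bar> \<le> 2 * indicator (HU (t n * fst z) (t n * snd z)) w"
  using tail.D_bounds[of z] by (auto simp: influence_def indicator_def)

text \<open>Inclusion and exclusion rewrites the expansion with the union event, which is the event that the
estimator counts.\<close>

lemma \<nu>_influence:
  "\<nu> n (influence n z) \<omega> = - \<nu>S n (HU (t n * fst z) (t n * snd z)) \<omega>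
    + (1 - tail.D1 z) * \<nu>S n (H1 (t n * fst z)) \<omega> + (1 - tail.D2 z) * \<nu>S n (H2 (t n * snd z)) \<omega>"
proof -
  define u v a b where "u = t n * fst z" and "v = t n * snd z" and "a = 1 - tail.D1 z" and "b = 1 - tail.D2 z"
  have "influence n z = (\<lambda>w. - indicat_real (HU u v) w + a * indicator (H1 u) w + b * indicator (H2 v) w)"
    by (rule ext) (auto simp: influence_def u_def v_def a_def b_def indicator_def)
  moreover have "integrable Q (indicator S :: _ \<Rightarrow> real)" if "S \<in> sets borel" for S :: "(real \<times> real) set"
    using that by (intro Q.integrable_const_bound[of _ 1]) (auto simp: indicator_def)
  ultimately have "(LINT w|Q. influence n z w) = - measure Q (HU u v) + a * measure Q (H1 u) + b * measure Q (H2 v)"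
    and "(\<Sum>i=1..n. influence n z (Z i \<omega>)) = - (\<Sum>i=1..n. indicat_real (HU u v) (Z i \<omega>))
      + a * (\<Sum>i=1..n. indicat_real (H1 u) (Z i \<omega>)) + b * (\<Sum>i=1..n. indicat_real (H2 v) (Z i \<omega>))"
    by (simp_all add: sum.distrib sum_negf sum_subtractf sum_distrib_left)
  then have "\<nu> n (influence n z) \<omega> = - \<nu>S n (HU u v) \<omega> + a * \<nu>S n (H1 u) \<omega> + b * \<nu>S n (H2 v) \<omega>"
    by (simp add: \<nu>_def add_divide_distrib diff_divide_distrib right_diff_distrib distrib_left mult_ac)
  then show ?thesis by (simp add: u_def v_def a_def b_def)
qed

text \<open>The error of the estimator minus its linear expansion \<open>- \<nu> n (influence n z)\<close>.\<close>

definition remainder :: "nat \<Rightarrow> real \<times> real \<Rightarrow> 'a \<Rightarrow> real" where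
  "remainder n z \<omega> = sqrt (k n) * (stdf_estimator X Y n (k n) \<omega> (fst z) (snd z)
      - (fst z + snd z - R (fst z) (snd z))) + \<nu> n (influence n z) \<omega>"

lemma scaled_sum_div_sqrt: "0 < q \<Longrightarrow> (sqrt q * a + q * c) / sqrt q = a + sqrt q * c"
proof -
  assume "0 < q"
  then have "q * c / sqrt q = sqrt q * c" using real_div_sqrt[of q] by (metis less_imp_le times_divide_eq_left)
  with \<open>0 < q\<close> show ?thesis by (simp add: add_divide_distrib)
qed

lemma union_estimate:
  assumes n: "n \<ge> 1" and uv: "0 \<le> u" "t n * u \<le> 1" "0 \<le> v" "t n * v \<le> 1"
  shows "card {i \<in> {1..n}. Z i \<omega> \<in> HU (t n * u) (t n * v)} / sqrt (k n)
    = \<nu>S n (HU (t n * u) (t n * v)) \<omega> + sqrt (k n) * (u + v - tail.cop (t n * u) (t n * v) / t n)"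
proof -
  define c where "c = u + v - tail.cop (t n * u) (t n * v) / t n"
  have "measure Q (HU (t n * u) (t n * v)) = t n * u + t n * v - tail.cop (t n * u) (t n * v)"
    using uv t_bounds[OF n] by (intro measure_HU) auto
  also have "\<dots> = t n * c" using t_bounds(1)[OF n] by (simp add: c_def right_diff_distrib distrib_left)
  finally have "n * measure Q (HU (t n * u) (t n * v)) = k n * c" using n_times_t[OF n] by (simp flip: mult.assoc)
  then have "real (card {i \<in> {1..n}. Z i \<omega> \<in> HU (t n * u) (t n * v)}) = sqrt (k n) * \<nu>S n (HU (t n * u) (t n * v)) \<omega> + k n * c"
    using count_eq[OF n borel_rectangles(4)[of "t n * u" "t n * v"], of \<omega>] by simp
  then show ?thesis
    using scaled_sum_div_sqrt[of "k n"] k_range[OF n] by (simp add: c_def)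
qed

lemma strip_count:
  fixes u :: real
  assumes n: "n \<ge> 1" and u: "0 \<le> u" "t n * u \<le> 1"
  shows "real (card {j \<in> {1..n}. f1 (X j \<omega>) \<le> t n * u}) = sqrt (k n) * \<nu>S n (H1 (t n * u)) \<omega> + k n * u"
    "real (card {j \<in> {1..n}. f2 (Y j \<omega>) \<le> t n * u}) = sqrt (k n) * \<nu>S n (H2 (t n * u)) \<omega> + k n * u"
proof -
  have "n * (t n * u) = k n * u" using n_times_t[OF n] by (simp flip: mult.assoc)
  then show "real (card {j \<in> {1..n}. f1 (X j \<omega>) \<le> t n * u}) = sqrt (k n) * \<nu>S n (H1 (t n * u)) \<omega> + k n * u"
    "real (card {j \<in> {1..n}. f2 (Y j \<omega>) \<le> t n * u}) = sqrt (k n) * \<nu>S n (H2 (t n * u)) \<omega> + k n * u"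
    using count_eq[OF n, of "H1 (t n * u)" \<omega>] count_eq[OF n, of "H2 (t n * u)" \<omega>] u t_bounds[OF n]
    by (simp_all add: tail.uniform1 tail.uniform2 Z_eq)
qed

lemma stdf_scaled:
  fixes x y c :: real
  shows "n \<ge> 1 \<Longrightarrow> sqrt (k n) * (stdf_estimator X Y n (k n) \<omega> x y - c)
    = card (top_set X n (k n * x) \<omega> \<union> top_set Y n (k n * y) \<omega>) / sqrt (k n) - sqrt (k n) * c"
proof -
  assume "n \<ge> 1"
  then have "sqrt (k n) / k n = 1 / sqrt (k n)" using k_range[of n] real_div_sqrt[of "k n"] by (auto simp: field_simps)
  then show ?thesis by (simp add: stdf_estimator_card right_diff_distrib) (metis times_divide_eq_right mult.commute mult.right_neutral)
qed

lemma stdf_estimator_measurable: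
  assumes [measurable]: "W \<in> measurable N M" "x \<in> borel_measurable N" "y \<in> borel_measurable N"
  shows "(\<lambda>p. stdf_estimator X Y n m (W p) (x p) (y p)) \<in> borel_measurable N"
  unfolding stdf_estimator_def by measurable

lemma remainder_measurable [measurable]: "remainder n z \<in> borel_measurable M"
  unfolding remainder_def[abs_def]
  by (intro borel_measurable_add borel_measurable_times borel_measurable_diff stdf_estimator_measurable) auto

text \<open>Replacing the random levels by deterministic ones costs at most the two marginal fluctuations and
rounding (\<open>top_set_union_error\<close>), so the remainder is dominated by the tail empirical process at three fixed sets.\<close>

lemma remainder_AE_bound:
  assumes n: "n \<ge> 1" and z: "z \<in> {0..1} \<times> {0..1}"
    and bias_n: "sqrt (k n) * \<bar>tail.cop (t n * fst z) (t n * snd z) / t n - R (fst z) (snd z)\<bar> \<le> 1"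
  shows "AE \<omega> in M. \<bar>remainder n z \<omega>\<bar> \<le> 2 * (\<bar>\<nu>S n (HU (t n * fst z) (t n * snd z)) \<omega>\<bar>
    + \<bar>\<nu>S n (H1 (t n * fst z)) \<omega>\<bar> + \<bar>\<nu>S n (H2 (t n * snd z)) \<omega>\<bar> + 1)"
  using AE_no_ties
proof eventually_elim
  case (elim \<omega>)
  define x y where "x = fst z" and "y = snd z"
  have xy: "0 \<le> x" "x \<le> 1" "0 \<le> y" "y \<le> 1" using z by (auto simp: x_def y_def)
  have tx: "t n * x \<le> 1" "t n * y \<le> 1" using xy t_bounds[OF n] by (auto intro: mult_le_one)
  define A0 B0 where "A0 = {j \<in> {1..n}. f1 (X j \<omega>) \<le> t n * x}" and "B0 = {j \<in> {1..n}. f2 (Y j \<omega>) \<le> t n * y}"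
  define q where "q = sqrt (k n)"
  have q: "q \<ge> 1" using k_range[OF n] by (simp add: q_def)
  define a b c d where "a = \<nu>S n (HU (t n * x) (t n * y)) \<omega>" and "b = \<nu>S n (H1 (t n * x)) \<omega>"
    and "c = \<nu>S n (H2 (t n * y)) \<omega>" and "d = R x y - tail.cop (t n * x) (t n * y) / t n"
  define U where "U = top_set X n (k n * x) \<omega> \<union> top_set Y n (k n * y) \<omega>"
  have kx: "k n * x \<le> n" "k n * y \<le> n"
    using xy k_range[OF n] mult_mono[of "real (k n)" n x 1] mult_mono[of "real (k n)" n y 1] by auto
  have "inj_on (\<lambda>i. X i \<omega>) {1..n}" "inj_on (\<lambda>i. Y i \<omega>) {1..n}"
    using elim by (auto intro: inj_on_subset)
  then have e: "\<bar>real (card U) - card (A0 \<union> B0)\<bar> \<le> \<bar>card A0 - k n * x\<bar> + \<bar>card B0 - k n * y\<bar> + 1"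
    unfolding U_def A0_def B0_def using kx xy by (intro top_set_union_error f1 f2) auto
  have cards: "real (card A0) = q * b + k n * x" "real (card B0) = q * c + k n * y"
    unfolding A0_def B0_def b_def c_def q_def
    by (rule strip_count[OF n xy(1) tx(1)], rule strip_count[OF n xy(3) tx(2)])
  have "\<bar>real (card U) - card (A0 \<union> B0)\<bar> \<le> q * \<bar>b\<bar> + q * \<bar>c\<bar> + 1"
    using e q unfolding cards by (simp add: abs_mult)
  also have "\<dots> \<le> q * (\<bar>b\<bar> + \<bar>c\<bar> + 1)" using q by (simp add: distrib_left)
  finally have "\<bar>real (card U) - card (A0 \<union> B0)\<bar> / q \<le> \<bar>b\<bar> + \<bar>c\<bar> + 1"
    using q by (simp add: divide_le_eq mult.commute)
  then have 1: "\<bar>card U / q - card (A0 \<union> B0) / q\<bar> \<le> \<bar>b\<bar> + \<bar>c\<bar> + 1"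
    using q by (simp flip: diff_divide_distrib)
  have "A0 \<union> B0 = {i \<in> {1..n}. Z i \<omega> \<in> HU (t n * x) (t n * y)}"
    by (auto simp: A0_def B0_def Z_eq)
  then have 2: "card (A0 \<union> B0) / q = a + q * (x + y - tail.cop (t n * x) (t n * y) / t n)"
    unfolding a_def q_def using union_estimate[OF n _ tx(1) _ tx(2)] xy by simp
  have 3: "remainder n z \<omega> = card U / q - q * (x + y - R x y) + \<nu> n (influence n z) \<omega>"
    unfolding remainder_def U_def q_def x_def y_def by (simp only: stdf_scaled[OF n])
  have 4: "\<nu> n (influence n z) \<omega> = - a + (1 - tail.D1 z) * b + (1 - tail.D2 z) * c"
    by (simp add: \<nu>_influence a_def b_def c_def x_def y_def)
  have "q * \<bar>d\<bar> \<le> 1" using bias_n by (simp add: q_def d_def x_def y_def abs_minus_commute)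
  then have 5: "\<bar>q * d\<bar> \<le> 1" using q by (simp add: abs_mult)
  have 6: "\<bar>(1 - tail.D1 z) * b\<bar> \<le> \<bar>b\<bar>" "\<bar>(1 - tail.D2 z) * c\<bar> \<le> \<bar>c\<bar>"
    using tail.D_bounds[of z] by (auto simp: abs_mult intro!: mult_left_le_one_le)
  have "remainder n z \<omega> = (card U / q - card (A0 \<union> B0) / q) + q * d + (1 - tail.D1 z) * b + (1 - tail.D2 z) * c"
    unfolding 3 4 2 by (simp add: d_def algebra_simps)
  then have "\<bar>remainder n z \<omega>\<bar> \<le> \<bar>card U / q - card (A0 \<union> B0) / q\<bar> + \<bar>q * d\<bar>
      + \<bar>(1 - tail.D1 z) * b\<bar> + \<bar>(1 - tail.D2 z) * c\<bar>"
    by linarith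
  also have "\<dots> \<le> (\<bar>b\<bar> + \<bar>c\<bar> + 1) + 1 + \<bar>b\<bar> + \<bar>c\<bar>"
    using 1 5 6 by (intro add_mono)
  also have "\<dots> \<le> 2 * (\<bar>a\<bar> + \<bar>b\<bar> + \<bar>c\<bar> + 1)" by simp
  finally have "\<bar>remainder n z \<omega>\<bar> \<le> 2 * (\<bar>a\<bar> + \<bar>b\<bar> + \<bar>c\<bar> + 1)" .
  then show ?case by (simp add: a_def b_def c_def x_def y_def)
qed

lemma second_moment_strips:
  assumes n: "n \<ge> 1" and x: "0 \<le> x" "t n * x \<le> 1"
  shows "expectation (\<lambda>\<omega>. (\<nu>S n (H1 (t n * x)) \<omega>)\<^sup>2) \<le> x" "expectation (\<lambda>\<omega>. (\<nu>S n (H2 (t n * x)) \<omega>)\<^sup>2) \<le> x"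
proof -
  have sq: "(indicat_real S w)\<^sup>2 = indicat_real S w" for S :: "(real \<times> real) set" and w by (simp add: indicator_def)
  show "expectation (\<lambda>\<omega>. (\<nu>S n (H1 (t n * x)) \<omega>)\<^sup>2) \<le> x"
    using \<nu>_second_moment[OF borel_measurable_indicator[OF borel_rectangles(1)[of "t n * x"]], of 1 n] n x t_bounds[OF n] by (simp add: sq tail.uniform1)
  show "expectation (\<lambda>\<omega>. (\<nu>S n (H2 (t n * x)) \<omega>)\<^sup>2) \<le> x"
    using \<nu>_second_moment[OF borel_measurable_indicator[OF borel_rectangles(2)[of "t n * x"]], of 1 n] n x t_bounds[OF n] by (simp add: sq tail.uniform2)
qed

lemma second_moment_union:
  assumes n: "n \<ge> 1" and x: "0 \<le> x" "t n * x \<le> 1" and y: "0 \<le> y" "t n * y \<le> 1"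
  shows "expectation (\<lambda>\<omega>. (\<nu>S n (HU (t n * x) (t n * y)) \<omega>)\<^sup>2) \<le> x + y"
proof -
  have sq: "(indicat_real S w)\<^sup>2 = indicat_real S w" for S :: "(real \<times> real) set" and w by (simp add: indicator_def)
  have "expectation (\<lambda>\<omega>. (\<nu>S n (HU (t n * x) (t n * y)) \<omega>)\<^sup>2) \<le> measure Q (HU (t n * x) (t n * y)) / t n"
    using \<nu>_second_moment[OF borel_measurable_indicator[OF borel_rectangles(4)[of "t n * x" "t n * y"]], of 1 n] n by (simp add: sq)
  also have "\<dots> \<le> (t n * (x + y)) / t n"
    using t_bounds[OF n] x y by (intro divide_right_mono) (auto simp: measure_HU tail.cop_def distrib_left)
  also have "\<dots> = x + y" using t_bounds(1)[OF n] by simp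
  finally show ?thesis .
qed

lemma second_moment_remainder:
  "\<forall>\<^sub>F n in sequentially. \<forall>z\<in>{0..1} \<times> {0..1}. integrable M (\<lambda>\<omega>. (remainder n z \<omega>)\<^sup>2) \<and>
    expectation (\<lambda>\<omega>. (remainder n z \<omega>)\<^sup>2) \<le> 80"
proof -
  have "\<forall>\<^sub>F n in sequentially. \<beta> n < 1" using \<beta> by (intro order_tendstoD(2)) auto
  then show ?thesis using bias_t eventually_ge_at_top[of 1]
  proof eventually_elim
    case (elim n)
    show ?case
    proof
      fix z :: "real \<times> real" assume z: "z \<in> {0..1} \<times> {0..1}"
      have n: "n \<ge> 1" by fact
      have z': "0 \<le> fst z" "fst z \<le> 1" "0 \<le> snd z" "snd z \<le> 1" using z by auto
      have tz: "t n * fst z \<le> 1" "t n * snd z \<le> 1" using z' t_bounds[OF n] by (auto intro: mult_le_one)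
      define a b c where "a = \<nu>S n (HU (t n * fst z) (t n * snd z))" and "b = \<nu>S n (H1 (t n * fst z))"
        and "c = \<nu>S n (H2 (t n * snd z))"
      have "sqrt (k n) * \<bar>tail.cop (t n * fst z) (t n * snd z) / t n - R (fst z) (snd z)\<bar> \<le> 1"
        using elim(1) elim(2)[rule_format, of "fst z" "snd z"] z' by simp
      note * = remainder_AE_bound[OF n z this]
      have sq: "(2 * (a + b + c + 1))\<^sup>2 \<le> 16 * (a\<^sup>2 + b\<^sup>2 + c\<^sup>2 + 1)" for a b c :: real
      proof -
        have "16 * (a\<^sup>2 + b\<^sup>2 + c\<^sup>2 + 1) - (2 * (a + b + c + 1))\<^sup>2 = 4 * ((a - b)\<^sup>2 + (a - c)\<^sup>2
            + (a - 1)\<^sup>2 + (b - c)\<^sup>2 + (b - 1)\<^sup>2 + (c - 1)\<^sup>2)"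
          by (simp add: power2_eq_square algebra_simps)
        moreover have "0 \<le> 4 * ((a - b)\<^sup>2 + (a - c)\<^sup>2 + (a - 1)\<^sup>2 + (b - c)\<^sup>2 + (b - 1)\<^sup>2 + (c - 1)\<^sup>2)"
          by (intro mult_nonneg_nonneg add_nonneg_nonneg zero_le_power2) simp
        ultimately show ?thesis by linarith
      qed
      have AE: "AE \<omega> in M. (remainder n z \<omega>)\<^sup>2 \<le> 16 * ((a \<omega>)\<^sup>2 + (b \<omega>)\<^sup>2 + (c \<omega>)\<^sup>2 + 1)"
        using *
      proof eventually_elim
        case (elim \<omega>)
        then have "\<bar>remainder n z \<omega>\<bar>\<^sup>2 \<le> (2 * (\<bar>a \<omega>\<bar> + \<bar>b \<omega>\<bar> + \<bar>c \<omega>\<bar> + 1))\<^sup>2"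
          unfolding a_def b_def c_def by (intro power_mono) simp_all
        from order.trans[OF this sq] show ?case by (simp only: power2_abs)
      qed
      have i: "integrable M (\<lambda>\<omega>. (a \<omega>)\<^sup>2)" "integrable M (\<lambda>\<omega>. (b \<omega>)\<^sup>2)" "integrable M (\<lambda>\<omega>. (c \<omega>)\<^sup>2)"
        unfolding a_def b_def c_def by (auto intro!: \<nu>_square_integrable[of _ 1] borel_measurable_indicator)
      then have I: "integrable M (\<lambda>\<omega>. 16 * ((a \<omega>)\<^sup>2 + (b \<omega>)\<^sup>2 + (c \<omega>)\<^sup>2 + 1))" by simp
      have "expectation (\<lambda>\<omega>. (remainder n z \<omega>)\<^sup>2) \<le> expectation (\<lambda>\<omega>. 16 * ((a \<omega>)\<^sup>2 + (b \<omega>)\<^sup>2 + (c \<omega>)\<^sup>2 + 1))"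
        using AE I by (intro integral_mono_AE') auto
      also have "\<dots> = 16 * (expectation (\<lambda>\<omega>. (a \<omega>)\<^sup>2) + expectation (\<lambda>\<omega>. (b \<omega>)\<^sup>2) + expectation (\<lambda>\<omega>. (c \<omega>)\<^sup>2) + 1)"
        using i by (simp add: prob_space)
      also have "\<dots> \<le> 16 * ((1 + 1) + 1 + 1 + 1)"
      proof (intro mult_left_mono add_mono)
        show "expectation (\<lambda>\<omega>. (a \<omega>)\<^sup>2) \<le> 1 + 1"
          unfolding a_def by (rule order.trans[OF second_moment_union[OF n z'(1) tz(1) z'(3) tz(2)] add_mono[OF z'(2) z'(4)]])
        show "expectation (\<lambda>\<omega>. (b \<omega>)\<^sup>2) \<le> 1"
          unfolding b_def by (rule order.trans[OF second_moment_strips(1)[OF n z'(1) tz(1)] z'(2)])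
        show "expectation (\<lambda>\<omega>. (c \<omega>)\<^sup>2) \<le> 1"
          unfolding c_def by (rule order.trans[OF second_moment_strips(2)[OF n z'(3) tz(2)] z'(4)])
      qed auto
      also have "\<dots> = 80" by simp
      finally have "expectation (\<lambda>\<omega>. (remainder n z \<omega>)\<^sup>2) \<le> 80" .
      moreover have "integrable M (\<lambda>\<omega>. (remainder n z \<omega>)\<^sup>2)"
        by (rule Bochner_Integration.integrable_bound[OF I]) (use AE in \<open>auto elim!: eventually_mono\<close>)
      ultimately show "integrable M (\<lambda>\<omega>. (remainder n z \<omega>)\<^sup>2) \<and> expectation (\<lambda>\<omega>. (remainder n z \<omega>)\<^sup>2) \<le> 80" by simp
    qed
  qed
qed

end

section \<open>The linear expansion at a regular point\<close>

context tail_sample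
begin

text \<open>Deterministic part of the argument.  The grid consists of the points \<open>x + \<delta> j / sqrt k\<close>, the scale on which the random levels fluctuate.
If the tail empirical process hardly varies over the grid (\<open>close1\<close>, \<open>close2\<close>, \<open>closeU\<close>), the marginal fluctuations stay within
the grid (\<open>tight\<close>), and the expectation is linear over the grid (\<open>lin\<close>), then both random levels
are bracketed by grid points (\<open>top_set_bracket\<close>).  The estimator is monotone in the levels, and at the bracketing
points it agrees with the linear expansion up to multiples of \<open>\<delta>\<close>.\<close>

lemma remainder_on_grid:
  fixes L :: int and \<delta> x y :: real
  assumes n: "n \<ge> 1" and \<delta>: "\<delta> > 0"
  defines "q \<equiv> sqrt (k n)"
  assumes pos: "\<And>j. \<bar>j\<bar> \<le> L \<Longrightarrow> 0 \<le> x + \<delta> * of_int j / q \<and> t n * (x + \<delta> * of_int j / q) \<le> 1"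
      "\<And>j. \<bar>j\<bar> \<le> L \<Longrightarrow> 0 \<le> y + \<delta> * of_int j / q \<and> t n * (y + \<delta> * of_int j / q) \<le> 1"
    and close1: "\<And>j. \<bar>j\<bar> \<le> L \<Longrightarrow>
      \<bar>\<nu>S n (H1 (t n * (x + \<delta> * of_int j / q))) \<omega> - \<nu>S n (H1 (t n * x)) \<omega>\<bar> \<le> \<delta>"
    and close2: "\<And>j. \<bar>j\<bar> \<le> L \<Longrightarrow>
      \<bar>\<nu>S n (H2 (t n * (y + \<delta> * of_int j / q))) \<omega> - \<nu>S n (H2 (t n * y)) \<omega>\<bar> \<le> \<delta>"
    and closeU: "\<And>j l. \<bar>j\<bar> \<le> L \<Longrightarrow> \<bar>l\<bar> \<le> L \<Longrightarrow>
      \<bar>\<nu>S n (HU (t n * (x + \<delta> * of_int j / q)) (t n * (y + \<delta> * of_int l / q))) \<omega> - \<nu>S n (HU (t n * x) (t n * y)) \<omega>\<bar> \<le> \<delta>"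
    and tight: "\<bar>\<nu>S n (H1 (t n * x)) \<omega>\<bar> \<le> \<delta> * (L - 3)" "\<bar>\<nu>S n (H2 (t n * y)) \<omega>\<bar> \<le> \<delta> * (L - 3)"
    and lin: "\<And>j l. \<bar>j\<bar> \<le> L \<Longrightarrow> \<bar>l\<bar> \<le> L \<Longrightarrow>
      \<bar>q * (x + \<delta> * of_int j / q + (y + \<delta> * of_int l / q)
          - tail.cop (t n * (x + \<delta> * of_int j / q)) (t n * (y + \<delta> * of_int l / q)) / t n - (x + y - R x y))
        - ((1 - tail.D1 (x, y)) * (\<delta> * of_int j) + (1 - tail.D2 (x, y)) * (\<delta> * of_int l))\<bar> \<le> \<delta>"
  shows "\<bar>remainder n (x, y) \<omega>\<bar> \<le> 6 * \<delta>"
proof -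
  define xs ys where "xs j = x + \<delta> * of_int j / q" and "ys j = y + \<delta> * of_int j / q" for j :: int
  have q: "q > 0" "k n / q = q" using k_range[OF n] by (auto simp: q_def real_div_sqrt)
  have kq: "k n * (c + \<delta> * of_int j / q) = k n * c + q * (\<delta> * of_int j)" for c :: real and j :: int
  proof -
    have "k n * (\<delta> * of_int j / q) = (k n / q) * (\<delta> * of_int j)" by simp
    then show ?thesis using q by (simp add: distrib_left)
  qed
  define h1 h2 o0 where "h1 = \<nu>S n (H1 (t n * x)) \<omega>" and "h2 = \<nu>S n (H2 (t n * y)) \<omega>" and "o0 = \<nu>S n (HU (t n * x) (t n * y)) \<omega>"
  define d1 d2 where "d1 = 1 - tail.D1 (x, y)" and "d2 = 1 - tail.D2 (x, y)"
  have d: "0 \<le> d1" "d1 \<le> 1" "0 \<le> d2" "d2 \<le> 1" using tail.D_bounds[of "(x, y)"] by (auto simp: d1_def d2_def)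
  define A B where "A = top_set X n (k n * x) \<omega>" and "B = top_set Y n (k n * y) \<omega>"
  obtain j where j: "\<bar>j - 1\<bar> \<le> L" "\<bar>j + 2\<bar> \<le> L" "\<delta> * j \<le> - h1" "- h1 < \<delta> * (j + 1)"
    "{i \<in> {1..n}. f1 (X i \<omega>) \<le> t n * xs (j - 1)} \<subseteq> A" "A \<subseteq> {i \<in> {1..n}. f1 (X i \<omega>) \<le> t n * xs (j + 2)}"
    unfolding A_def
  proof (rule top_set_bracket[where f=f1 and X=X and \<omega>=\<omega> and n=n and \<delta>=\<delta> and q=q and s="k n * x" and J=L
        and u="\<lambda>j. t n * xs j" and h="\<lambda>j. \<nu>S n (H1 (t n * xs j)) \<omega>" and ?h0.0=h1])
    show "real (card {i \<in> {1..n}. f1 (X i \<omega>) \<le> t n * xs j}) =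
        q * \<nu>S n (H1 (t n * xs j)) \<omega> + k n * x + q * (\<delta> * of_int j)" if "\<bar>j\<bar> \<le> L" for j
      using strip_count(1)[OF n, of "xs j"] pos(1)[OF that] kq[of x j] by (simp add: xs_def q_def)
    show "\<bar>\<nu>S n (H1 (t n * xs j)) \<omega> - h1\<bar> \<le> \<delta>" if "\<bar>j\<bar> \<le> L" for j
      using close1[OF that] by (simp add: xs_def h1_def)
  qed (use f1 \<delta> q tight in \<open>auto simp: h1_def\<close>)
  obtain l where l: "\<bar>l - 1\<bar> \<le> L" "\<bar>l + 2\<bar> \<le> L" "\<delta> * l \<le> - h2" "- h2 < \<delta> * (l + 1)"
    "{i \<in> {1..n}. f2 (Y i \<omega>) \<le> t n * ys (l - 1)} \<subseteq> B" "B \<subseteq> {i \<in> {1..n}. f2 (Y i \<omega>) \<le> t n * ys (l + 2)}"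
    unfolding B_def
  proof (rule top_set_bracket[where f=f2 and X=Y and \<omega>=\<omega> and n=n and \<delta>=\<delta> and q=q and s="k n * y" and J=L
        and u="\<lambda>j. t n * ys j" and h="\<lambda>j. \<nu>S n (H2 (t n * ys j)) \<omega>" and ?h0.0=h2])
    show "real (card {i \<in> {1..n}. f2 (Y i \<omega>) \<le> t n * ys j}) =
        q * \<nu>S n (H2 (t n * ys j)) \<omega> + k n * y + q * (\<delta> * of_int j)" if "\<bar>j\<bar> \<le> L" for j
      using strip_count(2)[OF n, of "ys j"] pos(2)[OF that] kq[of y j] by (simp add: ys_def q_def)
    show "\<bar>\<nu>S n (H2 (t n * ys j)) \<omega> - h2\<bar> \<le> \<delta>" if "\<bar>j\<bar> \<le> L" for j
      using close2[OF that] by (simp add: ys_def h2_def)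
  qed (use f2 \<delta> q tight in \<open>auto simp: h2_def\<close>)
  (* the count that the estimator would give with deterministic levels at the grid points j and l *)
  define G where "G j l = {i \<in> {1..n}. Z i \<omega> \<in> HU (t n * xs j) (t n * ys l)}" for j l
  have G: "\<bar>card (G j l) / q - q * (x + y - R x y) - (o0 + d1 * (\<delta> * of_int j) + d2 * (\<delta> * of_int l))\<bar> \<le> 2 * \<delta>"
    if jl: "\<bar>j\<bar> \<le> L" "\<bar>l\<bar> \<le> L" for j l
  proof -
    have "card (G j l) / q = \<nu>S n (HU (t n * xs j) (t n * ys l)) \<omega>
        + q * (xs j + ys l - tail.cop (t n * xs j) (t n * ys l) / t n)"
      unfolding G_def q_def xs_def ys_def
      by (rule union_estimate) (use n pos(1)[OF jl(1)] pos(2)[OF jl(2)] in \<open>auto simp: q_def\<close>)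
    then show ?thesis
      using closeU[OF jl] lin[OF jl]
      unfolding xs_def[symmetric] ys_def[symmetric] d1_def[symmetric] d2_def[symmetric] o0_def[symmetric]
      by (simp add: right_diff_distrib distrib_left)
  qed
  have "G (j - 1) (l - 1) \<subseteq> A \<union> B" "A \<union> B \<subseteq> G (j + 2) (l + 2)"
    using j(5,6) l(5,6) by (auto simp: G_def Z_eq)
  then have "card (G (j - 1) (l - 1)) \<le> card (A \<union> B)" "card (A \<union> B) \<le> card (G (j + 2) (l + 2))"
    by (auto intro!: card_mono simp: A_def B_def) (auto intro!: card_mono simp: G_def)
  then have card: "card (G (j - 1) (l - 1)) / q \<le> card (A \<union> B) / q" "card (A \<union> B) / q \<le> card (G (j + 2) (l + 2)) / q"
    using q by (auto intro!: divide_right_mono)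
  have rem: "remainder n (x, y) \<omega> = card (A \<union> B) / q - q * (x + y - R x y) + (- o0 + d1 * h1 + d2 * h2)"
    unfolding remainder_def A_def B_def q_def o0_def d1_def d2_def h1_def h2_def by (simp add: stdf_scaled[OF n] \<nu>_influence)
  have up1: "d1 * (\<delta> * of_int (j + 2)) \<le> - (d1 * h1) + 2 * \<delta>" and lo1: "- (d1 * h1) - 2 * \<delta> \<le> d1 * (\<delta> * of_int (j - 1))"
  proof -
    have "d1 * (\<delta> * of_int (j + 2)) \<le> d1 * (- h1 + 2 * \<delta>)" using j(3) d by (intro mult_left_mono) (auto simp: distrib_left)
    moreover have "d1 * (2 * \<delta>) \<le> 1 * (2 * \<delta>)" using d \<delta> by (intro mult_right_mono) auto
    ultimately show "d1 * (\<delta> * of_int (j + 2)) \<le> - (d1 * h1) + 2 * \<delta>" by (simp add: algebra_simps)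
    have "d1 * (- h1 - 2 * \<delta>) \<le> d1 * (\<delta> * of_int (j - 1))" using j(4) d by (intro mult_left_mono) (auto simp: distrib_left right_diff_distrib)
    then show "- (d1 * h1) - 2 * \<delta> \<le> d1 * (\<delta> * of_int (j - 1))"
      using \<open>d1 * (2 * \<delta>) \<le> 1 * (2 * \<delta>)\<close> by (simp add: algebra_simps)
  qed
  have up2: "d2 * (\<delta> * of_int (l + 2)) \<le> - (d2 * h2) + 2 * \<delta>" and lo2: "- (d2 * h2) - 2 * \<delta> \<le> d2 * (\<delta> * of_int (l - 1))"
  proof -
    have "d2 * (\<delta> * of_int (l + 2)) \<le> d2 * (- h2 + 2 * \<delta>)" using l(3) d by (intro mult_left_mono) (auto simp: distrib_left)
    moreover have "d2 * (2 * \<delta>) \<le> 1 * (2 * \<delta>)" using d \<delta> by (intro mult_right_mono) auto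
    ultimately show "d2 * (\<delta> * of_int (l + 2)) \<le> - (d2 * h2) + 2 * \<delta>" by (simp add: algebra_simps)
    have "d2 * (- h2 - 2 * \<delta>) \<le> d2 * (\<delta> * of_int (l - 1))" using l(4) d by (intro mult_left_mono) (auto simp: distrib_left right_diff_distrib)
    then show "- (d2 * h2) - 2 * \<delta> \<le> d2 * (\<delta> * of_int (l - 1))"
      using \<open>d2 * (2 * \<delta>) \<le> 1 * (2 * \<delta>)\<close> by (simp add: algebra_simps)
  qed
  show ?thesis
    using G[OF j(2) l(2)] G[OF j(1) l(1)] card rem up1 up2 lo1 lo2 unfolding abs_le_iff by linarith
qed

lemma second_moment_close:
  fixes x x' y y' :: real
  assumes n: "n \<ge> 1" and x: "0 \<le> x" "t n * x \<le> 1" "0 \<le> x'" "t n * x' \<le> 1" and y: "0 \<le> y" "t n * y \<le> 1" "0 \<le> y'" "t n * y' \<le> 1"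
  shows "expectation (\<lambda>\<omega>. (\<nu>S n (H1 (t n * x')) \<omega> - \<nu>S n (H1 (t n * x)) \<omega>)\<^sup>2) \<le> \<bar>x' - x\<bar>"
    "expectation (\<lambda>\<omega>. (\<nu>S n (H2 (t n * x')) \<omega> - \<nu>S n (H2 (t n * x)) \<omega>)\<^sup>2) \<le> \<bar>x' - x\<bar>"
    "expectation (\<lambda>\<omega>. (\<nu>S n (HU (t n * x') (t n * y')) \<omega> - \<nu>S n (HU (t n * x) (t n * y)) \<omega>)\<^sup>2) \<le> \<bar>x' - x\<bar> + \<bar>y' - y\<bar>"
proof -
  have t: "0 < t n" by (rule t_bounds(1)[OF n])
  have t0: "0 \<le> t n * x" "0 \<le> t n * x'" "0 \<le> t n * y" "0 \<le> t n * y'" using t x y by auto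
  have ab: "\<bar>t n * a - t n * b\<bar> = t n * \<bar>a - b\<bar>" for a b using t by (simp add: abs_mult flip: right_diff_distrib)
  have diff: "\<nu>S n A \<omega> - \<nu>S n B \<omega> = \<nu> n (\<lambda>w. indicat_real A w - indicat_real B w) \<omega>"
    if "A \<in> sets borel" "B \<in> sets borel" for A B \<omega>
    using that by (intro \<nu>_diff[symmetric, of _ _ 1]) auto
  have bound: "expectation (\<lambda>\<omega>. (\<nu>S n A \<omega> - \<nu>S n B \<omega>)\<^sup>2) \<le> (LINT w|Q. (indicat_real A w - indicat_real B w)\<^sup>2) / t n"
    if "A \<in> sets borel" "B \<in> sets borel" for A B
    unfolding diff[OF that] using that by (intro \<nu>_second_moment[of _ 1] n) (auto simp: indicator_def)
  have le: "c / t n \<le> e" if "c \<le> t n * e" for c e using that t by (simp add: pos_divide_le_eq mult.commute)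
  show "expectation (\<lambda>\<omega>. (\<nu>S n (H1 (t n * x')) \<omega> - \<nu>S n (H1 (t n * x)) \<omega>)\<^sup>2) \<le> \<bar>x' - x\<bar>"
    by (rule order.trans[OF bound le]) (use second_moment_H1[OF t0(1) x(2) t0(2) x(4)] ab in auto)
  show "expectation (\<lambda>\<omega>. (\<nu>S n (H2 (t n * x')) \<omega> - \<nu>S n (H2 (t n * x)) \<omega>)\<^sup>2) \<le> \<bar>x' - x\<bar>"
    by (rule order.trans[OF bound le]) (use second_moment_H2[OF t0(1) x(2) t0(2) x(4)] ab in auto)
  show "expectation (\<lambda>\<omega>. (\<nu>S n (HU (t n * x') (t n * y')) \<omega> - \<nu>S n (HU (t n * x) (t n * y)) \<omega>)\<^sup>2) \<le> \<bar>x' - x\<bar> + \<bar>y' - y\<bar>"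
    by (rule order.trans[OF bound le])
      (use second_moment_HU[OF t0(1) x(2) t0(2) x(4) t0(3) y(2) t0(4) y(4)] ab in \<open>auto simp: distrib_left\<close>)
qed

text \<open>The linearity over the grid holds eventually because the bias is \<open>o(1 / sqrt k)\<close> and \<open>R\<close> is
differentiable along each line through \<open>(x, y)\<close>; only finitely many grid points occur.\<close>

lemma eventually_grid:
  fixes L :: int and \<delta> x y :: real
  assumes z: "tail.regular (x, y)" "x \<le> 1" "y \<le> 1" and \<delta>: "\<delta> > 0"
  shows "\<forall>\<^sub>F n in sequentially. \<forall>j\<in>{-L..L}. \<forall>l\<in>{-L..L}.
    0 \<le> x + \<delta> * of_int j / sqrt (k n) \<and> t n * (x + \<delta> * of_int j / sqrt (k n)) \<le> 1 \<and>
    0 \<le> y + \<delta> * of_int l / sqrt (k n) \<and> t n * (y + \<delta> * of_int l / sqrt (k n)) \<le> 1 \<and>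
    \<bar>sqrt (k n) * (x + \<delta> * of_int j / sqrt (k n) + (y + \<delta> * of_int l / sqrt (k n))
        - tail.cop (t n * (x + \<delta> * of_int j / sqrt (k n))) (t n * (y + \<delta> * of_int l / sqrt (k n))) / t n - (x + y - R x y))
      - ((1 - tail.D1 (x, y)) * (\<delta> * of_int j) + (1 - tail.D2 (x, y)) * (\<delta> * of_int l))\<bar> \<le> \<delta>"
proof (intro eventually_ball_finite ballI finite_atLeastAtMost_int)
  fix j l :: int
  define a b where "a = \<delta> * real_of_int j" and "b = \<delta> * real_of_int l"
  have xy: "0 < x" "0 < y" using z by (auto simp: tail.regular_def)
  have sk: "filterlim (\<lambda>n. sqrt (k n)) at_top sequentially"
    using k_top by (intro filterlim_compose[OF sqrt_at_top] filterlim_compose[OF filterlim_real_sequentially])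
  define s where "s n = 1 / sqrt (k n)" for n
  have s0: "s \<longlonglongrightarrow> 0"
    unfolding s_def[abs_def] by (intro tendsto_divide_0[OF tendsto_const] filterlim_at_top_imp_at_infinity sk)
  have spos: "\<forall>\<^sub>F n in sequentially. s n > 0"
    using eventually_ge_at_top[of 1] by eventually_elim (use k_range in \<open>force simp: s_def\<close>)
  have "((\<lambda>h. R (x + a * h) (y + b * h)) has_real_derivative (a * tail.D1 (x, y) + b * tail.D2 (x, y))) (at 0)"
    using z(1) by (simp add: tail.regular_def)
  then have "((\<lambda>h. (R (x + a * h) (y + b * h) - R x y) / h) \<longlongrightarrow> a * tail.D1 (x, y) + b * tail.D2 (x, y)) (at 0)"
    by (simp add: has_field_derivative_iff)
  moreover have "filterlim s (at 0) sequentially"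
    using s0 spos by (intro filterlim_atI) (auto elim: eventually_mono)
  ultimately have D: "(\<lambda>n. (R (x + a * s n) (y + b * s n) - R x y) / s n) \<longlonglongrightarrow> a * tail.D1 (x, y) + b * tail.D2 (x, y)"
    by (rule filterlim_compose)
  have X: "(\<lambda>n. x + a * s n) \<longlonglongrightarrow> x + a * 0" "(\<lambda>n. y + b * s n) \<longlonglongrightarrow> y + b * 0"
    by (intro tendsto_intros s0)+
  have ev: "\<forall>\<^sub>F n in sequentially. 0 < x + a * s n" "\<forall>\<^sub>F n in sequentially. 0 < y + b * s n"
    "\<forall>\<^sub>F n in sequentially. x + a * s n < 2" "\<forall>\<^sub>F n in sequentially. y + b * s n < 2"
    using order_tendstoD[OF X(1)] order_tendstoD[OF X(2)] xy z(2,3) by auto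
  have tt: "\<forall>\<^sub>F n in sequentially. t n < 1 / 2" using t_tendsto_0 by (rule order_tendstoD(2)) simp
  have lim: "(\<lambda>n. \<beta> n + \<bar>(R (x + a * s n) (y + b * s n) - R x y) / s n - (a * tail.D1 (x, y) + b * tail.D2 (x, y))\<bar>)
      \<longlonglongrightarrow> 0 + \<bar>(a * tail.D1 (x, y) + b * tail.D2 (x, y)) - (a * tail.D1 (x, y) + b * tail.D2 (x, y))\<bar>"
    using D \<beta> by (intro tendsto_intros)
  then have "\<forall>\<^sub>F n in sequentially. \<beta> n + \<bar>(R (x + a * s n) (y + b * s n) - R x y) / s n - (a * tail.D1 (x, y) + b * tail.D2 (x, y))\<bar> < \<delta>"
    using \<delta> by (intro order_tendstoD(2)) auto
  then show "\<forall>\<^sub>F n in sequentially.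
    0 \<le> x + \<delta> * of_int j / sqrt (k n) \<and> t n * (x + \<delta> * of_int j / sqrt (k n)) \<le> 1 \<and>
    0 \<le> y + \<delta> * of_int l / sqrt (k n) \<and> t n * (y + \<delta> * of_int l / sqrt (k n)) \<le> 1 \<and>
    \<bar>sqrt (k n) * (x + \<delta> * of_int j / sqrt (k n) + (y + \<delta> * of_int l / sqrt (k n))
        - tail.cop (t n * (x + \<delta> * of_int j / sqrt (k n))) (t n * (y + \<delta> * of_int l / sqrt (k n))) / t n - (x + y - R x y))
      - ((1 - tail.D1 (x, y)) * (\<delta> * of_int j) + (1 - tail.D2 (x, y)) * (\<delta> * of_int l))\<bar> \<le> \<delta>"
    using ev tt bias_t spos eventually_ge_at_top[of 1]
  proof eventually_elim
    case (elim n)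
    define u v q where "u = x + a * s n" and "v = y + b * s n" and "q = sqrt (k n)"
    have q: "q > 0" "q * s n = 1" "c / q = c * s n" for c using elim by (auto simp: s_def q_def)
    have tn: "0 < t n" "t n < 1/2" using elim t_bounds by auto
    have uv: "0 < u" "u < 2" "0 < v" "v < 2" using elim by (auto simp: u_def v_def)
    have "t n * u \<le> 1 / 2 * 2" "t n * v \<le> 1 / 2 * 2" using tn uv by (intro mult_mono; simp)+
    then have tuv: "t n * u \<le> 1" "t n * v \<le> 1" by auto
    have "q * \<bar>tail.cop (t n * u) (t n * v) / t n - R u v\<bar> \<le> \<beta> n" using elim uv by (auto simp: q_def)
    then have b1: "\<bar>q * (R u v - tail.cop (t n * u) (t n * v) / t n)\<bar> \<le> \<beta> n"
      using q(1) by (simp add: abs_mult abs_minus_commute)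
    have "(R u v - R x y) / s n = q * (R u v - R x y)" using q by (simp add: s_def q_def mult.commute)
    then have b2: "\<beta> n + \<bar>q * (R u v - R x y) - (a * tail.D1 (x, y) + b * tail.D2 (x, y))\<bar> \<le> \<delta>"
      using elim by (simp add: u_def v_def)
    have qa: "q * u = q * x + a" "q * v = q * y + b" using q by (simp_all add: u_def v_def distrib_left mult.left_commute[of q])
    have "q * (u + v - tail.cop (t n * u) (t n * v) / t n - (x + y - R x y))
        - ((1 - tail.D1 (x, y)) * a + (1 - tail.D2 (x, y)) * b)
      = q * (R u v - tail.cop (t n * u) (t n * v) / t n)
        - (q * (R u v - R x y) - (a * tail.D1 (x, y) + b * tail.D2 (x, y)))"
      using qa by (simp add: algebra_simps)
    then have "\<bar>q * (u + v - tail.cop (t n * u) (t n * v) / t n - (x + y - R x y))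
        - ((1 - tail.D1 (x, y)) * a + (1 - tail.D2 (x, y)) * b)\<bar> \<le> \<delta>"
      using b1 b2 by linarith
    then show ?case
      using uv tuv unfolding a_def[symmetric] b_def[symmetric] q_def[symmetric] q(3) u_def[symmetric] v_def[symmetric] by auto
  qed
qed

text \<open>For a fixed grid, \<open>S n\<close> collects the squared increments of the tail empirical process over the grid and has
expectation of order \<open>1 / sqrt k\<close>, while \<open>T n\<close> collects its squared marginal values, with expectation at most \<open>2\<close>.  When both
are small, \<open>remainder_on_grid\<close> applies.  Otherwise the remainder is truncated at a level \<open>K\<close>: the truncated part is
paid for by Chebyshev's inequality for \<open>S n\<close> and \<open>T n\<close>, the rest by the second moment of
the remainder.\<close>

theorem remainder_tendsto_0:
  assumes z: "tail.regular (x, y)" "x \<le> 1" "y \<le> 1"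
  shows "(\<lambda>n. expectation (\<lambda>\<omega>. \<bar>remainder n (x, y) \<omega>\<bar>)) \<longlonglongrightarrow> 0"
proof (rule tendstoI)
  fix \<epsilon> :: real assume \<epsilon>: "\<epsilon> > 0"
  (* 6 \<delta> = \<epsilon> / 5 and 80 / K = \<epsilon> / 5, where 80 is the bound of second_moment_remainder *)
  define \<delta> K where "\<delta> = \<epsilon> / 30" and "K = 400 / \<epsilon>"
  have \<delta>: "\<delta> > 0" and K: "K > 0" using \<epsilon> by (auto simp: \<delta>_def K_def)
  have xy: "0 < x" "0 < y" using z by (auto simp: tail.regular_def)
  (* the grid is so long that the marginal fluctuations leave it with small probability *)
  obtain m :: nat where m: "(2 * K / \<delta>\<^sup>2) / (\<epsilon> / 5) < real m" using reals_Archimedean2 by blast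
  define L where "L = int m + 4"
  define b where "b = \<delta> * (real_of_int L - 3)"
  have b: "b > 0" using \<delta> by (simp add: b_def L_def)
  have "2 * K / b\<^sup>2 \<le> \<epsilon> / 5"
  proof -
    have "real m \<le> (real_of_int L - 3)\<^sup>2" by (simp add: L_def power2_eq_square algebra_simps)
    then have "(2 * K / \<delta>\<^sup>2) / (\<epsilon> / 5) \<le> (real_of_int L - 3)\<^sup>2" using m by linarith
    then have "2 * K / \<delta>\<^sup>2 \<le> (real_of_int L - 3)\<^sup>2 * (\<epsilon> / 5)" using \<epsilon> by (simp only: pos_divide_le_eq[of "\<epsilon> / 5"] zero_less_divide_iff zero_less_numeral simp_thms)
    then have "2 * K \<le> ((real_of_int L - 3)\<^sup>2 * (\<epsilon> / 5)) * \<delta>\<^sup>2" using \<delta> by (simp add: pos_divide_le_eq)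
    then have "2 * K \<le> \<epsilon> / 5 * b\<^sup>2" by (simp add: b_def power_mult_distrib mult_ac)
    then show ?thesis using b by (simp add: pos_divide_le_eq)
  qed
  define I where "I = {-L..L}"
  have finI: "finite I" by (simp add: I_def)
  define xs ys where "xs n j = x + \<delta> * of_int j / sqrt (k n)" and "ys n j = y + \<delta> * of_int j / sqrt (k n)" for n and j :: int
  define h1 h2 o0 where "h1 n = \<nu>S n (H1 (t n * x))" and "h2 n = \<nu>S n (H2 (t n * y))" and "o0 n = \<nu>S n (HU (t n * x) (t n * y))" for n
  define g1 g2 gU where "g1 n j = \<nu>S n (H1 (t n * xs n j))" and "g2 n j = \<nu>S n (H2 (t n * ys n j))"
    and "gU n j l = \<nu>S n (HU (t n * xs n j) (t n * ys n l))" for n j l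
  define S where "S n \<omega> = (\<Sum>j\<in>I. (g1 n j \<omega> - h1 n \<omega>)\<^sup>2) + (\<Sum>j\<in>I. (g2 n j \<omega> - h2 n \<omega>)\<^sup>2)
    + (\<Sum>j\<in>I. \<Sum>l\<in>I. (gU n j l \<omega> - o0 n \<omega>)\<^sup>2)" for n \<omega>
  define T where "T n \<omega> = (h1 n \<omega>)\<^sup>2 + (h2 n \<omega>)\<^sup>2" for n \<omega>
  define C where "C = (\<Sum>j\<in>I. \<bar>\<delta> * of_int j\<bar>) + (\<Sum>j\<in>I. \<bar>\<delta> * of_int j\<bar>) + (\<Sum>j\<in>I. \<Sum>l\<in>I. \<bar>\<delta> * of_int j\<bar> + \<bar>\<delta> * of_int l\<bar>)"
  have S0: "0 \<le> S n \<omega>" "0 \<le> T n \<omega>" for n \<omega> by (auto simp: S_def T_def intro!: add_nonneg_nonneg sum_nonneg)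
  have g1S: "(g1 n j \<omega> - h1 n \<omega>)\<^sup>2 \<le> S n \<omega>" if "j \<in> I" for n j \<omega>
    using member_le_sum[OF that _ finI, of "\<lambda>j. (g1 n j \<omega> - h1 n \<omega>)\<^sup>2"] unfolding S_def
    by (intro add_increasing2 sum_nonneg) auto
  have g2S: "(g2 n j \<omega> - h2 n \<omega>)\<^sup>2 \<le> S n \<omega>" if "j \<in> I" for n j \<omega>
    using member_le_sum[OF that _ finI, of "\<lambda>j. (g2 n j \<omega> - h2 n \<omega>)\<^sup>2"] unfolding S_def
    by (intro add_increasing2 add_increasing sum_nonneg) auto
  have gUS: "(gU n j l \<omega> - o0 n \<omega>)\<^sup>2 \<le> S n \<omega>" if "j \<in> I" "l \<in> I" for n j l \<omega>
  proof -
    have "(gU n j l \<omega> - o0 n \<omega>)\<^sup>2 \<le> (\<Sum>l\<in>I. (gU n j l \<omega> - o0 n \<omega>)\<^sup>2)"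
      using member_le_sum[OF that(2) _ finI, of "\<lambda>l. (gU n j l \<omega> - o0 n \<omega>)\<^sup>2"] by simp
    also have "\<dots> \<le> (\<Sum>j\<in>I. \<Sum>l\<in>I. (gU n j l \<omega> - o0 n \<omega>)\<^sup>2)"
      using member_le_sum[OF that(1) _ finI, of "\<lambda>j. \<Sum>l\<in>I. (gU n j l \<omega> - o0 n \<omega>)\<^sup>2"] by (simp add: sum_nonneg)
    finally show ?thesis unfolding S_def by (intro add_increasing add_nonneg_nonneg sum_nonneg) auto
  qed
  have zI: "(x, y) \<in> {0..1} \<times> {0..1}" using xy z by auto
  have lim: "(\<lambda>n. K * (C / sqrt (k n)) / \<delta>\<^sup>2) \<longlonglongrightarrow> K * 0 / \<delta>\<^sup>2"
    using k_top \<delta> by (intro tendsto_intros tendsto_divide_0[OF tendsto_const] filterlim_at_top_imp_at_infinity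
        filterlim_compose[OF sqrt_at_top] filterlim_compose[OF filterlim_real_sequentially]) auto
  then have "\<forall>\<^sub>F n in sequentially. K * (C / sqrt (k n)) / \<delta>\<^sup>2 < \<epsilon> / 5"
    using \<epsilon> by (intro order_tendstoD(2)) auto
  then show "\<forall>\<^sub>F n in sequentially. dist (expectation (\<lambda>\<omega>. \<bar>remainder n (x, y) \<omega>\<bar>)) 0 < \<epsilon>"
    using eventually_grid[OF z \<delta>, of L] second_moment_remainder eventually_ge_at_top[of 1]
  proof eventually_elim
    case (elim n)
    have n: "n \<ge> 1" by fact
    have r2: "integrable M (\<lambda>\<omega>. (remainder n (x, y) \<omega>)\<^sup>2)" "expectation (\<lambda>\<omega>. (remainder n (x, y) \<omega>)\<^sup>2) \<le> 80"
      using elim(3) zI by blast+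
    have r1: "integrable M (\<lambda>\<omega>. remainder n (x, y) \<omega>)"
      by (rule square_integrable_imp_integrable[OF _ r2(1)]) measurable
    have jI: "j \<in> I \<longleftrightarrow> \<bar>j\<bar> \<le> L" for j by (auto simp: I_def)
    have pos: "0 \<le> xs n j" "t n * xs n j \<le> 1" "0 \<le> ys n j" "t n * ys n j \<le> 1" if "j \<in> I" for j
      using elim(2) that unfolding xs_def ys_def I_def by blast+
    have txy: "t n * x \<le> 1" "t n * y \<le> 1" using z xy t_bounds[OF n] by (auto intro: mult_le_one)
    have meas: "integrable M (\<lambda>\<omega>. (\<nu>S n A \<omega> - \<nu>S n B \<omega>)\<^sup>2)" if "A \<in> sets borel" "B \<in> sets borel" for A B
    proof -
      have "\<nu>S n A \<omega> - \<nu>S n B \<omega> = \<nu> n (\<lambda>w. indicat_real A w - indicat_real B w) \<omega>" for \<omega>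
        using that by (intro \<nu>_diff[symmetric, of _ _ 1]) auto
      then show ?thesis using that by (simp, intro \<nu>_square_integrable[of _ 1]) (auto simp: indicator_def)
    qed
    have iS: "integrable M (S n)"
      unfolding S_def[abs_def] g1_def g2_def gU_def h1_def h2_def o0_def
      by (intro Bochner_Integration.integrable_add Bochner_Integration.integrable_sum meas) auto
    have iT: "integrable M (T n)"
      unfolding T_def[abs_def] h1_def h2_def
      by (intro Bochner_Integration.integrable_add \<nu>_square_integrable[of _ 1] borel_measurable_indicator) auto
    have ES: "expectation (S n) \<le> C / sqrt (k n)"
    proof -
      have dx: "\<bar>xs n j - x\<bar> = \<bar>\<delta> * of_int j\<bar> / sqrt (k n)" "\<bar>ys n j - y\<bar> = \<bar>\<delta> * of_int j\<bar> / sqrt (k n)" for j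
        by (auto simp: xs_def ys_def)
      have "expectation (S n) = (\<Sum>j\<in>I. expectation (\<lambda>\<omega>. (g1 n j \<omega> - h1 n \<omega>)\<^sup>2)) + (\<Sum>j\<in>I. expectation (\<lambda>\<omega>. (g2 n j \<omega> - h2 n \<omega>)\<^sup>2))
          + (\<Sum>j\<in>I. \<Sum>l\<in>I. expectation (\<lambda>\<omega>. (gU n j l \<omega> - o0 n \<omega>)\<^sup>2))"
        unfolding S_def g1_def g2_def gU_def h1_def h2_def o0_def by (simp add: meas)
      also have "\<dots> \<le> (\<Sum>j\<in>I. \<bar>xs n j - x\<bar>) + (\<Sum>j\<in>I. \<bar>ys n j - y\<bar>)
          + (\<Sum>j\<in>I. \<Sum>l\<in>I. \<bar>xs n j - x\<bar> + \<bar>ys n l - y\<bar>)"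
        unfolding g1_def g2_def gU_def h1_def h2_def o0_def
        using pos xy txy by (intro add_mono sum_mono second_moment_close n) auto
      also have "\<dots> = C / sqrt (k n)"
        unfolding C_def dx add_divide_distrib sum_divide_distrib ..
      finally show ?thesis .
    qed
    have ET: "expectation (T n) \<le> 2"
    proof -
      have "expectation (T n) = expectation (\<lambda>\<omega>. (h1 n \<omega>)\<^sup>2) + expectation (\<lambda>\<omega>. (h2 n \<omega>)\<^sup>2)"
        unfolding T_def h1_def h2_def
        by (intro Bochner_Integration.integral_add \<nu>_square_integrable[of _ 1] borel_measurable_indicator) auto
      also have "\<dots> \<le> 1 + 1"
        unfolding h1_def h2_def using xy z
        by (intro add_mono order.trans[OF second_moment_strips(1)[OF n _ txy(1)]] order.trans[OF second_moment_strips(2)[OF n _ txy(2)]]) auto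
      finally show ?thesis by simp
    qed
    (* off the good event one of the last two terms is at least K *)
    have point: "\<bar>remainder n (x, y) \<omega>\<bar> \<le> 6 * \<delta> + (remainder n (x, y) \<omega>)\<^sup>2 / K + K * S n \<omega> / \<delta>\<^sup>2 + K * T n \<omega> / b\<^sup>2" for \<omega>
    proof -
      have nn: "0 \<le> (remainder n (x, y) \<omega>)\<^sup>2 / K" "0 \<le> K * S n \<omega> / \<delta>\<^sup>2" "0 \<le> K * T n \<omega> / b\<^sup>2"
        using K S0 by auto
      show ?thesis
      proof (cases "S n \<omega> \<le> \<delta>\<^sup>2 \<and> T n \<omega> \<le> b\<^sup>2")
        case True
        have sq: "\<bar>c\<bar> \<le> d" if "c\<^sup>2 \<le> d\<^sup>2" "0 < d" for c d :: real
          using that abs_le_square_iff[of c d] by simp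
        have "(h1 n \<omega>)\<^sup>2 \<le> b\<^sup>2" "(h2 n \<omega>)\<^sup>2 \<le> b\<^sup>2"
          using True zero_le_power2[of "h1 n \<omega>"] zero_le_power2[of "h2 n \<omega>"] unfolding T_def by linarith+
        note tight = sq[OF this(1) b] sq[OF this(2) b]
        have "\<bar>remainder n (x, y) \<omega>\<bar> \<le> 6 * \<delta>"
        proof (rule remainder_on_grid[OF n \<delta>, of L])
          fix j :: int assume j: "\<bar>j\<bar> \<le> L"
          then have j': "j \<in> I" by (simp add: jI)
          show "0 \<le> x + \<delta> * of_int j / sqrt (k n) \<and> t n * (x + \<delta> * of_int j / sqrt (k n)) \<le> 1"
            "0 \<le> y + \<delta> * of_int j / sqrt (k n) \<and> t n * (y + \<delta> * of_int j / sqrt (k n)) \<le> 1"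
            using pos[OF j'] by (auto simp: xs_def ys_def)
          show "\<bar>\<nu>S n (H1 (t n * (x + \<delta> * of_int j / sqrt (k n)))) \<omega> - \<nu>S n (H1 (t n * x)) \<omega>\<bar> \<le> \<delta>"
            using sq[OF order.trans[OF g1S[OF j'] conjunct1[OF True]] \<delta>] by (simp add: g1_def h1_def xs_def)
          show "\<bar>\<nu>S n (H2 (t n * (y + \<delta> * of_int j / sqrt (k n)))) \<omega> - \<nu>S n (H2 (t n * y)) \<omega>\<bar> \<le> \<delta>"
            using sq[OF order.trans[OF g2S[OF j'] conjunct1[OF True]] \<delta>] by (simp add: g2_def h2_def ys_def)
          fix l :: int assume l: "\<bar>l\<bar> \<le> L"
          then have l': "l \<in> I" by (simp add: jI)
          show "\<bar>\<nu>S n (HU (t n * (x + \<delta> * of_int j / sqrt (k n))) (t n * (y + \<delta> * of_int l / sqrt (k n)))) \<omega> - \<nu>S n (HU (t n * x) (t n * y)) \<omega>\<bar> \<le> \<delta>"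
            using sq[OF order.trans[OF gUS[OF j' l'] conjunct1[OF True]] \<delta>] by (simp add: gU_def o0_def xs_def ys_def)
          show "\<bar>sqrt (k n) * (x + \<delta> * of_int j / sqrt (k n) + (y + \<delta> * of_int l / sqrt (k n))
              - tail.cop (t n * (x + \<delta> * of_int j / sqrt (k n))) (t n * (y + \<delta> * of_int l / sqrt (k n))) / t n - (x + y - R x y))
            - ((1 - tail.D1 (x, y)) * (\<delta> * of_int j) + (1 - tail.D2 (x, y)) * (\<delta> * of_int l))\<bar> \<le> \<delta>"
            using elim(2) j' l' unfolding I_def by blast
        qed (use tight in \<open>auto simp: h1_def h2_def b_def\<close>)
        then show ?thesis using nn by linarith
      next
        case False
        have "\<bar>r\<bar> \<le> K + r\<^sup>2 / K" for r
        proof (cases "\<bar>r\<bar> \<le> K")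
          case True then show ?thesis using K by (simp add: add_increasing2)
        next
          case False
          then have "\<bar>r\<bar> * K \<le> \<bar>r\<bar> * \<bar>r\<bar>" by (intro mult_left_mono) auto
          then have "\<bar>r\<bar> \<le> r\<^sup>2 / K" using K by (simp add: pos_le_divide_eq power2_eq_square)
          then show ?thesis using K by linarith
        qed
        moreover have "K \<le> K * S n \<omega> / \<delta>\<^sup>2 + K * T n \<omega> / b\<^sup>2"
        proof -
          have "K * 1 \<le> K * (S n \<omega> / \<delta>\<^sup>2) \<or> K * 1 \<le> K * (T n \<omega> / b\<^sup>2)"
            using False \<delta> b K by (auto simp: not_le pos_le_divide_eq less_imp_le simp del: mult_1_right)
          then show ?thesis using nn by auto
        qed
        ultimately show ?thesis using \<delta> by (smt (verit))
      qed
    qed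
    have "expectation (\<lambda>\<omega>. \<bar>remainder n (x, y) \<omega>\<bar>)
        \<le> expectation (\<lambda>\<omega>. 6 * \<delta> + (remainder n (x, y) \<omega>)\<^sup>2 / K + K * S n \<omega> / \<delta>\<^sup>2 + K * T n \<omega> / b\<^sup>2)"
      using point r1 r2(1) iS iT by (intro integral_mono) auto
    also have "\<dots> = 6 * \<delta> + expectation (\<lambda>\<omega>. (remainder n (x, y) \<omega>)\<^sup>2) / K + K * expectation (S n) / \<delta>\<^sup>2 + K * expectation (T n) / b\<^sup>2"
      using r2(1) iS iT by (simp add: prob_space)
    also have "\<dots> \<le> 6 * \<delta> + 80 / K + K * (C / sqrt (k n)) / \<delta>\<^sup>2 + K * 2 / b\<^sup>2"
      using r2(2) ES ET K by (intro add_mono divide_right_mono mult_left_mono) auto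
    also have "\<dots> < \<epsilon>"
    proof -
      have "6 * \<delta> = \<epsilon> / 5" "80 / K = \<epsilon> / 5" using \<epsilon> by (auto simp: \<delta>_def K_def)
      moreover have "K * 2 / b\<^sup>2 \<le> \<epsilon> / 5" using \<open>2 * K / b\<^sup>2 \<le> \<epsilon> / 5\<close> by (simp only: mult.commute)
      ultimately show ?thesis using elim(1) \<epsilon> by linarith
    qed
    finally show ?case by (simp add: integral_nonneg_AE)
  qed
qed

end

section \<open>Integrals of the tail Wiener process\<close>

text \<open>The limit process combines the values of \<open>W\<close> at \<open>(x, y)\<close>, \<open>(x, \<infinity>)\<close> and \<open>(\<infinity>, y)\<close>.  Indexing these three fields
by one measure space turns the whole combination into a single integral of \<open>W\<close>.\<close>

datatype margin = Corner | First | Second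

lemma UNIV_margin: "UNIV = {Corner, First, Second}"
  using margin.exhaust by auto

lemma finite_margin: "finite (UNIV :: margin set)"
  by (simp add: UNIV_margin)

definition index_measure :: "(margin \<times> (real \<times> real)) measure" where
  "index_measure = count_space UNIV \<Otimes>\<^sub>M lborel"

lemma pair_sigma_finite_index: "pair_sigma_finite (count_space (UNIV :: margin set)) (lborel :: (real \<times> real) measure)"
  by (intro pair_sigma_finite.intro sigma_finite_measure_count_space_finite finite_margin sigma_finite_lborel)

lemma sigma_finite_index_measure: "sigma_finite_measure index_measure"
proof -
  interpret pair_sigma_finite "count_space (UNIV :: margin set)" "lborel :: (real \<times> real) measure"
    by (rule pair_sigma_finite_index)
  show ?thesis unfolding index_measure_def by (rule P.sigma_finite_measure_axioms)
qed

lemma space_index_measure: "space index_measure = UNIV"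
  by (simp add: index_measure_def space_pair_measure)

lemma index_measure_integral:
  fixes f :: "margin \<times> (real \<times> real) \<Rightarrow> real"
  assumes f: "\<And>\<kappa>. integrable lborel (\<lambda>z. f (\<kappa>, z))"
  shows "integrable index_measure f"
    and "(LINT s|index_measure. f s) =
      (LINT z|lborel. f (Corner, z)) + (LINT z|lborel. f (First, z)) + (LINT z|lborel. f (Second, z))"
proof -
  interpret pair_sigma_finite "count_space (UNIV :: margin set)" "lborel :: (real \<times> real) measure"
    by (rule pair_sigma_finite_index)
  have m: "f \<in> borel_measurable (count_space UNIV \<Otimes>\<^sub>M lborel)"
    by (rule measurable_pair_measure_countable1) (use f finite_margin in \<open>auto intro: countable_finite\<close>)
  show i: "integrable index_measure f"
    unfolding index_measure_def
    by (rule Fubini_integrable[OF m]) (use f finite_margin in \<open>auto intro: integrable_count_space\<close>)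
  show "(LINT s|index_measure. f s) =
      (LINT z|lborel. f (Corner, z)) + (LINT z|lborel. f (First, z)) + (LINT z|lborel. f (Second, z))"
    using integral_fst'[of f] i finite_margin
    by (simp add: index_measure_def lebesgue_integral_count_space_finite) (simp add: UNIV_margin)
qed

definition margin_index :: "margin \<Rightarrow> real \<Rightarrow> real \<Rightarrow> ennreal \<times> ennreal" where
  "margin_index \<kappa> x y = (if \<kappa> = Second then \<infinity> else ennreal x, if \<kappa> = First then \<infinity> else ennreal y)"

text \<open>The weights vanish off the unit square; clipping keeps the indices of the process in a compact set.\<close>

definition unit_clip :: "real \<Rightarrow> real" where "unit_clip u = max 0 (min 1 u)"

lemma unit_clip_bounds [simp]: "0 \<le> unit_clip u" "unit_clip u \<le> 1"
  by (auto simp: unit_clip_def)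

lemma unit_clip_id [simp]: "0 \<le> u \<Longrightarrow> u \<le> 1 \<Longrightarrow> unit_clip u = u"
  by (simp add: unit_clip_def)

lemma unit_clip_measurable [measurable]: "unit_clip \<in> borel_measurable borel"
  unfolding unit_clip_def[abs_def] by measurable

definition tail_index :: "margin \<times> (real \<times> real) \<Rightarrow> ennreal \<times> ennreal" where
  "tail_index s = margin_index (fst s) (unit_clip (fst (snd s))) (unit_clip (snd (snd s)))"

text \<open>The event whose indicator corresponds to the value of \<open>W\<close> at \<open>tail_index s\<close>.\<close>

definition tail_region :: "real \<Rightarrow> margin \<times> (real \<times> real) \<Rightarrow> (real \<times> real) set" where
  "tail_region t s = {w. (fst s \<noteq> Second \<longrightarrow> fst w \<le> t * unit_clip (fst (snd s))) \<and>
    (fst s \<noteq> First \<longrightarrow> snd w \<le> t * unit_clip (snd (snd s)))}"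

definition tail_kernel :: "(real \<Rightarrow> real \<Rightarrow> real) \<Rightarrow> ennreal \<times> ennreal \<Rightarrow> ennreal \<times> ennreal \<Rightarrow> real" where
  "tail_kernel l = (\<lambda>(x1, y1) (x2, y2). tail_R_ext l (min x1 x2, min y1 y2))"

lemma tail_kernel_margin_index:
  assumes "0 \<le> x" "0 \<le> y" "0 \<le> x'" "0 \<le> y'"
  shows "tail_kernel l (margin_index \<kappa> x y) (margin_index \<kappa>' x' y') =
    (if \<kappa> = First \<and> \<kappa>' = First then min x x' else if \<kappa> = Second \<and> \<kappa>' = Second then min y y'
     else tail_R l (if \<kappa> = Second then x' else if \<kappa>' = Second then x else min x x')
       (if \<kappa> = First then y' else if \<kappa>' = First then y else min y y'))"
proof -
  have m: "min (ennreal a) (ennreal b) = ennreal (min a b)" if "0 \<le> a" "0 \<le> b" for a b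
    using that by (simp add: min_def ennreal_le_iff)
  have top: "min top (a :: ennreal) = a" "min a top = a" for a by (auto simp: min_def top_unique)
  show ?thesis
    using assms by (cases \<kappa>; cases \<kappa>') (auto simp: tail_kernel_def margin_index_def tail_R_ext_def m top)
qed

lemma tail_region_measurable:
  "(\<lambda>p. indicator (tail_region t (fst p)) (snd p) :: real) \<in> borel_measurable (index_measure \<Otimes>\<^sub>M borel)"
proof -
  have 1: "(\<lambda>p. fst (fst p)) \<in> measurable ((count_space (UNIV :: margin set) \<Otimes>\<^sub>M (lborel \<Otimes>\<^sub>M lborel)) \<Otimes>\<^sub>M (borel \<Otimes>\<^sub>M borel)) (count_space UNIV)"
    by measurable
  have "(\<lambda>p. of_bool ((fst (fst p) \<noteq> Second \<longrightarrow> fst (snd p) \<le> t * unit_clip (fst (snd (fst p)))) \<and>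
    (fst (fst p) \<noteq> First \<longrightarrow> snd (snd p) \<le> t * unit_clip (snd (snd (fst p))))) :: real)
    \<in> borel_measurable ((count_space (UNIV :: margin set) \<Otimes>\<^sub>M (lborel \<Otimes>\<^sub>M lborel)) \<Otimes>\<^sub>M (borel \<Otimes>\<^sub>M borel))"
    by measurable
  then show ?thesis
    by (simp add: index_measure_def indicator_def tail_region_def lborel_prod borel_prod)
qed

context tail_copula
begin

lemma measure_tail_region:
  assumes "0 \<le> t" "t \<le> 1"
  shows "measure Q (tail_region t s) \<le> t"
proof (cases "fst s = Second")
  case True
  have "measure Q (tail_region t s) \<le> measure Q {w. snd w \<le> t}"
    using assms True mult_left_mono[OF unit_clip_bounds(2)[of "snd (snd s)"], of t]
    by (intro finite_measure_mono) (auto simp: tail_region_def)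
  then show ?thesis using uniform2 assms by simp
next
  case False
  have "measure Q (tail_region t s) \<le> measure Q {w. fst w \<le> t}"
    using assms False mult_left_mono[OF unit_clip_bounds(2)[of "fst (snd s)"], of t]
    by (intro finite_measure_mono) (auto simp: tail_region_def)
  then show ?thesis using uniform1 assms by simp
qed

text \<open>The covariance of \<open>W\<close> is the limit of the rescaled mass of intersections of tail regions; this is what
matches the limit of the estimator with the integral of \<open>W\<close>.\<close>

lemma tail_kernel_limit:
  assumes R: "R = tail_R l"
  shows "((\<lambda>t. measure Q (tail_region t s \<inter> tail_region t s') / t) \<longlongrightarrow> tail_kernel l (tail_index s) (tail_index s')) (at_right 0)"
proof -
  obtain \<kappa> u v where s: "s = (\<kappa>, u, v)" by (metis prod.exhaust)
  obtain \<kappa>' u' v' where s': "s' = (\<kappa>', u', v')" by (metis prod.exhaust)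
  define x y x' y' where "x = unit_clip u" and "y = unit_clip v" and "x' = unit_clip u'" and "y' = unit_clip v'"
  have nn: "0 \<le> x" "0 \<le> y" "0 \<le> x'" "0 \<le> y'" "x \<le> 1" "y \<le> 1" "x' \<le> 1" "y' \<le> 1"
    by (auto simp: x_def y_def x'_def y'_def)
  define a b where "a = (if \<kappa> = Second then x' else if \<kappa>' = Second then x else min x x')"
    and "b = (if \<kappa> = First then y' else if \<kappa>' = First then y else min y y')"
  have ab: "0 \<le> a" "0 \<le> b" "a \<le> 1" "b \<le> 1" using nn by (auto simp: a_def b_def)
  have tmin: "c \<le> t * min p q \<longleftrightarrow> c \<le> t * p \<and> c \<le> t * q" if "0 < t" for c t p q :: real
    using that by (auto simp: min_def mult_le_cancel_left intro: order.trans mult_left_mono)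
  have K: "tail_kernel l (tail_index s) (tail_index s') =
      (if \<kappa> = First \<and> \<kappa>' = First then a else if \<kappa> = Second \<and> \<kappa>' = Second then b else R a b)"
    using nn by (simp add: tail_index_def s s' tail_kernel_margin_index R a_def b_def flip: x_def y_def x'_def y'_def)
  have ev: "\<forall>\<^sub>F t::real in at_right 0. 0 < t \<and> t < 1" by (rule eventually_at_rightI[of 0 1]) auto
  consider "\<kappa> = First \<and> \<kappa>' = First" | "\<kappa> = Second \<and> \<kappa>' = Second" |
    "\<not> (\<kappa> = First \<and> \<kappa>' = First)" "\<not> (\<kappa> = Second \<and> \<kappa>' = Second)" by blast
  then show ?thesis
  proof cases
    case 1
    have "\<forall>\<^sub>F t in at_right 0. measure Q (tail_region t s \<inter> tail_region t s') / t = a"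
      using ev
    proof eventually_elim
      case (elim t)
      have "tail_region t s \<inter> tail_region t s' = {w. fst w \<le> t * a}"
        using 1 elim by (auto simp: tail_region_def s s' a_def tmin simp flip: x_def x'_def)
      then show ?case using elim ab uniform1[of "t * a"] by (simp add: mult_le_one)
    qed
    then show ?thesis unfolding K using 1 by (simp add: tendsto_eventually)
  next
    case 2
    have "\<forall>\<^sub>F t in at_right 0. measure Q (tail_region t s \<inter> tail_region t s') / t = b"
      using ev
    proof eventually_elim
      case (elim t)
      have "tail_region t s \<inter> tail_region t s' = {w. snd w \<le> t * b}"
        using 2 elim by (auto simp: tail_region_def s s' b_def tmin simp flip: y_def y'_def)
      then show ?case using elim ab uniform2[of "t * b"] by (simp add: mult_le_one)
    qed
    then show ?thesis unfolding K using 2 by (simp add: tendsto_eventually)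
  next
    case 3
    have "\<forall>\<^sub>F t in at_right 0. cop (t * a) (t * b) / t = measure Q (tail_region t s \<inter> tail_region t s') / t"
      using ev
    proof eventually_elim
      case (elim t)
      have "tail_region t s \<inter> tail_region t s' = {w. fst w \<le> t * a \<and> snd w \<le> t * b}"
        using 3 elim by (cases \<kappa>; cases \<kappa>')
          (auto simp: tail_region_def s s' a_def b_def tmin simp flip: x_def x'_def y_def y'_def)
      then show ?case by (simp add: cop_def)
    qed
    with cop_limit[OF ab(1,2)] have "((\<lambda>t. measure Q (tail_region t s \<inter> tail_region t s') / t) \<longlongrightarrow> R a b) (at_right 0)"
      by (rule Lim_transform_eventually)
    then show ?thesis unfolding K using 3 by auto
  qed
qed

end

lemma measurable_finite_range:
  fixes f :: "'s \<Rightarrow> 'i::t1_space"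
  assumes f: "f \<in> borel_measurable A" and fin: "finite (range f)"
  shows "f \<in> measurable A (count_space UNIV)"
proof (rule measurableI)
  fix B :: "'i set"
  have "f -` B \<inter> space A = (\<Union>b\<in>B \<inter> range f. f -` {b} \<inter> space A)" by auto
  also have "\<dots> \<in> sets A"
    using fin f by (intro sets.finite_UN finite_Int) (auto intro!: measurable_sets[OF f])
  finally show "f -` B \<inter> space A \<in> sets A" .
qed simp

lemma (in tail_copula) tail_kernel_bound:
  assumes R: "R = tail_R l" and "x \<in> {0..1}" "y \<in> {0..1}" "x' \<in> {0..1}" "y' \<in> {0..1}"
  shows "\<bar>tail_kernel l (margin_index \<kappa> x y) (margin_index \<kappa>' x' y')\<bar> \<le> 1"
proof -
  have "\<bar>tail_R l a b\<bar> \<le> 1" if "0 \<le> a" "a \<le> 1" "0 \<le> b" for a b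
    using R_bounds[of a b] that by (auto simp: R)
  then show ?thesis using assms by (auto simp: tail_kernel_margin_index)
qed

lemma (in tail_copula) tail_kernel_continuous:
  assumes R: "R = tail_R l" and nn: "\<And>m. 0 \<le> a m" "\<And>m. 0 \<le> b m" "\<And>m. 0 \<le> a' m" "\<And>m. 0 \<le> b' m"
    and lim: "a \<longlonglongrightarrow> x" "b \<longlonglongrightarrow> y" "a' \<longlonglongrightarrow> x'" "b' \<longlonglongrightarrow> y'"
  shows "(\<lambda>m. tail_kernel l (margin_index \<kappa> (a m) (b m)) (margin_index \<kappa>' (a' m) (b' m)))
    \<longlonglongrightarrow> tail_kernel l (margin_index \<kappa> x y) (margin_index \<kappa>' x' y')"
proof -
  have nn': "0 \<le> x" "0 \<le> y" "0 \<le> x'" "0 \<le> y'"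
    using lim nn by (auto intro: LIMSEQ_le_const)
  note lims = lim tendsto_min[OF lim(1,3)] tendsto_min[OF lim(2,4)]
  have "(\<lambda>m. tail_R l (c m) (d m)) \<longlonglongrightarrow> tail_R l p q"
    if "c \<longlonglongrightarrow> p" "d \<longlonglongrightarrow> q" "\<And>m. 0 \<le> c m" "\<And>m. 0 \<le> d m" "0 \<le> p" "0 \<le> q" for c d p q
    using R_continuous[of c p sequentially d q] that by (simp add: R)
  then show ?thesis
    using lims nn nn' by (cases \<kappa>; cases \<kappa>') (simp_all add: tail_kernel_margin_index)
qed

text \<open>An instance of \<open>gaussian_process_integral\<close>, where both coordinates of the index are rounded down to multiples of \<open>1 / m\<close>.
Paths are continuous on \<open>[0, 1]\<^sup>2\<close> and along the two edges at infinity, hence bounded there.\<close>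

theorem tail_wiener_integral:
  assumes W: "tail_wiener_process N l W" and Q: "tail_copula Q (tail_R l)" and w: "integrable index_measure w"
  shows "(\<lambda>\<omega>. LINT s|index_measure. w s * W (tail_index s) \<omega>) \<in> borel_measurable N"
    and "\<And>\<omega>. \<omega> \<in> space N \<Longrightarrow> integrable index_measure (\<lambda>s. w s * W (tail_index s) \<omega>)"
    and "(CLINT \<omega>|N. iexp (LINT s|index_measure. w s * W (tail_index s) \<omega>)) = complex_of_real
      (exp (- (LINT s|index_measure. w s * (LINT s'|index_measure. w s' * tail_kernel l (tail_index s) (tail_index s'))) / 2))"
proof -
  interpret Q: tail_copula Q "tail_R l" by fact
  define dz where "dz m u = real_of_int \<lfloor>real m * unit_clip u\<rfloor> / real m" for m u
  define em where "em m s = margin_index (fst s) (dz m (fst (snd s))) (dz m (snd (snd s)))" for m and s :: "margin \<times> real \<times> real"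
  have dz01: "0 \<le> dz m u" "dz m u \<le> 1" for m u
  proof -
    show "0 \<le> dz m u" by (simp add: dz_def)
    have "real_of_int \<lfloor>real m * unit_clip u\<rfloor> \<le> real m * unit_clip u" by linarith
    also have "\<dots> \<le> real m * 1" by (intro mult_left_mono) auto
    finally show "dz m u \<le> 1" by (simp add: dz_def divide_le_eq)
  qed
  have dzlim: "(\<lambda>m. dz m u) \<longlonglongrightarrow> unit_clip u" for u
  proof (rule LIM_zero_cancel, rule Lim_null_comparison)
    show "\<forall>\<^sub>F m in sequentially. norm (dz m u - unit_clip u) \<le> 1 / real m"
      using eventually_gt_at_top[of 0]
    proof eventually_elim
      case (elim m)
      have "dz m u - unit_clip u = (real_of_int \<lfloor>real m * unit_clip u\<rfloor> - real m * unit_clip u) / real m"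
        using elim by (simp add: dz_def diff_divide_distrib)
      moreover have "\<bar>real_of_int \<lfloor>real m * unit_clip u\<rfloor> - real m * unit_clip u\<bar> \<le> 1" by linarith
      ultimately show ?case using elim by (simp add: abs_divide divide_right_mono)
    qed
  qed (rule lim_1_over_n)
  have dzfin: "finite (range (dz m))" for m
  proof (rule finite_subset)
    show "range (dz m) \<subseteq> (\<lambda>i. real_of_int i / real m) ` {0..int m}"
    proof
      fix r assume "r \<in> range (dz m)"
      then obtain u where r: "r = dz m u" by auto
      have "real m * unit_clip u \<le> real m * 1" by (intro mult_left_mono) auto
      then have "\<lfloor>real m * unit_clip u\<rfloor> \<in> {0..int m}" by (auto simp: floor_le_iff)
      then show "r \<in> (\<lambda>i. real_of_int i / real m) ` {0..int m}" by (auto simp: r dz_def)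
    qed
  qed simp
  have gp: "centered_gaussian_process N (UNIV - {(\<infinity>, \<infinity>)}) (tail_kernel l) W"
    using W by (simp add: tail_wiener_process_def tail_kernel_def)
  have dzm[measurable]: "dz m \<in> borel_measurable borel" for m unfolding dz_def[abs_def] by measurable
  have emm: "em m \<in> measurable index_measure (count_space UNIV)" and emf: "finite (range (em m))" for m
  proof -
    show f: "finite (range (em m))"
    proof (rule finite_subset)
      show "range (em m) \<subseteq> (\<lambda>(\<kappa>, a, b). margin_index \<kappa> a b) ` (UNIV \<times> range (dz m) \<times> range (dz m))"
        by (auto simp: em_def intro!: image_eqI[of _ _ "(\<kappa>, dz m u, dz m v)" for \<kappa> u v])
      show "finite ((\<lambda>(\<kappa>, a, b). margin_index \<kappa> a b) ` (UNIV \<times> range (dz m) \<times> range (dz m)))"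
        by (rule finite_imageI) (intro finite_cartesian_product finite_margin dzfin)
    qed
    have "(\<lambda>z. em m (\<kappa>, z)) \<in> borel_measurable lborel" for \<kappa>
    proof -
      have "(\<lambda>z. (if \<kappa> = Second then \<infinity> else ennreal (dz m (fst z)), if \<kappa> = First then \<infinity> else ennreal (dz m (snd z))))
          \<in> measurable (borel \<Otimes>\<^sub>M borel) (borel \<Otimes>\<^sub>M borel)" by measurable
      then show ?thesis by (simp add: em_def margin_index_def[abs_def] borel_prod)
    qed
    then have "em m \<in> borel_measurable index_measure"
      unfolding index_measure_def by (intro measurable_pair_measure_countable1) (auto intro: countable_finite finite_margin)
    then show "em m \<in> measurable index_measure (count_space UNIV)"
      using f by (rule measurable_finite_range)
  qed
  have sub: "range (em m) \<subseteq> UNIV - {(\<infinity>, \<infinity>)}" for m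
  proof -
    have "em m s \<noteq> (\<infinity>, \<infinity>)" for s by (cases "fst s") (auto simp: em_def margin_index_def)
    then show ?thesis by (intro image_subsetI) blast
  qed
  have cont: "continuous_on ({..<\<infinity>} \<times> {..<\<infinity>}) (\<lambda>z. W z \<omega>)" "continuous_on {..<\<infinity>} (\<lambda>x. W (x, \<infinity>) \<omega>)"
    "continuous_on {..<\<infinity>} (\<lambda>y. W (\<infinity>, y) \<omega>)" if "\<omega> \<in> space N" for \<omega>
    using W that by (auto simp: tail_wiener_process_def)
  have conv: "(\<lambda>m. W (em m s) \<omega>) \<longlonglongrightarrow> W (tail_index s) \<omega>" if \<omega>: "\<omega> \<in> space N" for \<omega> s
  proof -
    have l: "(\<lambda>m. ennreal (dz m u)) \<longlonglongrightarrow> ennreal (unit_clip u)" for u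
      by (intro tendsto_ennrealI dzlim)
    show ?thesis
    proof (cases "fst s")
      case Corner
      then show ?thesis
        unfolding em_def tail_index_def margin_index_def
        using continuous_on_tendsto_compose[OF cont(1)[OF \<omega>] tendsto_Pair[OF l l]] by (simp add: less_top[symmetric])
    next
      case First
      then show ?thesis
        unfolding em_def tail_index_def margin_index_def
        using continuous_on_tendsto_compose[OF cont(2)[OF \<omega>] l] by (simp add: less_top[symmetric])
    next
      case Second
      then show ?thesis
        unfolding em_def tail_index_def margin_index_def
        using continuous_on_tendsto_compose[OF cont(3)[OF \<omega>] l] by (simp add: less_top[symmetric])
    qed
  qed
  have bd: "\<exists>B. \<forall>m s. \<bar>W (em m s) \<omega>\<bar> \<le> B" if \<omega>: "\<omega> \<in> space N" for \<omega>
  proof -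
    have "continuous_on ({0..1} \<times> {0..1}) (\<lambda>z :: real \<times> real. W (ennreal (fst z), ennreal (snd z)) \<omega>)"
      by (rule continuous_on_compose2[OF cont(1)[OF \<omega>]]) (auto intro!: continuous_intros continuous_on_ennreal simp: less_top[symmetric])
    then have "bounded ((\<lambda>z :: real \<times> real. W (ennreal (fst z), ennreal (snd z)) \<omega>) ` ({0..1} \<times> {0..1}))"
      by (intro compact_imp_bounded compact_continuous_image compact_Times) auto
    then obtain B1 where B1: "\<And>u v. u \<in> {0..1} \<Longrightarrow> v \<in> {0..1} \<Longrightarrow> \<bar>W (ennreal u, ennreal v) \<omega>\<bar> \<le> B1"
      by (force simp: bounded_iff)
    have "continuous_on {0..1} (\<lambda>u. W (ennreal u, \<infinity>) \<omega>)"
      by (rule continuous_on_compose2[OF cont(2)[OF \<omega>]]) (auto intro!: continuous_intros continuous_on_ennreal simp: less_top[symmetric])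
    then have "bounded ((\<lambda>u. W (ennreal u, \<infinity>) \<omega>) ` {0..1})"
      by (intro compact_imp_bounded compact_continuous_image) auto
    then obtain B2 where B2: "\<And>u. u \<in> {0..1} \<Longrightarrow> \<bar>W (ennreal u, \<infinity>) \<omega>\<bar> \<le> B2"
      by (force simp: bounded_iff)
    have "continuous_on {0..1} (\<lambda>u. W (\<infinity>, ennreal u) \<omega>)"
      by (rule continuous_on_compose2[OF cont(3)[OF \<omega>]]) (auto intro!: continuous_intros continuous_on_ennreal simp: less_top[symmetric])
    then have "bounded ((\<lambda>u. W (\<infinity>, ennreal u) \<omega>) ` {0..1})"
      by (intro compact_imp_bounded compact_continuous_image) auto
    then obtain B3 where B3: "\<And>u. u \<in> {0..1} \<Longrightarrow> \<bar>W (\<infinity>, ennreal u) \<omega>\<bar> \<le> B3"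
      by (force simp: bounded_iff)
    have "\<bar>W (em m s) \<omega>\<bar> \<le> max B1 (max B2 B3)" for m s
      using B1[of "dz m (fst (snd s))" "dz m (snd (snd s))"] B2[of "dz m (fst (snd s))"] B3[of "dz m (snd (snd s))"] dz01
      by (cases "fst s") (auto simp: em_def margin_index_def)
    then show ?thesis by blast
  qed
  have Kconv: "(\<lambda>m. tail_kernel l (em m s) (em m s')) \<longlonglongrightarrow> tail_kernel l (tail_index s) (tail_index s')" for s s'
    unfolding em_def tail_index_def by (intro Q.tail_kernel_continuous dzlim dz01 refl)
  have Kbd: "\<bar>tail_kernel l (em m s) (em m s')\<bar> \<le> 1" for m s s'
    unfolding em_def using dz01 by (intro Q.tail_kernel_bound) auto
  note * = gp w emm emf sub conv bd Kconv Kbd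
  show "(\<lambda>\<omega>. LINT s|index_measure. w s * W (tail_index s) \<omega>) \<in> borel_measurable N"
    by (rule gaussian_process_integral_measurable[OF *])
  show "integrable index_measure (\<lambda>s. w s * W (tail_index s) \<omega>)" if "\<omega> \<in> space N" for \<omega>
    by (rule gaussian_process_integral_integrable[OF * that])
  show "(CLINT \<omega>|N. iexp (LINT s|index_measure. w s * W (tail_index s) \<omega>)) = complex_of_real
      (exp (- (LINT s|index_measure. w s * (LINT s'|index_measure. w s' * tail_kernel l (tail_index s) (tail_index s'))) / 2))"
    by (rule gaussian_process_integral_char[OF *])
qed

section \<open>Integrating the linear expansion against a weight\<close>

lemma norm_iexp_diff: "cmod (iexp a - iexp b) \<le> \<bar>a - b\<bar>"
proof -
  have "iexp a - iexp b = iexp b * (iexp (a - b) - 1)"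
    by (simp add: right_diff_distrib exp_add[symmetric] flip: distrib_left of_real_add)
  then have "cmod (iexp a - iexp b) = cmod (iexp (a - b) - 1)"
    by (simp add: norm_mult)
  also have "\<dots> \<le> \<bar>a - b\<bar>" using iexp_approx1[of "a - b" 0] by simp
  finally show ?thesis .
qed

lemma iexp_expectation_diff:
  assumes "prob_space M" and [measurable]: "A \<in> borel_measurable M" "B \<in> borel_measurable M"
    and i: "integrable M (\<lambda>\<omega>. A \<omega> - B \<omega>)"
  shows "cmod ((CLINT \<omega>|M. iexp (A \<omega>)) - (CLINT \<omega>|M. iexp (B \<omega>))) \<le> (LINT \<omega>|M. \<bar>A \<omega> - B \<omega>\<bar>)"
proof -
  interpret prob_space M by fact
  have ie: "integrable M (\<lambda>\<omega>. iexp (A \<omega>))" "integrable M (\<lambda>\<omega>. iexp (B \<omega>))"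
    by (auto intro!: integrable_const_bound[of _ 1])
  have "cmod ((CLINT \<omega>|M. iexp (A \<omega>)) - (CLINT \<omega>|M. iexp (B \<omega>))) = cmod (CLINT \<omega>|M. iexp (A \<omega>) - iexp (B \<omega>))"
    using ie by simp
  also have "\<dots> \<le> (LINT \<omega>|M. cmod (iexp (A \<omega>) - iexp (B \<omega>)))" by (rule integral_norm_bound)
  also have "\<dots> \<le> (LINT \<omega>|M. \<bar>A \<omega> - B \<omega>\<bar>)"
    using i ie by (intro integral_mono norm_iexp_diff) auto
  finally show ?thesis .
qed

context tail_sample
begin

definition unit_weight :: "(real \<times> real \<Rightarrow> real) \<Rightarrow> bool" where
  "unit_weight \<gamma> \<longleftrightarrow> \<gamma> \<in> borel_measurable borel \<and> integrable lborel \<gamma> \<and> (\<forall>z. z \<notin> {0..1} \<times> {0..1} \<longrightarrow> \<gamma> z = 0)"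

lemma unit_weightD:
  assumes "unit_weight \<gamma>"
  shows "\<gamma> \<in> borel_measurable borel" "integrable lborel \<gamma>" "\<And>z. z \<notin> {0..1} \<times> {0..1} \<Longrightarrow> \<gamma> z = 0"
  using assms unfolding unit_weight_def by blast+

text \<open>The weighted integral of the normalized estimation error; \<open>x + y - R(x, y)\<close> is the stable tail dependence function.\<close>

definition deviation :: "(real \<times> real \<Rightarrow> real) \<Rightarrow> nat \<Rightarrow> 'a \<Rightarrow> real" where
  "deviation \<gamma> n \<omega> = sqrt (k n) * (LINT z|lborel. \<gamma> z * (stdf_estimator X Y n (k n) \<omega> (fst z) (snd z)
      - (fst z + snd z - R (fst z) (snd z))))"

lemma D_measurable_pair [measurable]:
  "tail.D1 \<in> borel_measurable (borel \<Otimes>\<^sub>M borel)" "tail.D2 \<in> borel_measurable (borel \<Otimes>\<^sub>M borel)"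
  by (simp_all add: borel_prod)

lemma influence_joint_measurable:
  "(\<lambda>p. influence n (fst p) (snd p)) \<in> borel_measurable (borel \<Otimes>\<^sub>M borel)"
proof -
  have "(\<lambda>p. of_bool (fst (snd p) \<le> t n * fst (fst p) \<and> snd (snd p) \<le> t n * snd (fst p))
    - tail.D1 (fst p) * of_bool (fst (snd p) \<le> t n * fst (fst p)) - tail.D2 (fst p) * of_bool (snd (snd p) \<le> t n * snd (fst p)))
    \<in> borel_measurable ((borel \<Otimes>\<^sub>M borel) \<Otimes>\<^sub>M (borel \<Otimes>\<^sub>M borel))"
    by measurable
  then show ?thesis by (simp add: influence_def indicator_def borel_prod)
qed

lemma influence_integral_measurable: "(\<lambda>z. LINT w|Q. influence n z w) \<in> borel_measurable borel"
proof -
  have "(\<lambda>p. influence n (fst p) (snd p)) \<in> borel_measurable (borel \<Otimes>\<^sub>M Q)"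
    using influence_joint_measurable[of n] by (simp cong: measurable_cong_sets sets_pair_measure_cong)
  then have "(\<lambda>(z, w). influence n z w) \<in> borel_measurable (borel \<Otimes>\<^sub>M Q)" by (simp add: split_beta')
  then show ?thesis by (rule Q.borel_measurable_lebesgue_integral)
qed

lemma \<nu>_influence_joint_measurable:
  "(\<lambda>p. \<nu> n (influence n (fst p)) (snd p)) \<in> borel_measurable (lborel \<Otimes>\<^sub>M M)"
proof -
  have "(\<lambda>p. influence n (fst p) (Z i (snd p))) \<in> borel_measurable (lborel \<Otimes>\<^sub>M M)" for i
  proof -
    have "(\<lambda>p. (fst p, Z i (snd p))) \<in> measurable (lborel \<Otimes>\<^sub>M M) (borel \<Otimes>\<^sub>M borel)"
      by (intro measurable_Pair measurable_compose[OF measurable_snd Z_measurable]) (auto intro: measurable_compose[OF measurable_fst])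
    from measurable_compose[OF this influence_joint_measurable[of n]] show ?thesis by simp
  qed
  moreover have "(\<lambda>p. LINT w|Q. influence n (fst p) w) \<in> borel_measurable (lborel \<Otimes>\<^sub>M M)"
    by (rule measurable_compose[OF measurable_fst]) (simp add: influence_integral_measurable)
  ultimately show ?thesis
    unfolding \<nu>_def by (intro borel_measurable_divide borel_measurable_diff borel_measurable_sum borel_measurable_times) auto
qed

lemma influence_bound_const: "\<bar>influence n z w\<bar> \<le> 2"
  by (rule order.trans[OF influence_bound]) (simp add: indicator_def)

lemma weighted_remainder_measurable:
  assumes "unit_weight \<gamma>"
  shows "(\<lambda>p. \<gamma> (fst p) * remainder n (fst p) (snd p)) \<in> borel_measurable (lborel \<Otimes>\<^sub>M M)"
proof -
  have [measurable]: "\<gamma> \<in> borel_measurable borel" using assms by (simp add: unit_weight_def)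
  have [measurable]: "(\<lambda>z. R (max 0 (fst z)) (max 0 (snd z))) \<in> borel_measurable borel"
    using tail.R_measurable[of 0 0] by simp
  have [measurable]: "(\<lambda>z :: real \<times> real. fst z) \<in> borel_measurable borel" "(\<lambda>z :: real \<times> real. snd z) \<in> borel_measurable borel"
    by (intro borel_measurable_continuous_onI continuous_intros)+
  have *: "(\<lambda>p. f (fst p)) \<in> borel_measurable (lborel \<Otimes>\<^sub>M M)" if "f \<in> borel_measurable borel" for f :: "real \<times> real \<Rightarrow> real"
    by (rule measurable_compose[OF measurable_fst]) (use that in simp)
  have "(\<lambda>p. \<gamma> (fst p) * (sqrt (k n) * (stdf_estimator X Y n (k n) (snd p) (fst (fst p)) (snd (fst p))
      - (fst (fst p) + snd (fst p) - R (max 0 (fst (fst p))) (max 0 (snd (fst p))))) + \<nu> n (influence n (fst p)) (snd p)))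
      \<in> borel_measurable (lborel \<Otimes>\<^sub>M M)"
    by (intro borel_measurable_times borel_measurable_add borel_measurable_diff stdf_estimator_measurable
        \<nu>_influence_joint_measurable borel_measurable_const measurable_snd
        *[of \<gamma>] *[of "\<lambda>z. fst z"] *[of "\<lambda>z. snd z"] *[of "\<lambda>z. R (max 0 (fst z)) (max 0 (snd z))"]) measurable
  moreover have "\<gamma> z * (sqrt (k n) * (stdf_estimator X Y n (k n) \<omega> (fst z) (snd z)
      - (fst z + snd z - R (max 0 (fst z)) (max 0 (snd z)))) + \<nu> n (influence n z) \<omega>) = \<gamma> z * remainder n z \<omega>" for z \<omega>
  proof (cases "z \<in> {0..1} \<times> {0..1}")
    case True
    then have "max 0 (fst z) = fst z" "max 0 (snd z) = snd z" by auto
    then show ?thesis by (simp only: remainder_def)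
  qed (simp add: unit_weightD(3)[OF assms])
  ultimately show ?thesis by simp
qed

text \<open>A crude bound, growing with \<open>n\<close>, that gives integrability for each fixed \<open>n\<close>.\<close>

lemma remainder_bound:
  assumes n: "n \<ge> 1" and z: "z \<in> {0..1} \<times> {0..1}"
  shows "\<bar>remainder n z \<omega>\<bar> \<le> sqrt (k n) * (real n + 2) + 4 * real n / sqrt (k n)"
proof -
  have "card (top_set X n (k n * fst z) \<omega> \<union> top_set Y n (k n * snd z) \<omega>) \<le> card {1..n}"
    by (rule card_mono[OF finite_atLeastAtMost Un_least[OF top_set_subset_range top_set_subset_range]])
  moreover have "1 \<le> k n" using k_range[OF n] by simp
  ultimately have s: "0 \<le> stdf_estimator X Y n (k n) \<omega> (fst z) (snd z)" "stdf_estimator X Y n (k n) \<omega> (fst z) (snd z) \<le> n"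
    unfolding stdf_estimator_card using frac_le[of "real n" "card (top_set X n (k n * fst z) \<omega> \<union> top_set Y n (k n * snd z) \<omega>)" 1 "k n"]
    by auto
  have "0 \<le> fst z + snd z - R (fst z) (snd z)" "fst z + snd z - R (fst z) (snd z) \<le> 2"
    using tail.R_bounds[of "fst z" "snd z"] z by auto
  then have "\<bar>stdf_estimator X Y n (k n) \<omega> (fst z) (snd z) - (fst z + snd z - R (fst z) (snd z))\<bar> \<le> n + 2"
    using s by linarith
  then have "\<bar>sqrt (k n) * (stdf_estimator X Y n (k n) \<omega> (fst z) (snd z) - (fst z + snd z - R (fst z) (snd z)))\<bar> \<le> sqrt (k n) * (n + 2)"
    by (simp add: abs_mult mult_left_mono)
  then have 1: "\<bar>sqrt (real (k n)) * (stdf_estimator X Y n (k n) \<omega> (fst z) (snd z) - (fst z + snd z - R (fst z) (snd z)))\<bar> \<le> sqrt (real (k n)) * (real n + 2)" by (simp add: add.commute)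
  have 2: "\<bar>\<nu> n (influence n z) \<omega>\<bar> \<le> 4 * real n / sqrt (real (k n))" using \<nu>_bounded[of "influence n z" 2 n \<omega>] influence_bound_const by simp
  show ?thesis unfolding remainder_def by (rule order.trans[OF abs_triangle_ineq add_mono[OF 1 2]])
qed

lemma weighted_remainder_integrable:
  assumes \<gamma>: "unit_weight \<gamma>" and n: "n \<ge> 1"
  shows "integrable (lborel \<Otimes>\<^sub>M M) (\<lambda>p. \<gamma> (fst p) * remainder n (fst p) (snd p))"
proof (rule integrable_pair_dominated[OF sigma_finite_lborel prob_space_axioms _ weighted_remainder_measurable[OF \<gamma>]])
  show "integrable lborel \<gamma>" using \<gamma> by (simp add: unit_weight_def)
  show "\<bar>\<gamma> (fst (z, \<omega>)) * remainder n (fst (z, \<omega>)) (snd (z, \<omega>))\<bar> \<le> (sqrt (k n) * (real n + 2) + 4 * real n / sqrt (k n)) * \<bar>\<gamma> z\<bar>" for z \<omega>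
  proof (cases "z \<in> {0..1} \<times> {0..1}")
    case True
    show ?thesis using mult_left_mono[OF remainder_bound[OF n True, of \<omega>] abs_ge_zero[of "\<gamma> z"]]
      by (simp only: fst_conv snd_conv abs_mult mult.commute[of "\<bar>\<gamma> z\<bar>"] abs_ge_zero simp_thms)
  qed (simp add: unit_weightD(3)[OF \<gamma>])
qed

lemma AE_unit_square_regular: "AE z in lborel. z \<in> {0..1} \<times> {0..1} \<longrightarrow> tail.regular z"
proof -
  have "negligible {z :: real \<times> real. (1, 0) \<bullet> z = 0}" "negligible {z :: real \<times> real. (0, 1) \<bullet> z = 0}"
    by (rule negligible_hyperplane; simp add: zero_prod_def)+
  moreover have "closed {z :: real \<times> real. (1, 0) \<bullet> z = 0}" "closed {z :: real \<times> real. (0, 1) \<bullet> z = 0}"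
    by (rule closed_hyperplane)+
  ultimately have "{z :: real \<times> real. (1, 0) \<bullet> z = 0} \<in> null_sets lborel" "{z :: real \<times> real. (0, 1) \<bullet> z = 0} \<in> null_sets lborel"
    by (auto simp: negligible_iff_null_sets null_sets_completion_iff)
  note this[THEN AE_not_in]
  with tail.AE_regular show ?thesis
    by eventually_elim (auto simp: inner_prod_def)
qed

text \<open>Dominated convergence in \<open>z\<close>: the expected remainder tends to \<open>0\<close> at almost every point of the square and is
eventually bounded by \<open>81\<close>, since \<open>|r| \<le> 1 + r\<^sup>2\<close>.\<close>

lemma weighted_remainder_tendsto_0:
  assumes \<gamma>: "unit_weight \<gamma>"
  shows "(\<lambda>n. LINT z|lborel. \<bar>\<gamma> z\<bar> * expectation (\<lambda>\<omega>. \<bar>remainder n z \<omega>\<bar>)) \<longlonglongrightarrow> 0"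
    and "\<forall>\<^sub>F n in sequentially. expectation (\<lambda>\<omega>. \<bar>LINT z|lborel. \<gamma> z * remainder n z \<omega>\<bar>)
      \<le> (LINT z|lborel. \<bar>\<gamma> z\<bar> * expectation (\<lambda>\<omega>. \<bar>remainder n z \<omega>\<bar>))"
    and "\<And>n. n \<ge> 1 \<Longrightarrow> integrable M (\<lambda>\<omega>. LINT z|lborel. \<gamma> z * remainder n z \<omega>)"
proof -
  interpret pair: pair_sigma_finite lborel M ..
  have [measurable]: "\<gamma> \<in> borel_measurable borel" and i\<gamma>: "integrable lborel \<gamma>" and \<gamma>0: "\<And>z. z \<notin> {0..1} \<times> {0..1} \<Longrightarrow> \<gamma> z = 0"
    using unit_weightD[OF \<gamma>] by blast+
  have int: "integrable (lborel \<Otimes>\<^sub>M M) (\<lambda>p. \<gamma> (fst p) * remainder n (fst p) (snd p))" if "n \<ge> 1" for n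
    by (rule weighted_remainder_integrable[OF \<gamma> that])
  have E: "(\<lambda>\<omega>. \<bar>\<gamma> z * remainder n z \<omega>\<bar>) = (\<lambda>\<omega>. \<bar>\<gamma> z\<bar> * \<bar>remainder n z \<omega>\<bar>)" for z n by (simp add: abs_mult)
  have em: "(\<lambda>z. \<bar>\<gamma> z\<bar> * expectation (\<lambda>\<omega>. \<bar>remainder n z \<omega>\<bar>)) \<in> borel_measurable lborel" for n
  proof -
    have "(\<lambda>p. \<bar>\<gamma> (fst p) * remainder n (fst p) (snd p)\<bar>) \<in> borel_measurable (lborel \<Otimes>\<^sub>M M)"
      using weighted_remainder_measurable[OF \<gamma>] by (rule borel_measurable_abs)
    then have "(\<lambda>z. expectation (\<lambda>\<omega>. \<bar>\<gamma> z * remainder n z \<omega>\<bar>)) \<in> borel_measurable lborel"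
      using borel_measurable_lebesgue_integral[of "\<lambda>z \<omega>. \<bar>\<gamma> z * remainder n z \<omega>\<bar>" lborel] by (simp add: split_beta')
    then show ?thesis unfolding E by simp
  qed
  obtain n0 where n0: "\<And>n z. n \<ge> n0 \<Longrightarrow> z \<in> {0..1} \<times> {0..1} \<Longrightarrow> integrable M (\<lambda>\<omega>. (remainder n z \<omega>)\<^sup>2) \<and>
      expectation (\<lambda>\<omega>. (remainder n z \<omega>)\<^sup>2) \<le> 80"
    using second_moment_remainder unfolding eventually_sequentially by blast
  have bound: "expectation (\<lambda>\<omega>. \<bar>remainder n z \<omega>\<bar>) \<le> 81" if "n \<ge> n0" "z \<in> {0..1} \<times> {0..1}" for n z
  proof -
    have i2: "integrable M (\<lambda>\<omega>. (remainder n z \<omega>)\<^sup>2)" using n0[OF that] by simp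
    have i1: "integrable M (\<lambda>\<omega>. remainder n z \<omega>)" by (rule square_integrable_imp_integrable[OF _ i2]) measurable
    have "\<bar>r\<bar> \<le> 1 + r\<^sup>2" for r :: real
      using zero_le_power2[of "\<bar>r\<bar> - 1"] by (simp add: power2_diff)
    then have "expectation (\<lambda>\<omega>. \<bar>remainder n z \<omega>\<bar>) \<le> expectation (\<lambda>\<omega>. 1 + (remainder n z \<omega>)\<^sup>2)"
      using i1 i2 by (intro integral_mono) auto
    also have "\<dots> \<le> 81" using i2 n0[OF that] by (simp add: prob_space)
    finally show ?thesis .
  qed
  have "(\<lambda>n. LINT z|lborel. \<bar>\<gamma> z\<bar> * expectation (\<lambda>\<omega>. \<bar>remainder (n + n0) z \<omega>\<bar>)) \<longlonglongrightarrow> (LINT z|(lborel :: (real \<times> real) measure). (0::real))"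
  proof (rule integral_dominated_convergence[where w="\<lambda>z. 81 * \<bar>\<gamma> z\<bar>"])
    show "integrable lborel (\<lambda>z. 81 * \<bar>\<gamma> z\<bar>)" using i\<gamma> by auto
    show "AE z in lborel. (\<lambda>n. \<bar>\<gamma> z\<bar> * expectation (\<lambda>\<omega>. \<bar>remainder (n + n0) z \<omega>\<bar>)) \<longlonglongrightarrow> 0"
      using AE_unit_square_regular
    proof eventually_elim
      case (elim z)
      show ?case
      proof (cases "z \<in> {0..1} \<times> {0..1}")
        case True
        then have "(\<lambda>n. expectation (\<lambda>\<omega>. \<bar>remainder n z \<omega>\<bar>)) \<longlonglongrightarrow> 0"
          using remainder_tendsto_0[of "fst z" "snd z"] elim by auto
        then have "(\<lambda>n. \<bar>\<gamma> z\<bar> * expectation (\<lambda>\<omega>. \<bar>remainder (n + n0) z \<omega>\<bar>)) \<longlonglongrightarrow> \<bar>\<gamma> z\<bar> * 0"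
          by (intro tendsto_mult_left LIMSEQ_ignore_initial_segment)
        then show ?thesis by simp
      qed (simp add: \<gamma>0)
    qed
    show "AE z in lborel. norm (\<bar>\<gamma> z\<bar> * expectation (\<lambda>\<omega>. \<bar>remainder (n + n0) z \<omega>\<bar>)) \<le> 81 * \<bar>\<gamma> z\<bar>" for n
    proof (rule AE_I2)
      fix z
      show "norm (\<bar>\<gamma> z\<bar> * expectation (\<lambda>\<omega>. \<bar>remainder (n + n0) z \<omega>\<bar>)) \<le> 81 * \<bar>\<gamma> z\<bar>"
      proof (cases "z \<in> {0..1} \<times> {0..1}")
        case True
        then have "\<bar>\<gamma> z\<bar> * expectation (\<lambda>\<omega>. \<bar>remainder (n + n0) z \<omega>\<bar>) \<le> \<bar>\<gamma> z\<bar> * 81"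
          by (intro mult_left_mono bound) auto
        then show ?thesis by (simp add: abs_mult integral_nonneg_AE)
      qed (simp add: \<gamma>0)
    qed
  qed (use em in simp_all)
  then show "(\<lambda>n. LINT z|lborel. \<bar>\<gamma> z\<bar> * expectation (\<lambda>\<omega>. \<bar>remainder n z \<omega>\<bar>)) \<longlonglongrightarrow> 0"
    using LIMSEQ_offset[of "\<lambda>n. LINT z|lborel. \<bar>\<gamma> z\<bar> * expectation (\<lambda>\<omega>. \<bar>remainder n z \<omega>\<bar>)" n0 0] by simp
  have intM: "integrable M (\<lambda>\<omega>. LINT z|lborel. \<gamma> z * remainder n z \<omega>)"
    and le: "expectation (\<lambda>\<omega>. \<bar>LINT z|lborel. \<gamma> z * remainder n z \<omega>\<bar>)
      \<le> (LINT z|lborel. \<bar>\<gamma> z\<bar> * expectation (\<lambda>\<omega>. \<bar>remainder n z \<omega>\<bar>))" if n: "n \<ge> 1" for n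
  proof -
    have i: "integrable (lborel \<Otimes>\<^sub>M M) (\<lambda>(z, \<omega>). \<gamma> z * remainder n z \<omega>)" using int[OF n] by (simp add: split_beta')
    then have ia: "integrable (lborel \<Otimes>\<^sub>M M) (\<lambda>(z, \<omega>). \<bar>\<gamma> z * remainder n z \<omega>\<bar>)"
      using integrable_abs[OF i] by (simp add: split_beta')
    show iM: "integrable M (\<lambda>\<omega>. LINT z|lborel. \<gamma> z * remainder n z \<omega>)" by (rule pair.integrable_snd[OF i])
    have "expectation (\<lambda>\<omega>. \<bar>LINT z|lborel. \<gamma> z * remainder n z \<omega>\<bar>) \<le> expectation (\<lambda>\<omega>. LINT z|lborel. \<bar>\<gamma> z * remainder n z \<omega>\<bar>)"
      using iM pair.integrable_snd[OF ia] by (intro integral_mono integral_abs_bound) auto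
    also have "\<dots> = (LINT z|lborel. expectation (\<lambda>\<omega>. \<bar>\<gamma> z * remainder n z \<omega>\<bar>))"
      by (rule pair.Fubini_integral[OF ia])
    also have "\<dots> = (LINT z|lborel. \<bar>\<gamma> z\<bar> * expectation (\<lambda>\<omega>. \<bar>remainder n z \<omega>\<bar>))" unfolding E by simp
    finally show "expectation (\<lambda>\<omega>. \<bar>LINT z|lborel. \<gamma> z * remainder n z \<omega>\<bar>)
      \<le> (LINT z|lborel. \<bar>\<gamma> z\<bar> * expectation (\<lambda>\<omega>. \<bar>remainder n z \<omega>\<bar>))" .
  qed
  show "\<forall>\<^sub>F n in sequentially. expectation (\<lambda>\<omega>. \<bar>LINT z|lborel. \<gamma> z * remainder n z \<omega>\<bar>)
      \<le> (LINT z|lborel. \<bar>\<gamma> z\<bar> * expectation (\<lambda>\<omega>. \<bar>remainder n z \<omega>\<bar>))"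
    using eventually_ge_at_top[of 1] by eventually_elim (rule le)
  show "\<And>n. n \<ge> 1 \<Longrightarrow> integrable M (\<lambda>\<omega>. LINT z|lborel. \<gamma> z * remainder n z \<omega>)" by (rule intM)
qed

text \<open>The weight on the index space for which the integral of \<open>W\<close> is \<open>- \<integral> \<gamma> B\<close>, and the integral of the indicators of
the tail regions is \<open>- \<integral> \<gamma> (influence n z) dz\<close>.\<close>

definition index_weight :: "(real \<times> real \<Rightarrow> real) \<Rightarrow> margin \<times> (real \<times> real) \<Rightarrow> real" where
  "index_weight \<gamma> s = (case fst s of Corner \<Rightarrow> - \<gamma> (snd s) | First \<Rightarrow> \<gamma> (snd s) * tail.D1 (snd s) | Second \<Rightarrow> \<gamma> (snd s) * tail.D2 (snd s))"

lemma weight_times_bounded_integrable: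
  assumes \<gamma>: "unit_weight \<gamma>" and [measurable]: "f \<in> borel_measurable borel" and f: "\<And>z. z \<in> {0..1} \<times> {0..1} \<Longrightarrow> \<bar>f z\<bar> \<le> C"
  shows "integrable lborel (\<lambda>z. \<gamma> z * f z)"
proof (rule Bochner_Integration.integrable_bound)
  note [measurable] = unit_weightD(1)[OF \<gamma>]
  show "integrable lborel (\<lambda>z. C * \<gamma> z)" using unit_weightD(2)[OF \<gamma>] by simp
  show "(\<lambda>z. \<gamma> z * f z) \<in> borel_measurable lborel" by simp
  have "\<bar>\<gamma> z * f z\<bar> \<le> \<bar>C * \<gamma> z\<bar>" for z
  proof (cases "z \<in> {0..1} \<times> {0..1}")
    case True
    then have "\<bar>f z\<bar> \<le> \<bar>C\<bar>" using f[of z] by linarith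
    then show ?thesis by (simp add: abs_mult mult.commute[of "\<bar>C\<bar>"] mult_left_mono)
  qed (simp add: unit_weightD(3)[OF \<gamma>])
  then show "AE z in lborel. norm (\<gamma> z * f z) \<le> norm (C * \<gamma> z)" by simp
qed

lemma index_weight_integrable:
  assumes \<gamma>: "unit_weight \<gamma>"
  shows "integrable index_measure (index_weight \<gamma>)"
proof (rule index_measure_integral(1))
  fix \<kappa>
  have "integrable lborel (\<lambda>z. \<gamma> z * tail.D1 z)" "integrable lborel (\<lambda>z. \<gamma> z * tail.D2 z)"
    using tail.D_bounds by (auto intro!: weight_times_bounded_integrable[OF \<gamma>, of _ 1])
  then show "integrable lborel (\<lambda>z. index_weight \<gamma> (\<kappa>, z))"
    using unit_weightD(2)[OF \<gamma>] by (cases \<kappa>) (simp_all add: index_weight_def)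
qed

lemma influence_section_measurable: "(\<lambda>z. influence n z w) \<in> borel_measurable borel"
  using measurable_compose[OF measurable_Pair2'[of w borel borel] influence_joint_measurable[of n]] by simp

lemma weight_influence_integrable:
  assumes \<gamma>: "unit_weight \<gamma>"
  shows "integrable lborel (\<lambda>z. \<gamma> z * influence n z w)"
  by (rule weight_times_bounded_integrable[OF \<gamma> influence_section_measurable]) (rule influence_bound_const)

lemma index_integral_influence:
  assumes \<gamma>: "unit_weight \<gamma>"
  shows "(LINT s|index_measure. index_weight \<gamma> s * indicator (tail_region (t n) s) w) = - (LINT z|lborel. \<gamma> z * influence n z w)"
proof -
  let ?I = "\<lambda>\<kappa> z. indicat_real (tail_region (t n) (\<kappa>, z)) w"
  have [measurable]: "unit_clip \<in> borel_measurable borel" by (rule unit_clip_measurable)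
  have [measurable]: "(\<lambda>z :: real \<times> real. fst z) \<in> borel_measurable borel" "(\<lambda>z :: real \<times> real. snd z) \<in> borel_measurable borel"
    by (intro borel_measurable_continuous_onI continuous_intros)+
  have Im: "?I \<kappa> \<in> borel_measurable borel" for \<kappa>
  proof -
    have "(\<lambda>z. of_bool ((\<kappa> \<noteq> Second \<longrightarrow> fst w \<le> t n * unit_clip (fst z)) \<and> (\<kappa> \<noteq> First \<longrightarrow> snd w \<le> t n * unit_clip (snd z))) :: real)
        \<in> borel_measurable (borel \<Otimes>\<^sub>M borel)" by measurable
    then show ?thesis by (simp add: tail_region_def indicator_def borel_prod)
  qed
  have i: "integrable lborel (\<lambda>z. \<gamma> z * (f z * ?I \<kappa> z))" if "f \<in> borel_measurable borel" "\<And>z. 0 \<le> f z" "\<And>z. f z \<le> 1" for f \<kappa>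
    by (rule weight_times_bounded_integrable[OF \<gamma>, of _ 1]) (use that Im in \<open>auto simp: indicator_def\<close>)
  have ints: "integrable lborel (\<lambda>z. \<gamma> z * (1 * ?I Corner z))" "integrable lborel (\<lambda>z. \<gamma> z * (tail.D1 z * ?I First z))"
    "integrable lborel (\<lambda>z. \<gamma> z * (tail.D2 z * ?I Second z))"
    using i[of "\<lambda>_. 1" Corner] i[of tail.D1 First] i[of tail.D2 Second] tail.D_bounds tail.D_measurable by simp_all
  have "integrable lborel (\<lambda>z. index_weight \<gamma> (\<kappa>, z) * ?I \<kappa> z)" for \<kappa>
    using ints by (cases \<kappa>) (simp_all add: index_weight_def mult.assoc)
  then have "(LINT s|index_measure. index_weight \<gamma> s * indicator (tail_region (t n) s) w) =
      (LINT z|lborel. index_weight \<gamma> (Corner, z) * ?I Corner z) + (LINT z|lborel. index_weight \<gamma> (First, z) * ?I First z)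
      + (LINT z|lborel. index_weight \<gamma> (Second, z) * ?I Second z)"
    by (rule index_measure_integral(2))
  also have "\<dots> = - (LINT z|lborel. \<gamma> z * (1 * ?I Corner z)) + (LINT z|lborel. \<gamma> z * (tail.D1 z * ?I First z))
      + (LINT z|lborel. \<gamma> z * (tail.D2 z * ?I Second z))"
    by (simp add: index_weight_def mult.assoc)
  also have "\<dots> = - (LINT z|lborel. \<gamma> z * (1 * ?I Corner z) - \<gamma> z * (tail.D1 z * ?I First z) - \<gamma> z * (tail.D2 z * ?I Second z))"
    using ints by simp
  also have "(\<lambda>z. \<gamma> z * (1 * ?I Corner z) - \<gamma> z * (tail.D1 z * ?I First z) - \<gamma> z * (tail.D2 z * ?I Second z)) = (\<lambda>z. \<gamma> z * influence n z w)"
  proof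
    fix z
    show "\<gamma> z * (1 * ?I Corner z) - \<gamma> z * (tail.D1 z * ?I First z) - \<gamma> z * (tail.D2 z * ?I Second z) = \<gamma> z * influence n z w"
    proof (cases "z \<in> {0..1} \<times> {0..1}")
      case True
      then have "unit_clip (fst z) = fst z" "unit_clip (snd z) = snd z" by auto
      then show ?thesis by (simp add: influence_def tail_region_def right_diff_distrib)
    qed (simp add: unit_weightD(3)[OF \<gamma>])
  qed
  finally show ?thesis .
qed

lemma weight_\<nu>_influence_integral:
  assumes \<gamma>: "unit_weight \<gamma>"
  shows "integrable lborel (\<lambda>z. \<gamma> z * \<nu> n (influence n z) \<omega>)"
    and "(LINT z|lborel. \<gamma> z * \<nu> n (influence n z) \<omega>) = \<nu> n (\<lambda>w. LINT z|lborel. \<gamma> z * influence n z w) \<omega>"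
proof -
  interpret pair: pair_sigma_finite lborel Q ..
  have [measurable]: "\<gamma> \<in> borel_measurable borel" by (rule unit_weightD(1)[OF \<gamma>])
  have bQ: "\<bar>LINT w|Q. influence n z w\<bar> \<le> 2" for z
  proof -
    have "integrable Q (influence n z)" by (intro Q.integrable_const_bound[of _ 2] AE_I2) (use influence_measurable in \<open>simp_all add: influence_bound_const cong: measurable_cong_sets\<close>)
    then have "(LINT w|Q. \<bar>influence n z w\<bar>) \<le> 2" by (intro Q.integral_le_const AE_I2 influence_bound_const integrable_abs)
    then show ?thesis using integral_abs_bound[of Q "influence n z"] by linarith
  qed
  have iQ: "integrable lborel (\<lambda>z. \<gamma> z * (LINT w|Q. influence n z w))"
    by (rule weight_times_bounded_integrable[OF \<gamma> influence_integral_measurable]) (rule bQ)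
  have eq: "\<gamma> z * \<nu> n (influence n z) \<omega> = ((\<Sum>i=1..n. \<gamma> z * influence n z (Z i \<omega>)) - n * (\<gamma> z * (LINT w|Q. influence n z w))) / sqrt (k n)" for z
    by (simp add: \<nu>_def right_diff_distrib sum_distrib_left mult.left_commute)
  show "integrable lborel (\<lambda>z. \<gamma> z * \<nu> n (influence n z) \<omega>)"
    unfolding eq using weight_influence_integrable[OF \<gamma>] iQ by auto
  have "integrable (lborel \<Otimes>\<^sub>M Q) (\<lambda>p. \<gamma> (fst p) * influence n (fst p) (snd p))"
  proof (rule integrable_pair_dominated[OF sigma_finite_lborel Q.prob_space_axioms unit_weightD(2)[OF \<gamma>]])
    have 1: "(\<lambda>p. influence n (fst p) (snd p)) \<in> borel_measurable (lborel \<Otimes>\<^sub>M Q)"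
      using influence_joint_measurable[of n] by (simp cong: measurable_cong_sets sets_pair_measure_cong)
    have 2: "(\<lambda>p. \<gamma> (fst p)) \<in> borel_measurable (lborel \<Otimes>\<^sub>M Q)"
      by (rule measurable_compose[OF measurable_fst]) simp
    show "(\<lambda>p. \<gamma> (fst p) * influence n (fst p) (snd p)) \<in> borel_measurable (lborel \<Otimes>\<^sub>M Q)"
      by (rule borel_measurable_times[OF 2 1])
    show "\<bar>\<gamma> (fst (z, w)) * influence n (fst (z, w)) (snd (z, w))\<bar> \<le> 2 * \<bar>\<gamma> z\<bar>" for z w
      using mult_left_mono[OF influence_bound_const[of n z w] abs_ge_zero[of "\<gamma> z"]] by (simp add: abs_mult mult.commute)
  qed
  then have "(LINT w|Q. LINT z|lborel. \<gamma> z * influence n z w) = (LINT z|lborel. LINT w|Q. \<gamma> z * influence n z w)"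
    using pair.Fubini_integral[of "\<lambda>z w. \<gamma> z * influence n z w"] by (simp add: split_beta')
  then have fub: "(LINT z|lborel. \<gamma> z * (LINT w|Q. influence n z w)) = (LINT w|Q. LINT z|lborel. \<gamma> z * influence n z w)" by simp
  show "(LINT z|lborel. \<gamma> z * \<nu> n (influence n z) \<omega>) = \<nu> n (\<lambda>w. LINT z|lborel. \<gamma> z * influence n z w) \<omega>"
    unfolding eq using weight_influence_integrable[OF \<gamma>] iQ by (simp add: \<nu>_def fub)
qed

text \<open>The linear part is a centered sum over the sample of one bounded function, because \<open>\<nu>\<close> commutes with the
integral over \<open>z\<close>.\<close>

lemma deviation_decomposition:
  assumes \<gamma>: "unit_weight \<gamma>" and n: "n \<ge> 1" and \<omega>: "\<omega> \<in> space M"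
  shows "deviation \<gamma> n \<omega> = (LINT z|lborel. \<gamma> z * remainder n z \<omega>)
    + \<nu> n (\<lambda>w. LINT s|index_measure. index_weight \<gamma> s * indicator (tail_region (t n) s) w) \<omega>"
proof -
  have m: "(\<lambda>z. \<gamma> z * remainder n z \<omega>) \<in> borel_measurable lborel"
    using measurable_compose[OF measurable_Pair2'[OF \<omega>, of lborel] weighted_remainder_measurable[OF \<gamma>, of n]] by simp
  have i: "integrable lborel (\<lambda>z. \<gamma> z * remainder n z \<omega>)"
  proof (rule Bochner_Integration.integrable_bound[OF _ m])
    let ?C = "sqrt (k n) * (real n + 2) + 4 * real n / sqrt (k n)"
    show "integrable lborel (\<lambda>z. ?C * \<gamma> z)" using unit_weightD(2)[OF \<gamma>] by simp
    have "\<bar>\<gamma> z * remainder n z \<omega>\<bar> \<le> \<bar>?C * \<gamma> z\<bar>" for z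
    proof (cases "z \<in> {0..1} \<times> {0..1}")
      case True
      then have "\<bar>remainder n z \<omega>\<bar> \<le> \<bar>?C\<bar>" using remainder_bound[OF n True, of \<omega>] by linarith
      then show ?thesis by (simp only: abs_mult mult.commute[of "\<bar>?C\<bar>"] mult_left_mono abs_ge_zero)
    qed (simp add: unit_weightD(3)[OF \<gamma>])
    then show "AE z in lborel. norm (\<gamma> z * remainder n z \<omega>) \<le> norm (?C * \<gamma> z)" by simp
  qed
  have "deviation \<gamma> n \<omega> = (LINT z|lborel. \<gamma> z * remainder n z \<omega> - \<gamma> z * \<nu> n (influence n z) \<omega>)"
    unfolding deviation_def integral_mult_right_zero[symmetric]
    by (intro Bochner_Integration.integral_cong refl) (simp add: remainder_def algebra_simps)
  also have "\<dots> = (LINT z|lborel. \<gamma> z * remainder n z \<omega>) - \<nu> n (\<lambda>w. LINT z|lborel. \<gamma> z * influence n z w) \<omega>"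
    using i weight_\<nu>_influence_integral[OF \<gamma>] by simp
  also have "\<dots> = (LINT z|lborel. \<gamma> z * remainder n z \<omega>) + \<nu> n (\<lambda>w. (-1) * (LINT z|lborel. \<gamma> z * influence n z w)) \<omega>"
    unfolding \<nu>_mult by simp
  finally show ?thesis unfolding index_integral_influence[OF \<gamma>] by simp
qed

theorem deviation_clt:
  assumes \<gamma>: "unit_weight \<gamma>" and R: "R = tail_R l"
  shows "(\<lambda>n. CLINT \<omega>|M. iexp (deviation \<gamma> n \<omega>)) \<longlonglongrightarrow> complex_of_real
    (exp (- (LINT s|index_measure. index_weight \<gamma> s *
      (LINT s'|index_measure. index_weight \<gamma> s' * tail_kernel l (tail_index s) (tail_index s'))) / 2))"
proof -
  let ?\<zeta> = "\<lambda>n w. LINT s|index_measure. index_weight \<gamma> s * indicator (tail_region (t n) s) w"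
  let ?A = "\<lambda>n \<omega>. LINT z|lborel. \<gamma> z * remainder n z \<omega>"
  have t0: "filterlim t (at_right 0) sequentially"
  proof -
    have "\<forall>\<^sub>F n in sequentially. t n \<in> {0<..} \<and> t n \<noteq> 0"
      using eventually_ge_at_top[of 1] by eventually_elim (use t_bounds in force)
    then show ?thesis using t_tendsto_0 by (simp add: filterlim_at)
  qed
  have clt: "(\<lambda>n. CLINT \<omega>|M. iexp (((\<Sum>i=1..n. ?\<zeta> n (Z i \<omega>)) - n * (LINT z|Q. ?\<zeta> n z)) / sqrt (k n)))
    \<longlonglongrightarrow> complex_of_real (exp (- (LINT s|index_measure. index_weight \<gamma> s *
      (LINT s'|index_measure. index_weight \<gamma> s' * tail_kernel l (tail_index s) (tail_index s'))) / 2))"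
  proof (rule linear_statistic_clt[OF sigma_finite_index_measure space_index_measure index_weight_integrable[OF \<gamma>] tail_region_measurable _ k_top k_small])
    show "1 \<le> k n" if "n \<ge> 1" for n using k_range[OF that] by simp
    show "measure Q (tail_region (t n) s) \<le> real (k n) / real n" if "n \<ge> 1" for n s
      using tail.measure_tail_region[of "t n" s] t_bounds[OF that] by (simp add: t_def)
    show "(\<lambda>n. measure Q (tail_region (t n) s \<inter> tail_region (t n) s') / (real (k n) / real n)) \<longlonglongrightarrow> tail_kernel l (tail_index s) (tail_index s')" for s s'
      using filterlim_compose[OF tail.tail_kernel_limit[OF R] t0] by (simp add: t_def)
  qed
  have \<zeta>m: "?\<zeta> n \<in> borel_measurable borel" for n
  proof -
    have "(\<lambda>w. LINT z|lborel. \<gamma> z * influence n z w) \<in> borel_measurable borel"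
    proof -
      have 1: "(\<lambda>p. influence n (snd p) (fst p)) \<in> borel_measurable (borel \<Otimes>\<^sub>M lborel)"
        using measurable_compose[OF measurable_pair_swap' influence_joint_measurable[of n]]
        by (simp add: split_beta cong: measurable_cong_sets sets_pair_measure_cong)
      have 2: "(\<lambda>p. \<gamma> (snd p)) \<in> borel_measurable (borel \<Otimes>\<^sub>M lborel)"
        by (rule measurable_compose[OF measurable_snd]) (use unit_weightD(1)[OF \<gamma>] in simp)
      have "(\<lambda>(w, z). \<gamma> z * influence n z w) \<in> borel_measurable (borel \<Otimes>\<^sub>M lborel)"
        using borel_measurable_times[OF 2 1] by (simp add: split_beta')
      then show ?thesis by (rule lborel.borel_measurable_lebesgue_integral)
    qed
    then show ?thesis unfolding index_integral_influence[OF \<gamma>] by simp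
  qed
  have Am: "?A n \<in> borel_measurable M" if "n \<ge> 1" for n
    using weighted_remainder_tendsto_0(3)[OF \<gamma> that] by auto
  have dev: "(CLINT \<omega>|M. iexp (deviation \<gamma> n \<omega>)) = (CLINT \<omega>|M. iexp (?A n \<omega> + \<nu> n (?\<zeta> n) \<omega>))" if "n \<ge> 1" for n
    by (intro Bochner_Integration.integral_cong refl) (simp add: deviation_decomposition[OF \<gamma> that])
  have "(\<lambda>n. (CLINT \<omega>|M. iexp (deviation \<gamma> n \<omega>)) - (CLINT \<omega>|M. iexp (\<nu> n (?\<zeta> n) \<omega>))) \<longlonglongrightarrow> 0"
  proof (rule Lim_null_comparison[OF _ weighted_remainder_tendsto_0(1)[OF \<gamma>]])
    show "\<forall>\<^sub>F n in sequentially. cmod ((CLINT \<omega>|M. iexp (deviation \<gamma> n \<omega>)) - (CLINT \<omega>|M. iexp (\<nu> n (?\<zeta> n) \<omega>)))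
        \<le> (LINT z|lborel. \<bar>\<gamma> z\<bar> * expectation (\<lambda>\<omega>. \<bar>remainder n z \<omega>\<bar>))"
      using weighted_remainder_tendsto_0(2)[OF \<gamma>] eventually_ge_at_top[of 1]
    proof eventually_elim
      case (elim n)
      have "cmod ((CLINT \<omega>|M. iexp (?A n \<omega> + \<nu> n (?\<zeta> n) \<omega>)) - (CLINT \<omega>|M. iexp (\<nu> n (?\<zeta> n) \<omega>)))
          \<le> (LINT \<omega>|M. \<bar>(?A n \<omega> + \<nu> n (?\<zeta> n) \<omega>) - \<nu> n (?\<zeta> n) \<omega>\<bar>)"
        by (rule iexp_expectation_diff[OF prob_space_axioms])
          (use Am[OF elim(2)] \<nu>_measurable[OF \<zeta>m] weighted_remainder_tendsto_0(3)[OF \<gamma> elim(2)] in auto)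
      also have "\<dots> \<le> (LINT z|lborel. \<bar>\<gamma> z\<bar> * expectation (\<lambda>\<omega>. \<bar>remainder n z \<omega>\<bar>))"
        using elim(1) by simp
      finally show ?case using dev[OF elim(2)] by (simp only:)
    qed
  qed
  moreover have "(\<lambda>n. CLINT \<omega>|M. iexp (\<nu> n (?\<zeta> n) \<omega>)) \<longlonglongrightarrow> complex_of_real (exp (- (LINT s|index_measure. index_weight \<gamma> s *
      (LINT s'|index_measure. index_weight \<gamma> s' * tail_kernel l (tail_index s) (tail_index s'))) / 2))"
    using clt unfolding \<nu>_def .
  ultimately show ?thesis using tendsto_add by (force simp only: add_0_left diff_add_cancel)
qed

end

section \<open>From observations to a tail sample\<close>

text \<open>The probability integral transform for a continuous distribution function that may have flat parts.  Levels \<open>d\<close> strictly between \<open>0\<close>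
and \<open>1\<close> have a quantile by the intermediate value theorem, and \<open>{cdf < c}\<close> is compared with the half-lines ending at quantiles.\<close>

lemma (in real_distribution) cdf_probability_integral_transform:
  assumes cont: "\<And>x. isCont (cdf M) x" and s: "0 \<le> s" "s \<le> 1"
  shows "measure M {x. 1 - cdf M x \<le> s} = s"
proof -
  define c where "c = 1 - s"
  have c: "0 \<le> c" "c \<le> 1" using s by (auto simp: c_def)
  have quantile: "\<exists>a. cdf M a = d" if "0 < d" "d < 1" for d
  proof -
    have "\<forall>\<^sub>F x in at_bot. cdf M x < d" using cdf_lim_at_bot that(1) by (rule order_tendstoD)
    moreover have "\<forall>\<^sub>F x in at_bot. x \<le> (0::real)" by (rule eventually_le_at_bot)
    ultimately obtain u where u: "cdf M u < d" "u \<le> 0"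
      using eventually_happens'[OF trivial_limit_at_bot_linorder eventually_conj] by blast
    have "\<forall>\<^sub>F x in at_top. d < cdf M x" using cdf_lim_at_top_prob that(2) by (rule order_tendstoD)
    moreover have "\<forall>\<^sub>F x in at_top. x \<ge> (0::real)" by (rule eventually_ge_at_top)
    ultimately obtain v where v: "d < cdf M v" "0 \<le> v"
      using eventually_happens'[OF trivial_limit_at_top_linorder eventually_conj] by blast
    show ?thesis using IVT[of "cdf M" u d v] u v cont by force
  qed
  have [measurable]: "cdf M \<in> borel_measurable borel"
    by (intro borel_measurable_continuous_onI) (simp add: cont continuous_at_imp_continuous_on)
  have meas: "{x. cdf M x < c} \<in> sets M" by simp
  have "measure M {x. cdf M x < c} \<le> c"
  proof -
    consider "c = 0" | "c = 1" | "0 < c" "c < 1" using c by linarith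
    then show ?thesis
    proof cases
      case 1
      then have "{x. cdf M x < c} = {}" using cdf_nonneg by (auto simp: not_less)
      then show ?thesis using c by simp
    next
      case 3
      obtain a where a: "cdf M a = c" using quantile[OF 3] by blast
      have "{x. cdf M x < c} \<subseteq> {..a}"
      proof
        fix x assume "x \<in> {x. cdf M x < c}"
        then have "\<not> a \<le> x" using cdf_nondecreasing[of a x] a by auto
        then show "x \<in> {..a}" by simp
      qed
      then have "measure M {x. cdf M x < c} \<le> measure M {..a}" by (intro finite_measure_mono) auto
      then show ?thesis using a by (simp add: cdf_def)
    qed simp
  qed
  moreover have "c \<le> measure M {x. cdf M x < c}"
  proof (rule dense_le)
    fix d assume d: "d < c"
    show "d \<le> measure M {x. cdf M x < c}"
    proof (cases "0 < d")
      case True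
      obtain a where a: "cdf M a = d" using quantile[of d] True d c by force
      have "{..a} \<subseteq> {x. cdf M x < c}" using cdf_nondecreasing[of _ a] d by (force simp: a[symmetric])
      then have "measure M {..a} \<le> measure M {x. cdf M x < c}" by (intro finite_measure_mono meas)
      then show ?thesis using a by (simp add: cdf_def)
    qed (use measure_nonneg[of M "{x. cdf M x < c}"] in linarith)
  qed
  moreover have "measure M (space M - {x. cdf M x < c}) = 1 - measure M {x. cdf M x < c}"
    by (rule prob_compl[OF meas])
  moreover have "space M - {x. cdf M x < c} = {x. 1 - cdf M x \<le> s}" by (auto simp: c_def)
  ultimately show ?thesis by (simp add: c_def)
qed

text \<open>The mass of \<open>{V = u, W \<le> v}\<close> is at most the increment of \<open>F\<close> over \<open>(u - h, u]\<close> at the fixed height \<open>v\<close>; then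
\<open>v\<close> runs through the natural numbers.\<close>

lemma (in prob_space) continuous_joint_cdf_no_atoms:
  fixes V W :: "'a \<Rightarrow> real"
  assumes [measurable]: "V \<in> borel_measurable M" "W \<in> borel_measurable M"
    and F: "\<And>u v. \<P>(\<omega> in M. V \<omega> \<le> u \<and> W \<omega> \<le> v) = F u v"
    and cont: "\<And>u v. isCont (\<lambda>u. F u v) u"
  shows "isCont (cdf (distr M borel V)) u"
proof -
  interpret D: real_distribution "distr M borel V" by (rule real_distribution_distr) simp
  have null: "prob {\<omega>\<in>space M. V \<omega> = u \<and> W \<omega> \<le> v} = 0" for v
  proof -
    have "prob {\<omega>\<in>space M. V \<omega> = u \<and> W \<omega> \<le> v} \<le> F u v - F (u - 1 / Suc n) v" for n
    proof -
      have "prob {\<omega>\<in>space M. V \<omega> = u \<and> W \<omega> \<le> v} + prob {\<omega>\<in>space M. V \<omega> \<le> u - 1 / Suc n \<and> W \<omega> \<le> v}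
          = prob ({\<omega>\<in>space M. V \<omega> = u \<and> W \<omega> \<le> v} \<union> {\<omega>\<in>space M. V \<omega> \<le> u - 1 / Suc n \<and> W \<omega> \<le> v})"
        by (rule finite_measure_Union[symmetric]) auto
      also have "\<dots> \<le> prob {\<omega>\<in>space M. V \<omega> \<le> u \<and> W \<omega> \<le> v}"
      proof (intro finite_measure_mono subsetI)
        fix \<omega> assume "\<omega> \<in> {\<omega>\<in>space M. V \<omega> = u \<and> W \<omega> \<le> v} \<union> {\<omega>\<in>space M. V \<omega> \<le> u - 1 / Suc n \<and> W \<omega> \<le> v}"
        moreover have "u - 1 / real (Suc n) \<le> u" by simp
        ultimately show "\<omega> \<in> {\<omega>\<in>space M. V \<omega> \<le> u \<and> W \<omega> \<le> v}"
          by (elim UnE CollectE conjE) (auto intro: order.trans simp del: of_nat_Suc)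
      qed simp
      finally show ?thesis unfolding F by simp
    qed
    moreover have "(\<lambda>n. F u v - F (u - 1 / Suc n) v) \<longlonglongrightarrow> 0"
    proof -
      have "(\<lambda>n. u - 1 / Suc n) \<longlonglongrightarrow> u - 0" by (intro tendsto_diff tendsto_const LIMSEQ_Suc lim_1_over_n)
      then have "(\<lambda>n. F (u - 1 / Suc n) v) \<longlonglongrightarrow> F u v"
        using isCont_tendsto_compose[OF cont[of u v]] by simp
      from tendsto_diff[OF tendsto_const[of "F u v"] this] show ?thesis by simp
    qed
    ultimately have "prob {\<omega>\<in>space M. V \<omega> = u \<and> W \<omega> \<le> v} \<le> 0"
      using LIMSEQ_le_const by blast
    then show ?thesis using measure_nonneg[of M] by (simp add: order_antisym)
  qed
  have "AE \<omega> in M. \<forall>n. \<not> (V \<omega> = u \<and> W \<omega> \<le> real n)"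
    unfolding AE_all_countable
  proof
    fix n :: nat
    have "emeasure M {\<omega>\<in>space M. V \<omega> = u \<and> W \<omega> \<le> real n} = 0" using null[of n] by (simp add: emeasure_eq_measure)
    then show "AE \<omega> in M. \<not> (V \<omega> = u \<and> W \<omega> \<le> real n)" by (subst AE_iff_measurable[OF _ refl]) auto
  qed
  then have "AE \<omega> in M. V \<omega> \<noteq> u"
    by eventually_elim (use real_arch_simple in blast)
  then have "prob {\<omega>\<in>space M. V \<omega> = u} = 0" by (subst prob_eq_0) auto
  then have "measure (distr M borel V) {u} = 0"
    by (subst measure_distr) (auto simp: vimage_def Int_def conj_commute)
  then show ?thesis using D.isCont_cdf by simp
qed

lemma distr_pair_eqI:
  fixes V W V' W' :: "'a \<Rightarrow> real"
  assumes "prob_space M" and [measurable]: "V \<in> borel_measurable M" "W \<in> borel_measurable M" "V' \<in> borel_measurable M" "W' \<in> borel_measurable M"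
    and eq: "\<And>u v. \<P>(\<omega> in M. V \<omega> \<le> u \<and> W \<omega> \<le> v) = \<P>(\<omega> in M. V' \<omega> \<le> u \<and> W' \<omega> \<le> v)"
  shows "distr M borel (\<lambda>\<omega>. (V \<omega>, W \<omega>)) = distr M borel (\<lambda>\<omega>. (V' \<omega>, W' \<omega>))"
proof (rule measure_eqI_generator_eq[where E = "range (\<lambda>a :: real \<times> real. {..a})" and \<Omega> = UNIV
      and A = "\<lambda>n. {..(real n, real n)}"])
  interpret prob_space M by fact
  have pm [measurable]: "(\<lambda>\<omega>. (V \<omega>, W \<omega>)) \<in> borel_measurable M" "(\<lambda>\<omega>. (V' \<omega>, W' \<omega>)) \<in> borel_measurable M"
    by (intro borel_measurable_Pair; measurable)+
  have inf: "inf a b = (inf (fst a) (fst b), inf (snd a) (snd b))" for a b :: "real \<times> real"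
    by (simp add: prod_eq_iff)
  show "Int_stable (range (\<lambda>a :: real \<times> real. {..a}))"
  proof (rule Int_stableI_image)
    fix a b :: "real \<times> real"
    have "{..a} \<inter> {..b} = {..inf a b}" by auto
    then show "\<exists>c\<in>UNIV. {..a} \<inter> {..b} = {..c}" by blast
  qed
  show "emeasure (distr M borel (\<lambda>\<omega>. (V \<omega>, W \<omega>))) S = emeasure (distr M borel (\<lambda>\<omega>. (V' \<omega>, W' \<omega>))) S"
    if "S \<in> range (\<lambda>a :: real \<times> real. {..a})" for S
  proof -
    obtain u v where S: "S = {..(u, v)}" using \<open>S \<in> _\<close> by force
    have "emeasure (distr M borel (\<lambda>\<omega>. (V \<omega>, W \<omega>))) S = \<P>(\<omega> in M. V \<omega> \<le> u \<and> W \<omega> \<le> v)"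
      unfolding S by (subst emeasure_distr) (auto simp: emeasure_eq_measure vimage_def Int_def conj_ac)
    moreover have "emeasure (distr M borel (\<lambda>\<omega>. (V' \<omega>, W' \<omega>))) S = \<P>(\<omega> in M. V' \<omega> \<le> u \<and> W' \<omega> \<le> v)"
      unfolding S by (subst emeasure_distr) (auto simp: emeasure_eq_measure vimage_def Int_def conj_ac)
    ultimately show ?thesis using eq by simp
  qed
  have "sets (borel :: (real \<times> real) measure) = sigma_sets UNIV (range (\<lambda>a. {..a}))"
    by (subst borel_eq_atMost) simp
  then show "sets (distr M borel (\<lambda>\<omega>. (V \<omega>, W \<omega>))) = sigma_sets UNIV (range (\<lambda>a. {..a}))"
    "sets (distr M borel (\<lambda>\<omega>. (V' \<omega>, W' \<omega>))) = sigma_sets UNIV (range (\<lambda>a. {..a}))" by simp_all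
  show "(\<Union>n. {..(real n, real n)}) = UNIV"
  proof (intro UNIV_eq_I[symmetric])
    fix z :: "real \<times> real"
    obtain n where "max (fst z) (snd z) \<le> real n" using real_arch_simple by blast
    then show "z \<in> (\<Union>n. {..(real n, real n)})" by (cases z) auto
  qed
  show "emeasure (distr M borel (\<lambda>\<omega>. (V \<omega>, W \<omega>))) {..(real n, real n)} \<noteq> \<infinity>" for n
    by (subst emeasure_distr) (auto simp: emeasure_eq_measure)
qed auto

text \<open>With \<open>e = 2\<alpha> / (1 + 2\<alpha>)\<close> the bias is \<open>sqrt k (k / n)\<^sup>\<alpha> = (k / n\<^sup>e)\<^bsup>1/2 + \<alpha>\<^esup>\<close>, and \<open>e < 1\<close>.\<close>

lemma intermediate_sequence:
  fixes k :: "nat \<Rightarrow> nat"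
  assumes \<alpha>: "\<alpha> > 0" and k: "\<And>n. n \<ge> 1 \<Longrightarrow> k n \<in> {1..n}"
    and o: "(\<lambda>n. real (k n)) \<in> o(\<lambda>n. real n powr (2 * \<alpha> / (1 + 2 * \<alpha>)))"
  shows "(\<lambda>n. real (k n) / real n) \<longlonglongrightarrow> 0"
    and "(\<lambda>n. sqrt (k n) * (real (k n) / real n) powr \<alpha>) \<longlonglongrightarrow> 0"
proof -
  define e where "e = 2 * \<alpha> / (1 + 2 * \<alpha>)"
  have e: "0 < e" "e < 1" using \<alpha> by (auto simp: e_def)
  have lim: "(\<lambda>n. real (k n) / real n powr e) \<longlonglongrightarrow> 0"
    using smalloD_tendsto[OF o] by (simp add: e_def)
  show "(\<lambda>n. real (k n) / real n) \<longlonglongrightarrow> 0"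
  proof (rule Lim_null_comparison[OF _ lim])
    show "\<forall>\<^sub>F n in sequentially. norm (real (k n) / real n) \<le> real (k n) / real n powr e"
      using eventually_ge_at_top[of 1]
    proof eventually_elim
      case (elim n)
      have "real n powr e \<le> real n powr 1" using elim e by (intro powr_mono) auto
      then show ?case using elim by (auto intro!: divide_left_mono)
    qed
  qed
  have "(\<lambda>n. (real (k n) / real n powr e) powr ((1 + 2 * \<alpha>) / 2)) \<longlonglongrightarrow> 0"
    using tendsto_zero_powrI[OF lim tendsto_const, of "(1 + 2 * \<alpha>) / 2"] \<alpha> by simp
  moreover have "\<forall>\<^sub>F n in sequentially. (real (k n) / real n powr e) powr ((1 + 2 * \<alpha>) / 2) = sqrt (k n) * (real (k n) / real n) powr \<alpha>"
    using eventually_ge_at_top[of 1]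
  proof eventually_elim
    case (elim n)
    have p: "0 < real (k n)" "0 < real n" using k[OF elim] by auto
    have "(real (k n) / real n powr e) powr ((1 + 2 * \<alpha>) / 2) = real (k n) powr (1 / 2 + \<alpha>) / real n powr (e * ((1 + 2 * \<alpha>) / 2))"
      using p by (simp add: powr_divide powr_powr add_divide_distrib)
    also have "e * ((1 + 2 * \<alpha>) / 2) = \<alpha>" using \<alpha> by (simp add: e_def field_simps)
    also have "real (k n) powr (1 / 2 + \<alpha>) = sqrt (k n) * real (k n) powr \<alpha>"
      using p by (simp add: powr_add powr_half_sqrt)
    finally show ?case using p by (simp add: powr_divide)
  qed
  ultimately show "(\<lambda>n. sqrt (k n) * (real (k n) / real n) powr \<alpha>) \<longlonglongrightarrow> 0"
    by (rule Lim_transform_eventually)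
qed

text \<open>The transforms \<open>1 - F1\<close> and \<open>1 - F2\<close> make the margins uniform, inclusion and exclusion turns the stable
tail dependence function into the tail copula, and the two rate conditions bound the bias.\<close>

theorem tail_sample_of_observations:
  fixes M :: "'a measure" and X Y :: "nat \<Rightarrow> 'a \<Rightarrow> real" and F :: "real \<Rightarrow> real \<Rightarrow> real" and k :: "nat \<Rightarrow> nat"
  assumes M: "prob_space M"
    and indep: "prob_space.indep_vars M (\<lambda>_. borel) (\<lambda>i \<omega>. (X i \<omega>, Y i \<omega>)) UNIV"
    and F: "\<And>i u v. \<P>(\<omega> in M. X i \<omega> \<le> u \<and> Y i \<omega> \<le> v) = F u v"
    and F_cont: "continuous_on UNIV (\<lambda>(u, v). F u v)"
    and stdf: "has_stdf M (X 0) (Y 0) l"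
    and k_range: "\<And>n. n \<ge> 1 \<Longrightarrow> k n \<in> {1..n}"
    and \<alpha>: "\<alpha> > 0"
    and C: "\<exists>C. \<forall>\<^sub>F t in at_right 0. \<forall>x\<ge>0. \<forall>y\<ge>0. x + y = 1 \<longrightarrow>
               \<bar>\<P>(\<omega> in M. 1 - cdf (distr M borel (X 0)) (X 0 \<omega>) \<le> t * x \<and>
                           1 - cdf (distr M borel (Y 0)) (Y 0 \<omega>) \<le> t * y) / t
                 - tail_R l x y\<bar> \<le> C * t powr \<alpha>"
    and k_top: "filterlim k at_top sequentially"
    and k_small: "(\<lambda>n. real (k n)) \<in> o(\<lambda>n. real n powr (2 * \<alpha> / (1 + 2 * \<alpha>)))"
  defines "f1 \<equiv> \<lambda>x. 1 - cdf (distr M borel (X 0)) x" and "f2 \<equiv> \<lambda>y. 1 - cdf (distr M borel (Y 0)) y"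
  shows "\<exists>Q \<beta>. tail_sample M (\<lambda>i \<omega>. (f1 (X i \<omega>), f2 (Y i \<omega>))) Q (tail_R l) X Y f1 f2 k \<beta>"
proof -
  interpret prob_space M by fact
  have pm: "(\<lambda>\<omega>. (X i \<omega>, Y i \<omega>)) \<in> borel_measurable M" for i
    using indep by (simp add: indep_vars_def)
  have X [measurable]: "X i \<in> borel_measurable M" and Y [measurable]: "Y i \<in> borel_measurable M" for i
    using borel_measurable_continuous_on[OF continuous_on_fst[OF continuous_on_id] pm[of i]]
      borel_measurable_continuous_on[OF continuous_on_snd[OF continuous_on_id] pm[of i]] by simp_all
  interpret D1: real_distribution "distr M borel (X 0)" by (rule real_distribution_distr) simp
  interpret D2: real_distribution "distr M borel (Y 0)" by (rule real_distribution_distr) simp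
  have cX: "isCont (cdf (distr M borel (X 0))) u" for u
  proof (rule continuous_joint_cdf_no_atoms[OF X Y F])
    fix u v
    have "continuous_on UNIV (\<lambda>u. (\<lambda>(u, v). F u v) (u, v))"
      by (rule continuous_on_compose2[OF F_cont]) (auto intro!: continuous_intros)
    then show "isCont (\<lambda>u. F u v) u" by (simp add: continuous_on_eq_continuous_at)
  qed
  have cY: "isCont (cdf (distr M borel (Y 0))) u" for u
  proof (rule continuous_joint_cdf_no_atoms[OF Y X])
    show "\<P>(\<omega> in M. Y 0 \<omega> \<le> v \<and> X 0 \<omega> \<le> u) = F u v" for u v using F[of 0 u v] by (simp add: conj_commute)
    fix u v
    have "continuous_on UNIV (\<lambda>v. (\<lambda>(u, v). F u v) (u, v))"
      by (rule continuous_on_compose2[OF F_cont]) (auto intro!: continuous_intros)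
    then show "isCont (\<lambda>v. F u v) v" by (simp add: continuous_on_eq_continuous_at)
  qed
  have f_anti: "antimono f1" "antimono f2"
    unfolding f1_def f2_def by (auto intro!: antimonoI D1.cdf_nondecreasing D2.cdf_nondecreasing)
  have f_meas [measurable]: "f1 \<in> borel_measurable borel" "f2 \<in> borel_measurable borel"
    unfolding f1_def f2_def
    by (intro borel_measurable_continuous_onI continuous_intros; simp add: cX cY continuous_at_imp_continuous_on)+
  define Z where "Z i \<omega> = (f1 (X i \<omega>), f2 (Y i \<omega>))" for i \<omega>
  define Q where "Q = distr M borel (Z 0)"
  have h: "(\<lambda>p. (f1 (fst p), f2 (snd p))) \<in> borel_measurable borel"
  proof -
    have "(\<lambda>p. (f1 (fst p), f2 (snd p))) \<in> borel_measurable (borel \<Otimes>\<^sub>M borel)" by measurable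
    then show ?thesis by (simp add: borel_prod)
  qed
  interpret Z: iid_sample M Z Q
  proof (unfold_locales)
    show "indep_vars (\<lambda>_. borel) Z UNIV"
      using indep_vars_compose2[OF indep, of "\<lambda>_ p. (f1 (fst p), f2 (snd p))" "\<lambda>_. borel"] h
      by (simp add: Z_def[abs_def])
    show "distr M borel (Z i) = Q" for i
    proof -
      have "distr M borel (\<lambda>\<omega>. (X i \<omega>, Y i \<omega>)) = distr M borel (\<lambda>\<omega>. (X 0 \<omega>, Y 0 \<omega>))"
        by (rule distr_pair_eqI[OF M]) (simp_all add: F)
      moreover have "distr M borel (Z j) = distr (distr M borel (\<lambda>\<omega>. (X j \<omega>, Y j \<omega>))) borel (\<lambda>p. (f1 (fst p), f2 (snd p)))" for j
        by (subst distr_distr[OF h pm]) (simp add: Z_def[abs_def] comp_def)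
      ultimately show ?thesis by (simp add: Q_def)
    qed
  qed
  have Qm: "measure Q S = \<P>(\<omega> in M. Z 0 \<omega> \<in> S)" if "S \<in> sets borel" for S
    using Z.prob_law[OF that, of 0] by simp
  note ms = sets_borel_Collect_pair
  have u1: "\<P>(\<omega> in M. f1 (X 0 \<omega>) \<le> s) = s" if "0 \<le> s" "s \<le> 1" for s
  proof -
    have "measure (distr M borel (X 0)) {x. f1 x \<le> s} = s"
      using D1.cdf_probability_integral_transform[OF cX that] by (simp add: f1_def)
    then show ?thesis by (subst (asm) measure_distr) (auto simp: vimage_def Int_def conj_commute)
  qed
  have u2: "\<P>(\<omega> in M. f2 (Y 0 \<omega>) \<le> s) = s" if "0 \<le> s" "s \<le> 1" for s
  proof -
    have "measure (distr M borel (Y 0)) {x. f2 x \<le> s} = s"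
      using D2.cdf_probability_integral_transform[OF cY that] by (simp add: f2_def)
    then show ?thesis by (subst (asm) measure_distr) (auto simp: vimage_def Int_def conj_commute)
  qed
  have cop: "measure Q {z. fst z \<le> a \<and> snd z \<le> b} = \<P>(\<omega> in M. f1 (X 0 \<omega>) \<le> a \<and> f2 (Y 0 \<omega>) \<le> b)" for a b
    by (subst Qm) (auto intro!: ms simp: Z_def)
  interpret Q: tail_copula Q "tail_R l"
  proof
    show "sets Q = sets borel" by simp
    show "measure Q {z. fst z \<le> s} = s" if "0 \<le> s" "s \<le> 1" for s
      using u1[OF that] by (subst Qm) (auto intro!: ms simp: Z_def)
    show "measure Q {z. snd z \<le> s} = s" if "0 \<le> s" "s \<le> 1" for s
      using u2[OF that] by (subst Qm) (auto intro!: ms simp: Z_def)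
    fix x y :: real assume xy: "0 \<le> x" "0 \<le> y"
    let ?P = "\<lambda>t. \<P>(\<omega> in M. f1 (X 0 \<omega>) \<le> t * x \<or> f2 (Y 0 \<omega>) \<le> t * y)"
    have "((\<lambda>t. ?P t / t) \<longlongrightarrow> l x y) (at_right 0)"
      using stdf xy unfolding has_stdf_def f1_def f2_def by blast
    then have lim: "((\<lambda>t. x + y - ?P t / t) \<longlongrightarrow> tail_R l x y) (at_right 0)"
      unfolding tail_R_def by (intro tendsto_intros)
    have "\<forall>\<^sub>F t in at_right 0. x + y - ?P t / t = measure Q {z. fst z \<le> t * x \<and> snd z \<le> t * y} / t"
      unfolding eventually_at_right_field
    proof (intro exI[of _ "1 / (1 + x + y)"] conjI allI impI)
      show "0 < 1 / (1 + x + y)" using xy by simp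
      fix t :: real assume t: "0 < t" "t < 1 / (1 + x + y)"
      have "t * (1 + x + y) < 1" using t xy by (simp add: pos_less_divide_eq)
      then have "t + t * x + t * y < 1" by (simp add: distrib_left)
      moreover have "0 \<le> t * x" "0 \<le> t * y" using t xy by auto
      ultimately have tx: "t * x \<le> 1" "t * y \<le> 1" "0 \<le> t * x" "0 \<le> t * y" using t by linarith+
      have "?P t = prob ({\<omega>\<in>space M. f1 (X 0 \<omega>) \<le> t * x} \<union> {\<omega>\<in>space M. f2 (Y 0 \<omega>) \<le> t * y})"
        by (intro arg_cong[where f=prob]) auto
      also have "\<dots> = prob {\<omega>\<in>space M. f1 (X 0 \<omega>) \<le> t * x} + prob {\<omega>\<in>space M. f2 (Y 0 \<omega>) \<le> t * y}
          - prob ({\<omega>\<in>space M. f1 (X 0 \<omega>) \<le> t * x} \<inter> {\<omega>\<in>space M. f2 (Y 0 \<omega>) \<le> t * y})"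
        by (rule measure_Un3) (auto simp: fmeasurable_eq_sets)
      also have "{\<omega>\<in>space M. f1 (X 0 \<omega>) \<le> t * x} \<inter> {\<omega>\<in>space M. f2 (Y 0 \<omega>) \<le> t * y} = {\<omega>\<in>space M. f1 (X 0 \<omega>) \<le> t * x \<and> f2 (Y 0 \<omega>) \<le> t * y}"
        by auto
      finally have "?P t = t * x + t * y - measure Q {z. fst z \<le> t * x \<and> snd z \<le> t * y}"
        unfolding cop using u1 u2 tx by simp
      then show "x + y - ?P t / t = measure Q {z. fst z \<le> t * x \<and> snd z \<le> t * y} / t"
        using t by (simp add: field_simps)
    qed
    then show "((\<lambda>t. measure Q {z. fst z \<le> t * x \<and> snd z \<le> t * y} / t) \<longlongrightarrow> tail_R l x y) (at_right 0)"
      using lim by (rule Lim_transform_eventually[rotated])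
  qed
  obtain C where C: "\<forall>\<^sub>F t in at_right 0. \<forall>x\<ge>0. \<forall>y\<ge>0. x + y = 1 \<longrightarrow> \<bar>Q.cop (t * x) (t * y) / t - tail_R l x y\<bar> \<le> C * t powr \<alpha>"
    using C unfolding Q.cop_def cop f1_def f2_def by blast
  obtain C' where C': "\<forall>\<^sub>F t in at_right 0. \<forall>x\<in>{0..2}. \<forall>y\<in>{0..2}. \<bar>Q.cop (t * x) (t * y) / t - tail_R l x y\<bar> \<le> C' * t powr \<alpha>"
    using Q.tail_bias[OF \<alpha> C] by blast
  have small: "(\<lambda>n. real (k n) / real n) \<longlonglongrightarrow> 0" and bias0: "(\<lambda>n. sqrt (k n) * (real (k n) / real n) powr \<alpha>) \<longlonglongrightarrow> 0"
    using intermediate_sequence[OF \<alpha> k_range k_small] by blast+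
  have pos: "\<forall>\<^sub>F n in sequentially. real (k n) / real n \<in> {0<..} \<and> real (k n) / real n \<noteq> 0"
    using eventually_ge_at_top[of 1] by eventually_elim (use k_range in force)
  have t0: "filterlim (\<lambda>n. real (k n) / real n) (at_right 0) sequentially"
    using small pos by (simp add: filterlim_at)
  define \<beta> where "\<beta> n = C' * (sqrt (k n) * (real (k n) / real n) powr \<alpha>)" for n
  have "tail_sample M Z Q (tail_R l) X Y f1 f2 k \<beta>"
  proof
    show "\<beta> \<longlonglongrightarrow> 0" using tendsto_mult_right_zero[OF bias0, of C'] by (simp add: \<beta>_def[abs_def])
    show "\<forall>\<^sub>F n in sequentially. \<forall>x\<in>{0..2}. \<forall>y\<in>{0..2}.
      sqrt (k n) * \<bar>Q.cop (k n / n * x) (k n / n * y) / (k n / n) - tail_R l x y\<bar> \<le> \<beta> n"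
      using eventually_compose_filterlim[OF C' t0]
    proof eventually_elim
      case (elim n)
      show ?case
      proof (intro ballI)
        fix x y :: real assume "x \<in> {0..2}" "y \<in> {0..2}"
        then have "\<bar>Q.cop (k n / n * x) (k n / n * y) / (k n / n) - tail_R l x y\<bar> \<le> C' * (real (k n) / real n) powr \<alpha>"
          using elim by blast
        from mult_left_mono[OF this, of "sqrt (k n)"]
        show "sqrt (k n) * \<bar>Q.cop (k n / n * x) (k n / n * y) / (k n / n) - tail_R l x y\<bar> \<le> \<beta> n"
          by (simp add: \<beta>_def mult.left_commute)
      qed
    qed
  qed (use f_anti k_range k_top small in \<open>auto simp: Z_def\<close>)
  then show ?thesis unfolding Z_def by blast
qed

section \<open>The delta method and asymptotic normality of the weighted estimator\<close>

text \<open>The estimator depends on the sample only through the ranks, which take values in a countable set; so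
an arbitrary function \<open>H\<close> of it is measurable.  This covers the inverse of the moment map together with
its default value.\<close>

lemma rank_statistic_measurable:
  fixes X Y :: "nat \<Rightarrow> 'a \<Rightarrow> real"
  assumes X: "\<And>i. X i \<in> borel_measurable M" and Y: "\<And>i. Y i \<in> borel_measurable M"
  shows "(\<lambda>\<omega>. H (stdf_estimator X Y n k \<omega>)) \<in> borel_measurable M"
proof -
  define \<rho> where "\<rho> \<omega> = map (\<lambda>i. (sample_rank X n i \<omega>, sample_rank Y n i \<omega>)) [1..<Suc n]" for \<omega>
  define E where "E a x y = 1 / real k * (\<Sum>i=1..n. of_bool (real (fst (a ! (i - 1))) > real n + 1 / 2 - real k * x \<or>
    real (snd (a ! (i - 1))) > real n + 1 / 2 - real k * y))" for a :: "(nat \<times> nat) list" and x y :: real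
  have "stdf_estimator X Y n k \<omega> = E (\<rho> \<omega>)" for \<omega>
    unfolding stdf_estimator_def E_def \<rho>_def by (intro ext arg_cong2[where f=times] sum.cong refl) (auto simp del: upt_Suc)
  moreover have "\<rho> \<in> measurable M (count_space UNIV)"
    unfolding measurable_count_space_eq2_countable
  proof (intro conjI ballI)
    have r: "{\<omega> \<in> space M. sample_rank V n i \<omega> = c} \<in> sets M" if V: "\<And>i. V i \<in> borel_measurable M" for V i c
    proof -
      have "{\<omega> \<in> space M. real (sample_rank V n i \<omega>) = real c} \<in> sets M"
        by (intro borel_measurable_eq sample_rank_measurable V borel_measurable_const)
      then show ?thesis by simp
    qed
    fix a :: "(nat \<times> nat) list"
    have "\<rho> \<omega> = a \<longleftrightarrow> length a = n \<and> (\<forall>i\<in>{..<n}. sample_rank X n (Suc i) \<omega> = fst (a ! i) \<and> sample_rank Y n (Suc i) \<omega> = snd (a ! i))" for \<omega>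
    proof -
      have len: "length (\<rho> \<omega>) = n" by (simp add: \<rho>_def del: upt_Suc)
      have nth: "\<rho> \<omega> ! i = (sample_rank X n (Suc i) \<omega>, sample_rank Y n (Suc i) \<omega>)" if "i < n" for i
        using that by (simp add: \<rho>_def del: upt_Suc)
      show ?thesis unfolding list_eq_iff_nth_eq[of "\<rho> \<omega>"] len using nth by (metis lessThan_iff prod.collapse prod.inject)
    qed
    then have "\<rho> -` {a} \<inter> space M = {\<omega> \<in> space M. length a = n \<and> (\<forall>i\<in>{..<n}. sample_rank X n (Suc i) \<omega> = fst (a ! i) \<and> sample_rank Y n (Suc i) \<omega> = snd (a ! i))}"
      by blast
    also have "\<dots> \<in> sets M"
      by (intro sets.sets_Collect_conj sets.sets_Collect_const sets.sets_Collect_finite_All r X Y) auto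
    finally show "\<rho> -` {a} \<inter> space M \<in> sets M" .
  qed simp
  ultimately show ?thesis using measurable_compose[of \<rho> M "count_space UNIV" "\<lambda>a. H (E a)" borel] by simp
qed

text \<open>On the event that the normalized variable \<open>v n\<close> has norm at most \<open>K + 1\<close>, \<open>m n\<close> is within \<open>(K + 1) / r n\<close> of \<open>a\<close>
and the linearization error times \<open>r n\<close> is small.  The complement has small probability because the limit
law is tight; \<open>tail K\<close> is a continuous function that dominates its indicator.  Characteristic functions are
then compared.\<close>

theorem delta_method:
  fixes m :: "nat \<Rightarrow> 'a \<Rightarrow> 'c::euclidean_space" and \<psi> :: "'c \<Rightarrow> 'd::euclidean_space" and r :: "nat \<Rightarrow> real"
  assumes M: "prob_space M" and N: "prob_space N"
    and conv: "converges_in_distribution M (\<lambda>n \<omega>. r n *\<^sub>R (m n \<omega> - a)) N V"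
    and r: "filterlim r at_top sequentially"
    and \<psi>m: "\<And>n. (\<lambda>\<omega>. \<psi> (m n \<omega>)) \<in> borel_measurable M"
    and deriv: "(\<psi> has_derivative D) (at a)"
  shows "converges_in_distribution M (\<lambda>n \<omega>. r n *\<^sub>R (\<psi> (m n \<omega>) - \<psi> a)) N (\<lambda>\<omega>. D (V \<omega>))"
proof -
  interpret M: prob_space M by fact
  interpret N: prob_space N by fact
  interpret D: bounded_linear D by (rule has_derivative_bounded_linear[OF deriv])
  define v where "v n \<omega> = r n *\<^sub>R (m n \<omega> - a)" for n \<omega>
  define T where "T n \<omega> = r n *\<^sub>R (\<psi> (m n \<omega>) - \<psi> a)" for n \<omega>
  have [measurable]: "v n \<in> borel_measurable M" "V \<in> borel_measurable N" for n
    using conv by (auto simp: converges_in_distribution_def v_def[abs_def])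
  note [measurable] = \<psi>m
  have Dm [measurable]: "D \<in> borel_measurable borel"
    by (intro borel_measurable_continuous_onI linear_continuous_on D.bounded_linear_axioms)
  have Tm [measurable]: "T n \<in> borel_measurable M" for n unfolding T_def[abs_def] by measurable
  have test: "(\<lambda>n. LINT \<omega>|M. h (v n \<omega>)) \<longlonglongrightarrow> (LINT \<omega>|N. h (V \<omega>))"
    if "continuous_on UNIV h" "bounded (range h)" for h :: "'c \<Rightarrow> real"
    using conv that by (auto simp: converges_in_distribution_def v_def[abs_def])
  show ?thesis unfolding T_def[symmetric]
  proof (rule levy_continuity_euclidean[OF M N Tm])
    show "(\<lambda>\<omega>. D (V \<omega>)) \<in> borel_measurable N" by measurable
    fix c :: 'd
    have cD: "continuous_on UNIV (\<lambda>u. c \<bullet> D u)"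
      by (intro continuous_intros D.continuous_on)
    have lin: "(\<lambda>n. CLINT \<omega>|M. iexp (c \<bullet> D (v n \<omega>))) \<longlonglongrightarrow> (CLINT \<omega>|N. iexp (c \<bullet> D (V \<omega>)))"
    proof -
      have c: "(\<lambda>n. LINT \<omega>|M. cos (c \<bullet> D (v n \<omega>))) \<longlonglongrightarrow> (LINT \<omega>|N. cos (c \<bullet> D (V \<omega>)))"
        using cD by (intro test) (auto intro!: continuous_intros boundedI[of _ 1])
      have s: "(\<lambda>n. LINT \<omega>|M. sin (c \<bullet> D (v n \<omega>))) \<longlonglongrightarrow> (LINT \<omega>|N. sin (c \<bullet> D (V \<omega>)))"
        using cD by (intro test) (auto intro!: continuous_intros boundedI[of _ 1])
      have split: "(CLINT \<omega>|K. iexp (f \<omega>)) = complex_of_real (LINT \<omega>|K. cos (f \<omega>)) + \<i> * complex_of_real (LINT \<omega>|K. sin (f \<omega>))"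
        if "prob_space K" "f \<in> borel_measurable K" for K :: "'e measure" and f
      proof -
        interpret K: prob_space K by fact
        note [measurable] = that(2)
        have "integrable K (\<lambda>\<omega>. cos (f \<omega>))" "integrable K (\<lambda>\<omega>. sin (f \<omega>))"
          by (auto intro!: K.integrable_const_bound[of _ 1])
        then show ?thesis by (simp add: exp_Euler cos_of_real sin_of_real)
      qed
      show ?thesis
        using tendsto_add[OF tendsto_of_real[OF c] tendsto_mult[OF tendsto_const[of \<i>] tendsto_of_real[OF s]]]
        by (subst (1 2) split) (auto intro: M N)
    qed
    have "(\<lambda>n. (CLINT \<omega>|M. iexp (c \<bullet> T n \<omega>)) - (CLINT \<omega>|M. iexp (c \<bullet> D (v n \<omega>)))) \<longlonglongrightarrow> 0"
    proof (rule LIMSEQ_I)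
      fix \<epsilon>' :: real assume "0 < \<epsilon>'"
      define \<epsilon> where "\<epsilon> = \<epsilon>' / 4"
      have \<epsilon>: "\<epsilon> > 0" using \<open>0 < \<epsilon>'\<close> by (simp add: \<epsilon>_def)
      define tail where "tail K u = min 1 (max 0 (norm u - real K))" for K and u :: 'c
      have tail_cont: "continuous_on UNIV (tail K)" for K unfolding tail_def[abs_def] by (intro continuous_intros)
      have tail_01: "0 \<le> tail K u" "tail K u \<le> 1" for K u by (auto simp: tail_def)
      have tail_bdd: "bounded (range (tail K))" for K using tail_01 by (intro boundedI[of _ 1]) auto
      have [measurable]: "tail K \<in> borel_measurable borel" for K using tail_cont by (rule borel_measurable_continuous_onI)
      have "(\<lambda>K. LINT \<omega>|N. tail K (V \<omega>)) \<longlonglongrightarrow> (LINT \<omega>|N. 0)"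
      proof (rule integral_dominated_convergence[where w="\<lambda>_. 1"])
        show "AE \<omega> in N. (\<lambda>K. tail K (V \<omega>)) \<longlonglongrightarrow> 0"
        proof (intro AE_I2 tendsto_eventually)
          fix \<omega>
          obtain K0 where "norm (V \<omega>) \<le> real K0" using real_arch_simple by blast
          then show "\<forall>\<^sub>F K in sequentially. tail K (V \<omega>) = 0"
            by (intro eventually_mono[OF eventually_ge_at_top[of K0]]) (auto simp: tail_def)
        qed
      qed (use tail_01 in auto)
      then have "\<forall>\<^sub>F K in sequentially. (LINT \<omega>|N. tail K (V \<omega>)) < \<epsilon>"
        using \<epsilon> by (intro order_tendstoD(2)) auto
      then obtain K where K: "(LINT \<omega>|N. tail K (V \<omega>)) < \<epsilon>" using eventually_happens' sequentially_bot by blast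
      have ev1: "\<forall>\<^sub>F n in sequentially. (LINT \<omega>|M. tail K (v n \<omega>)) < \<epsilon>"
        using test[OF tail_cont tail_bdd] K by (rule order_tendstoD(2))
      (* the bound norm c * \<eta> * (K + 1) on the difference of exponents becomes at most \<epsilon> *)
      define \<eta> where "\<eta> = \<epsilon> / ((norm c + 1) * (real K + 1))"
      have nc: "0 < norm c + 1" using norm_ge_zero[of c] by linarith
      have \<eta>: "\<eta> > 0" using \<epsilon> nc by (simp add: \<eta>_def)
      obtain \<delta> where \<delta>: "\<delta> > 0" "\<And>y. norm (y - a) < \<delta> \<Longrightarrow> norm (\<psi> y - \<psi> a - D (y - a)) \<le> \<eta> * norm (y - a)"
        using deriv \<eta> unfolding has_derivative_at_alt by blast
      have ev2: "\<forall>\<^sub>F n in sequentially. (real K + 1) / \<delta> < r n" using r by (simp add: filterlim_at_top_dense)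
      have "\<forall>\<^sub>F n in sequentially. norm ((CLINT \<omega>|M. iexp (c \<bullet> T n \<omega>)) - (CLINT \<omega>|M. iexp (c \<bullet> D (v n \<omega>))) - 0) < \<epsilon>'"
        using ev1 ev2
      proof eventually_elim
        case (elim n)
        have r0: "r n > 0" using elim(2) \<delta>(1) by (meson add_nonneg_pos divide_pos_pos less_trans of_nat_0_le_iff zero_less_one)
        have pointwise: "cmod (iexp (c \<bullet> T n \<omega>) - iexp (c \<bullet> D (v n \<omega>))) \<le> \<epsilon> + 2 * tail K (v n \<omega>)" for \<omega>
        proof (cases "norm (v n \<omega>) \<le> real K + 1")
          case True
          have nv: "norm (v n \<omega>) = r n * norm (m n \<omega> - a)" using r0 by (simp add: v_def)
          have "norm (m n \<omega> - a) \<le> (real K + 1) / r n" using True r0 by (simp add: nv pos_le_divide_eq mult.commute)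
          also have "\<dots> < \<delta>" using elim(2) r0 \<delta>(1) by (simp add: pos_divide_less_eq mult.commute)
          finally have small: "norm (\<psi> (m n \<omega>) - \<psi> a - D (m n \<omega> - a)) \<le> \<eta> * norm (m n \<omega> - a)" by (rule \<delta>(2))
          have "T n \<omega> - D (v n \<omega>) = r n *\<^sub>R (\<psi> (m n \<omega>) - \<psi> a - D (m n \<omega> - a))"
            unfolding T_def v_def D.scaleR by (simp add: scaleR_diff_right)
          then have "norm (T n \<omega> - D (v n \<omega>)) = r n * norm (\<psi> (m n \<omega>) - \<psi> a - D (m n \<omega> - a))" using r0 by simp
          also have "\<dots> \<le> r n * (\<eta> * norm (m n \<omega> - a))" using small r0 by (intro mult_left_mono) auto
          also have "\<dots> = \<eta> * norm (v n \<omega>)" by (simp add: nv)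
          also have "\<dots> \<le> \<eta> * (real K + 1)" using True \<eta> by (intro mult_left_mono) auto
          finally have d: "norm (T n \<omega> - D (v n \<omega>)) \<le> \<eta> * (real K + 1)" .
          have "cmod (iexp (c \<bullet> T n \<omega>) - iexp (c \<bullet> D (v n \<omega>))) \<le> \<bar>c \<bullet> T n \<omega> - c \<bullet> D (v n \<omega>)\<bar>" by (rule norm_iexp_diff)
          also have "\<dots> = \<bar>c \<bullet> (T n \<omega> - D (v n \<omega>))\<bar>" by (simp add: inner_diff_right)
          also have "\<dots> \<le> norm c * norm (T n \<omega> - D (v n \<omega>))" by (rule Cauchy_Schwarz_ineq2)
          also have "\<dots> \<le> (norm c + 1) * (\<eta> * (real K + 1))" using d nc by (intro mult_mono) auto
          also have "\<dots> = \<epsilon>" using nc by (simp add: \<eta>_def)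
          finally show ?thesis using tail_01[of K "v n \<omega>"] by linarith
        next
          case False
          then have "tail K (v n \<omega>) = 1" by (simp add: tail_def)
          moreover have "cmod (iexp (c \<bullet> T n \<omega>) - iexp (c \<bullet> D (v n \<omega>))) \<le> 2"
            using norm_triangle_ineq4[of "iexp (c \<bullet> T n \<omega>)" "iexp (c \<bullet> D (v n \<omega>))"] by simp
          ultimately show ?thesis using \<epsilon> by simp
        qed
        have it: "integrable M (\<lambda>\<omega>. tail K (v n \<omega>))" using tail_01 by (intro M.integrable_const_bound[of _ 1]) auto
        have ie: "integrable M (\<lambda>\<omega>. iexp (c \<bullet> T n \<omega>))" "integrable M (\<lambda>\<omega>. iexp (c \<bullet> D (v n \<omega>)))"
          by (auto intro!: M.integrable_const_bound[of _ 1])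
        have "norm ((CLINT \<omega>|M. iexp (c \<bullet> T n \<omega>)) - (CLINT \<omega>|M. iexp (c \<bullet> D (v n \<omega>))) - 0)
            = cmod (CLINT \<omega>|M. iexp (c \<bullet> T n \<omega>) - iexp (c \<bullet> D (v n \<omega>)))" using ie by simp
        also have "\<dots> \<le> (LINT \<omega>|M. cmod (iexp (c \<bullet> T n \<omega>) - iexp (c \<bullet> D (v n \<omega>))))" by (rule integral_norm_bound)
        also have "\<dots> \<le> (LINT \<omega>|M. \<epsilon> + 2 * tail K (v n \<omega>))"
          using ie it pointwise by (intro integral_mono) auto
        also have "\<dots> = \<epsilon> + 2 * (LINT \<omega>|M. tail K (v n \<omega>))" using it by (simp add: M.prob_space)
        also have "\<dots> < \<epsilon>'" using elim(1) \<epsilon> by (simp add: \<epsilon>_def)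
        finally show ?case .
      qed
      then show "\<exists>n0. \<forall>n\<ge>n0. norm ((CLINT \<omega>|M. iexp (c \<bullet> T n \<omega>)) - (CLINT \<omega>|M. iexp (c \<bullet> D (v n \<omega>))) - 0) < \<epsilon>'"
        by (simp add: eventually_sequentially)
    qed
    from tendsto_add[OF this lin] show "(\<lambda>n. CLINT \<omega>|M. iexp (c \<bullet> T n \<omega>)) \<longlonglongrightarrow> (CLINT \<omega>|N. iexp (c \<bullet> D (V \<omega>)))"
      by (simp only: diff_add_cancel add_0_left)
  qed
qed

context tail_sample
begin

text \<open>A Lebesgue integrable scalar weight is replaced by a Borel version, for which the product
measures behave well.\<close>

lemma unit_weight_of_inner:
  fixes g :: "real \<times> real \<Rightarrow> real ^ 'p"
  assumes g: "set_integrable lebesgue ({0..1} \<times> {0..1}) g"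
  shows "\<exists>\<gamma>. unit_weight \<gamma> \<and> (AE z in lebesgue. \<gamma> z = indicator ({0..1} \<times> {0..1}) z * (c \<bullet> g z))"
proof -
  let ?S = "{0..1::real} \<times> {0..1::real}"
  have S: "?S \<in> sets borel" by (intro borel_closed closed_Times) auto
  have "integrable lebesgue (\<lambda>z. c \<bullet> (indicat_real ?S z *\<^sub>R g z))"
    using g unfolding set_integrable_def by (rule integrable_inner_right)
  then have i: "integrable lebesgue (\<lambda>z. indicat_real ?S z * (c \<bullet> g z))" by simp
  obtain \<gamma> where \<gamma>: "\<gamma> \<in> borel_measurable lborel" "AE z in lborel. indicat_real ?S z * (c \<bullet> g z) = \<gamma> z"
    using completion_ex_borel_measurable_real[OF borel_measurable_integrable[OF i]] by blast
  define \<gamma>' where "\<gamma>' z = indicat_real ?S z * \<gamma> z" for z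
  have m: "\<gamma>' \<in> borel_measurable borel" unfolding \<gamma>'_def[abs_def] using \<gamma>(1) S by simp
  have ae: "AE z in lebesgue. indicat_real ?S z * (c \<bullet> g z) = \<gamma>' z"
    using AE_completion[OF \<gamma>(2)]
  proof eventually_elim
    case (elim z)
    then show ?case by (cases "z \<in> ?S") (simp_all add: \<gamma>'_def)
  qed
  have "integrable lebesgue \<gamma>'"
    using m by (intro integrable_cong_AE_imp[OF i _ ae]) (auto intro: measurable_completion)
  then have "integrable lborel \<gamma>'" using m by (subst (asm) integrable_completion) auto
  then have "unit_weight \<gamma>'" using m by (simp add: unit_weight_def \<gamma>'_def)
  moreover have "AE z in lebesgue. \<gamma>' z = indicat_real ?S z * (c \<bullet> g z)" using ae by eventually_elim simp
  ultimately show ?thesis by blast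
qed

lemma inner_weighted_integral:
  fixes g :: "real \<times> real \<Rightarrow> real ^ 'p"
  assumes \<Gamma>: "\<And>c. AE z in lebesgue. \<Gamma> c z = indicator ({0..1} \<times> {0..1}) z * (c \<bullet> g z)"
    and f: "AE z in lebesgue. z \<in> {0..1} \<times> {0..1} \<longrightarrow> f (fst z) (snd z) = h z"
    and int: "\<And>c. integrable lborel (\<lambda>z. \<Gamma> c z * h z)"
  shows "c \<bullet> weighted_integral g f = (LINT z|lborel. \<Gamma> c z * h z)"
proof -
  let ?S = "{0..1::real} \<times> {0..1::real}"
  let ?G = "\<lambda>z. indicat_real ?S z *\<^sub>R (f (fst z) (snd z) *\<^sub>R g z)"
  have ae: "AE z in lebesgue. \<Gamma> c z * h z = c \<bullet> ?G z" for c
    using \<Gamma>[of c] f by eventually_elim (auto simp: indicator_def)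
  have il: "integrable lebesgue (\<lambda>z. \<Gamma> c z * h z)" for c
    using int[of c] borel_measurable_integrable[OF int[of c]] by (subst integrable_completion) auto
  have ic: "integrable lebesgue (\<lambda>z. c \<bullet> ?G z)" for c
    using borel_measurable_AE[OF borel_measurable_integrable[OF il[of c]] ae[of c]]
    by (intro integrable_cong_AE_imp[OF il[of c] _ ae[of c]])
  have "integrable lebesgue (\<lambda>z. \<Sum>b\<in>Basis. (b \<bullet> ?G z) *\<^sub>R b)"
    by (intro Bochner_Integration.integrable_sum integrable_scaleR_left ic)
  also have "(\<lambda>z. \<Sum>b\<in>Basis. (b \<bullet> ?G z) *\<^sub>R b) = ?G"
    by (simp only: inner_commute[of _ "?G _"] euclidean_representation)
  finally have G: "integrable lebesgue ?G" .
  have "c \<bullet> weighted_integral g f = (LINT z|lebesgue. c \<bullet> ?G z)"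
    unfolding weighted_integral_def set_lebesgue_integral_def by (rule integral_inner_right[symmetric, OF G])
  also have "\<dots> = (LINT z|lebesgue. \<Gamma> c z * h z)"
    using borel_measurable_integrable[OF ic] borel_measurable_integrable[OF il] ae[of c]
    by (intro integral_cong_AE) auto
  also have "\<dots> = (LINT z|lborel. \<Gamma> c z * h z)"
    by (rule integral_completion[OF borel_measurable_integrable[OF int]])
  finally show ?thesis .
qed

lemma stdf_estimator_bounded: "\<bar>stdf_estimator X Y n m \<omega> x y\<bar> \<le> real n / real m"
proof -
  have "(\<Sum>i=1..n. of_bool (real (sample_rank X n i \<omega>) > real n + 1 / 2 - real m * x \<or>
         real (sample_rank Y n i \<omega>) > real n + 1 / 2 - real m * y) :: real) \<le> (\<Sum>i=1..n. 1)"
    by (intro sum_mono) simp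
  moreover have "0 \<le> (\<Sum>i=1..n. of_bool (real (sample_rank X n i \<omega>) > real n + 1 / 2 - real m * x \<or>
         real (sample_rank Y n i \<omega>) > real n + 1 / 2 - real m * y) :: real)"
    by (intro sum_nonneg) simp
  ultimately show ?thesis
    unfolding stdf_estimator_def by (simp add: abs_mult divide_right_mono)
qed

text \<open>The right-hand derivatives in \<open>limit_B\<close> agree with their Borel versions at regular points, that is, almost everywhere on the
unit square.\<close>

lemma limit_B_integral:
  assumes R: "R = tail_R l" and W: "tail_wiener_process N l W" and \<gamma>: "unit_weight \<gamma>" and \<omega>: "\<omega> \<in> space N"
  defines "h \<equiv> \<lambda>z. W (tail_index (Corner, z)) \<omega> - tail.D1 z * W (tail_index (First, z)) \<omega> - tail.D2 z * W (tail_index (Second, z)) \<omega>"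
  shows "integrable lborel (\<lambda>z. \<gamma> z * h z)"
    and "(LINT z|lborel. \<gamma> z * h z) = (LINT s|index_measure. - index_weight \<gamma> s * W (tail_index s) \<omega>)"
    and "AE z in lebesgue. z \<in> {0..1} \<times> {0..1} \<longrightarrow> limit_B l W \<omega> (fst z) (snd z) = h z"
proof -
  have tc: "tail_copula Q (tail_R l)" using tail.tail_copula_axioms by (simp add: R)
  have "integrable index_measure (\<lambda>s. - index_weight \<gamma> s)" using index_weight_integrable[OF \<gamma>] by simp
  from tail_wiener_integral(2)[OF W tc this \<omega>]
  have i: "integrable index_measure (\<lambda>s. - index_weight \<gamma> s * W (tail_index s) \<omega>)" .
  interpret I: pair_sigma_finite "count_space (UNIV :: margin set)" "lborel :: (real \<times> real) measure"
    by (rule pair_sigma_finite_index)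
  have s: "integrable lborel (\<lambda>z. - index_weight \<gamma> (\<kappa>, z) * W (tail_index (\<kappa>, z)) \<omega>)" for \<kappa>
    using I.AE_integrable_fst'[OF i[unfolded index_measure_def]] by (simp add: AE_count_space)
  have s': "integrable lborel (\<lambda>z. \<gamma> z * W (tail_index (Corner, z)) \<omega>)"
    "integrable lborel (\<lambda>z. - (\<gamma> z * tail.D1 z * W (tail_index (First, z)) \<omega>))"
    "integrable lborel (\<lambda>z. - (\<gamma> z * tail.D2 z * W (tail_index (Second, z)) \<omega>))"
    using s[of Corner] s[of First] s[of Second] by (simp_all add: index_weight_def)
  have eq: "(\<lambda>z. \<gamma> z * h z) = (\<lambda>z. \<gamma> z * W (tail_index (Corner, z)) \<omega> + - (\<gamma> z * tail.D1 z * W (tail_index (First, z)) \<omega>)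
      + - (\<gamma> z * tail.D2 z * W (tail_index (Second, z)) \<omega>))"
    by (simp add: h_def algebra_simps)
  show "integrable lborel (\<lambda>z. \<gamma> z * h z)"
    unfolding eq by (intro Bochner_Integration.integrable_add s')
  have "(LINT z|lborel. \<gamma> z * h z) = (LINT z|lborel. \<gamma> z * W (tail_index (Corner, z)) \<omega>)
      + (LINT z|lborel. - (\<gamma> z * tail.D1 z * W (tail_index (First, z)) \<omega>))
      + (LINT z|lborel. - (\<gamma> z * tail.D2 z * W (tail_index (Second, z)) \<omega>))"
    unfolding eq by (simp only: Bochner_Integration.integral_add[OF Bochner_Integration.integrable_add[OF s'(1,2)] s'(3)]
      Bochner_Integration.integral_add[OF s'(1,2)])
  also have "\<dots> = (LINT s|index_measure. - index_weight \<gamma> s * W (tail_index s) \<omega>)"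
    by (subst index_measure_integral(2)[OF s]) (simp add: index_weight_def)
  finally show "(LINT z|lborel. \<gamma> z * h z) = (LINT s|index_measure. - index_weight \<gamma> s * W (tail_index s) \<omega>)" .
  show "AE z in lebesgue. z \<in> {0..1} \<times> {0..1} \<longrightarrow> limit_B l W \<omega> (fst z) (snd z) = h z"
    using AE_completion[OF AE_unit_square_regular]
  proof eventually_elim
    case (elim z)
    show ?case
    proof
      assume z: "z \<in> {0..1} \<times> {0..1}"
      then have "tail_R1 l (fst z) (snd z) = tail.D1 z" "tail_R2 l (fst z) (snd z) = tail.D2 z"
        using tail.regular_right_derivatives[of z] elim by (simp_all add: tail_R1_def tail_R2_def R)
      then show "limit_B l W \<omega> (fst z) (snd z) = h z"
        using z by (auto simp: limit_B_def h_def tail_index_def margin_index_def)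
    qed
  qed
qed

text \<open>Both characteristic functions in direction \<open>c\<close> are governed by the same quadratic form in the weight
\<open>c \<bullet> g\<close>: \<open>deviation_clt\<close> on the side of the sample, \<open>tail_wiener_integral\<close> on the side of the limit.\<close>

theorem weighted_estimator_clt:
  fixes g :: "real \<times> real \<Rightarrow> real ^ 'p"
  assumes R: "R = tail_R l" and W: "tail_wiener_process N l W"
    and g: "set_integrable lebesgue ({0..1} \<times> {0..1}) g"
  shows "converges_in_distribution M
    (\<lambda>n \<omega>. sqrt (k n) *\<^sub>R (weighted_integral g (stdf_estimator X Y n (k n) \<omega>) - weighted_integral g l))
    N (\<lambda>\<omega>. weighted_integral g (limit_B l W \<omega>))"
proof -
  have tc: "tail_copula Q (tail_R l)" using tail.tail_copula_axioms by (simp add: R)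
  have N: "prob_space N" using W by (simp add: tail_wiener_process_def centered_gaussian_process_def)
  obtain \<Gamma> where \<Gamma>: "\<And>c. unit_weight (\<Gamma> c)" "\<And>c. AE z in lebesgue. \<Gamma> c z = indicator ({0..1} \<times> {0..1}) z * (c \<bullet> g z)"
    using unit_weight_of_inner[OF g] by metis
  let ?I = "\<lambda>c \<omega>. LINT s|index_measure. - index_weight (\<Gamma> c) s * W (tail_index s) \<omega>"
  have wi: "integrable index_measure (\<lambda>s. - index_weight (\<Gamma> c) s)" for c
    using index_weight_integrable[OF \<Gamma>(1)] by simp
  have lim: "c \<bullet> weighted_integral g (limit_B l W \<omega>) = ?I c \<omega>" if "\<omega> \<in> space N" for c \<omega>
    using inner_weighted_integral[OF \<Gamma>(2) limit_B_integral(3)[OF R W \<Gamma>(1) that] limit_B_integral(1)[OF R W \<Gamma>(1) that]]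
      limit_B_integral(2)[OF R W \<Gamma>(1) that] by simp
  have dev: "c \<bullet> (sqrt (k n) *\<^sub>R (weighted_integral g (stdf_estimator X Y n (k n) \<omega>) - weighted_integral g l)) = deviation (\<Gamma> c) n \<omega>"
    if \<omega>: "\<omega> \<in> space M" for c n \<omega>
  proof -
    define e where "e z = stdf_estimator X Y n (k n) \<omega> (fst z) (snd z)" for z
    define h where "h z = fst z + snd z - R (max 0 (fst z) + 0) (max 0 (snd z) + 0)" for z
    have "(fst :: real \<times> real \<Rightarrow> real) \<in> borel_measurable borel" "(snd :: real \<times> real \<Rightarrow> real) \<in> borel_measurable borel"
      by (simp_all flip: borel_prod)
    then have em: "e \<in> borel_measurable borel"
      unfolding e_def[abs_def] using \<omega> by (intro stdf_estimator_measurable) auto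
    have ei: "integrable lborel (\<lambda>z. \<Gamma> c z * e z)" for c
      by (rule weight_times_bounded_integrable[OF \<Gamma>(1) em, where C="real n / real (k n)"]) (simp add: e_def stdf_estimator_bounded)
    have hm: "h \<in> borel_measurable borel"
      unfolding h_def[abs_def] using \<open>fst \<in> _\<close> \<open>snd \<in> _\<close>
      by (intro borel_measurable_diff borel_measurable_add tail.R_measurable) auto
    have hi: "integrable lborel (\<lambda>z. \<Gamma> c z * h z)" for c
    proof (rule weight_times_bounded_integrable[OF \<Gamma>(1) hm])
      show "\<bar>h z\<bar> \<le> 2" if "z \<in> {0..1} \<times> {0..1}" for z
        using tail.R_bounds[of "fst z" "snd z"] that by (auto simp: h_def)
    qed
    have "c \<bullet> weighted_integral g (stdf_estimator X Y n (k n) \<omega>) = (LINT z|lborel. \<Gamma> c z * e z)"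
      by (rule inner_weighted_integral[OF \<Gamma>(2) _ ei]) (simp add: e_def)
    moreover have "c \<bullet> weighted_integral g l = (LINT z|lborel. \<Gamma> c z * h z)"
      by (rule inner_weighted_integral[OF \<Gamma>(2) _ hi]) (auto intro!: AE_I2 simp: h_def R tail_R_def)
    moreover have "deviation (\<Gamma> c) n \<omega> = sqrt (k n) * (LINT z|lborel. \<Gamma> c z * e z - \<Gamma> c z * h z)"
      unfolding deviation_def
    proof (intro arg_cong[where f="\<lambda>u. sqrt (k n) * u"] Bochner_Integration.integral_cong refl)
      fix z
      show "\<Gamma> c z * (stdf_estimator X Y n (k n) \<omega> (fst z) (snd z) - (fst z + snd z - R (fst z) (snd z))) = \<Gamma> c z * e z - \<Gamma> c z * h z"
        by (cases "z \<in> {0..1} \<times> {0..1}") (auto simp: e_def h_def right_diff_distrib unit_weightD(3)[OF \<Gamma>(1)])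
    qed
    ultimately show ?thesis using ei hi by (simp add: inner_diff_right)
  qed
  show ?thesis
  proof (rule levy_continuity_euclidean[OF prob_space_axioms N])
    show "(\<lambda>\<omega>. sqrt (k n) *\<^sub>R (weighted_integral g (stdf_estimator X Y n (k n) \<omega>) - weighted_integral g l)) \<in> borel_measurable M" for n
      by (rule rank_statistic_measurable[where H="\<lambda>f. sqrt (k n) *\<^sub>R (weighted_integral g f - weighted_integral g l)"]) auto
    show "(\<lambda>\<omega>. weighted_integral g (limit_B l W \<omega>)) \<in> borel_measurable N"
    proof (subst borel_measurable_euclidean_space, intro ballI)
      fix b :: "real ^ 'p"
      have "(\<lambda>\<omega>. weighted_integral g (limit_B l W \<omega>) \<bullet> b) \<in> borel_measurable N \<longleftrightarrow> ?I b \<in> borel_measurable N"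
        by (intro measurable_cong) (simp add: inner_commute[of _ b] lim)
      then show "(\<lambda>\<omega>. weighted_integral g (limit_B l W \<omega>) \<bullet> b) \<in> borel_measurable N"
        using tail_wiener_integral(1)[OF W tc wi] by simp
    qed
    fix c :: "real ^ 'p"
    have "(CLINT \<omega>|N. iexp (c \<bullet> weighted_integral g (limit_B l W \<omega>))) = (CLINT \<omega>|N. iexp (?I c \<omega>))"
      by (intro Bochner_Integration.integral_cong refl) (simp add: lim)
    also have "\<dots> = complex_of_real (exp (- (LINT s|index_measure. - index_weight (\<Gamma> c) s *
      (LINT s'|index_measure. - index_weight (\<Gamma> c) s' * tail_kernel l (tail_index s) (tail_index s'))) / 2))"
      by (rule tail_wiener_integral(3)[OF W tc wi])
    also have "\<dots> = complex_of_real (exp (- (LINT s|index_measure. index_weight (\<Gamma> c) s *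
      (LINT s'|index_measure. index_weight (\<Gamma> c) s' * tail_kernel l (tail_index s) (tail_index s'))) / 2))"
      by simp
    finally have limit: "(CLINT \<omega>|N. iexp (c \<bullet> weighted_integral g (limit_B l W \<omega>))) = \<dots>" .
    have "(CLINT \<omega>|M. iexp (c \<bullet> (sqrt (k n) *\<^sub>R (weighted_integral g (stdf_estimator X Y n (k n) \<omega>) - weighted_integral g l))))
        = (CLINT \<omega>|M. iexp (deviation (\<Gamma> c) n \<omega>))" for n
      by (intro Bochner_Integration.integral_cong refl) (simp only: dev)
    then show "(\<lambda>n. CLINT \<omega>|M. iexp (c \<bullet> (sqrt (k n) *\<^sub>R (weighted_integral g (stdf_estimator X Y n (k n) \<omega>) - weighted_integral g l))))
      \<longlonglongrightarrow> (CLINT \<omega>|N. iexp (c \<bullet> weighted_integral g (limit_B l W \<omega>)))"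
      unfolding limit using deviation_clt[OF \<Gamma>(1) R] by simp
  qed
qed

end

section \<open>Asymptotic normality of the moment estimator\<close>

text \<open>By invariance of domain the image of the interior is open, so the inverse, extended by the default value \<open>d\<close>, is continuous near
\<open>\<phi> \<theta>\<close>, and a continuous inverse of a map with invertible derivative is differentiable.\<close>

lemma moment_equation_inverse_derivative:
  fixes \<phi> :: "real ^ 'p \<Rightarrow> real ^ 'p" and d :: "real ^ 'p"
  assumes homeo: "homeomorphism (interior S) (\<phi> ` interior S) \<phi> \<psi>'" and \<theta>: "\<theta> \<in> interior S"
    and diff: "\<phi> differentiable (at \<theta>)" and inv: "invertible (jacobian \<phi> (at \<theta>))"
  defines "\<psi> \<equiv> \<lambda>m. if m \<in> \<phi> ` interior S then the_inv_into (interior S) \<phi> m else d"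
  shows "\<psi> (\<phi> \<theta>) = \<theta>" and "(\<psi> has_derivative (\<lambda>h. matrix_inv (jacobian \<phi> (at \<theta>)) *v h)) (at (\<phi> \<theta>))"
proof -
  have inj: "inj_on \<phi> (interior S)" using homeo by (metis homeomorphism_def inj_on_inverseI)
  have cont: "continuous_on (interior S) \<phi>" using homeo by (simp add: homeomorphism_def)
  have op: "open (\<phi> ` interior S)" by (rule invariance_of_domain[OF cont open_interior inj])
  have \<psi>: "\<psi> (\<phi> x) = x" if "x \<in> interior S" for x
    using that inj by (simp add: \<psi>_def the_inv_into_f_f)
  show 1: "\<psi> (\<phi> \<theta>) = \<theta>" by (rule \<psi>[OF \<theta>])
  have eq: "\<psi>' m = \<psi> m" if "m \<in> \<phi> ` interior S" for m
    using that homeo \<psi> by (auto simp: homeomorphism_def)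
  have "continuous_on (\<phi> ` interior S) \<psi>'" using homeo by (simp add: homeomorphism_def)
  then have "continuous_on (\<phi> ` interior S) \<psi>" using eq by (rule continuous_on_eq)
  then have c: "continuous (at (\<phi> \<theta>)) \<psi>" using op \<theta> by (simp add: continuous_on_eq_continuous_at)
  show "(\<psi> has_derivative (\<lambda>h. matrix_inv (jacobian \<phi> (at \<theta>)) *v h)) (at (\<phi> \<theta>))"
  proof (rule has_derivative_inverse_basic[OF _ _ _ c op])
    show "(\<phi> has_derivative (\<lambda>h. jacobian \<phi> (at \<theta>) *v h)) (at (\<psi> (\<phi> \<theta>)))"
      unfolding 1 using diff jacobian_works by blast
    show "bounded_linear (\<lambda>h. matrix_inv (jacobian \<phi> (at \<theta>)) *v h)" by (rule matrix_vector_mul_bounded_linear)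
    show "(\<lambda>h. matrix_inv (jacobian \<phi> (at \<theta>)) *v h) \<circ> (\<lambda>h. jacobian \<phi> (at \<theta>) *v h) = id"
    proof -
      have "matrix_inv (jacobian \<phi> (at \<theta>)) ** jacobian \<phi> (at \<theta>) = mat 1"
        using someI_ex[OF inv[unfolded invertible_def]] by (simp add: matrix_inv_def)
      then show ?thesis by (simp add: fun_eq_iff matrix_vector_mul_assoc)
    qed
    show "\<phi> \<theta> \<in> \<phi> ` interior S" using \<theta> by simp
    show "\<phi> (\<psi> m) = m" if "m \<in> \<phi> ` interior S" for m using that \<psi> by auto
  qed
qed

theorem theorem4p2:
  fixes M :: "'a measure" and X Y :: "nat \<Rightarrow> 'a \<Rightarrow> real"
    and F :: "real \<Rightarrow> real \<Rightarrow> real"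
    and l :: "real \<Rightarrow> real \<Rightarrow> real"
    and \<Theta> :: "(real ^ 'p) set" and L :: "real ^ 'p \<Rightarrow> real \<Rightarrow> real \<Rightarrow> real"
    and \<theta>\<^sub>0 \<theta>' :: "real ^ 'p"
    and g :: "real \<times> real \<Rightarrow> real ^ 'p"
    and k :: "nat \<Rightarrow> nat" and \<alpha> :: real
    and N :: "'b measure" and W :: "ennreal \<times> ennreal \<Rightarrow> 'b \<Rightarrow> real"
  defines "\<phi> \<equiv> \<lambda>\<theta>. weighted_integral g (L \<theta>)"
  assumes "prob_space M"
    and indep: "prob_space.indep_vars M (\<lambda>_. borel) (\<lambda>i \<omega>. (X i \<omega>, Y i \<omega>)) UNIV"
    and F: "\<And>i u v. \<P>(\<omega> in M. X i \<omega> \<le> u \<and> Y i \<omega> \<le> v) = F u v"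
    and F_cont: "continuous_on UNIV (\<lambda>(u, v). F u v)"
    and stdf: "has_stdf M (X 0) (Y 0) l"
    and family: "\<And>\<theta>. \<theta> \<in> \<Theta> \<Longrightarrow> is_stdf (L \<theta>)"
    and true_parameter: "\<And>x y. x \<ge> 0 \<Longrightarrow> y \<ge> 0 \<Longrightarrow> l x y = L \<theta>\<^sub>0 x y"
    and k_range: "\<And>n. n \<ge> 1 \<Longrightarrow> k n \<in> {1..n}"
    and default_value: "\<theta>' \<in> \<Theta>"
    and W: "tail_wiener_process N l W"
    and g: "set_integrable lebesgue ({0..1} \<times> {0..1}) g"
    and \<phi>_homeo: "\<exists>\<psi>. homeomorphism (interior \<Theta>) (\<phi> ` interior \<Theta>) \<phi> \<psi>"
    and \<theta>\<^sub>0: "\<theta>\<^sub>0 \<in> interior \<Theta>"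
    and C1: "\<exists>U. open U \<and> \<theta>\<^sub>0 \<in> U \<and> U \<subseteq> \<Theta> \<and> (\<forall>\<theta>\<in>U. \<phi> differentiable (at \<theta>)) \<and>
                 continuous_on U (\<lambda>\<theta>. jacobian \<phi> (at \<theta>))"
            "invertible (jacobian \<phi> (at \<theta>\<^sub>0))"
    and C2: "\<alpha> > 0"
            "\<exists>C. \<forall>\<^sub>F t in at_right 0. \<forall>x\<ge>0. \<forall>y\<ge>0. x + y = 1 \<longrightarrow>
               \<bar>\<P>(\<omega> in M. 1 - cdf (distr M borel (X 0)) (X 0 \<omega>) \<le> t * x \<and>
                           1 - cdf (distr M borel (Y 0)) (Y 0 \<omega>) \<le> t * y) / t
                 - tail_R l x y\<bar> \<le> C * t powr \<alpha>"
    and C3: "filterlim k at_top sequentially"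
            "(\<lambda>n. real (k n)) \<in> o(\<lambda>n. real n powr (2 * \<alpha> / (1 + 2 * \<alpha>)))"
  shows "converges_in_distribution
           M (\<lambda>n \<omega>. sqrt (real (k n)) *\<^sub>R (moment_estimator g L \<Theta> \<theta>' X Y n (k n) \<omega> - \<theta>\<^sub>0))
           N (\<lambda>\<omega>. matrix_inv (jacobian \<phi> (at \<theta>\<^sub>0)) *v weighted_integral g (limit_B l W \<omega>))"
proof -
  interpret prob_space M by fact
  obtain Q \<beta> where "tail_sample M (\<lambda>i \<omega>. (1 - cdf (distr M borel (X 0)) (X i \<omega>), 1 - cdf (distr M borel (Y 0)) (Y i \<omega>))) Q (tail_R l) X Y
      (\<lambda>x. 1 - cdf (distr M borel (X 0)) x) (\<lambda>y. 1 - cdf (distr M borel (Y 0)) y) k \<beta>"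
    using tail_sample_of_observations[OF \<open>prob_space M\<close> indep F F_cont stdf k_range C2 C3] by blast
  then interpret tail_sample M "\<lambda>i \<omega>. (1 - cdf (distr M borel (X 0)) (X i \<omega>), 1 - cdf (distr M borel (Y 0)) (Y i \<omega>))" Q "tail_R l" X Y
      "\<lambda>x. 1 - cdf (distr M borel (X 0)) x" "\<lambda>y. 1 - cdf (distr M borel (Y 0)) y" k \<beta> .
  define \<psi> where "\<psi> m = (if m \<in> \<phi> ` interior \<Theta> then the_inv_into (interior \<Theta>) \<phi> m else \<theta>')" for m
  have moment: "moment_estimator g L \<Theta> \<theta>' X Y n (k n) \<omega> = \<psi> (weighted_integral g (stdf_estimator X Y n (k n) \<omega>))" for n \<omega>
    by (simp add: moment_estimator_def \<psi>_def \<phi>_def Let_def)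
  have truth: "weighted_integral g l = \<phi> \<theta>\<^sub>0"
    unfolding weighted_integral_def \<phi>_def
  proof (rule set_lebesgue_integral_cong)
    have "{0..1::real} \<times> {0..1::real} \<in> sets borel" by (intro borel_closed closed_Times) auto
    then show "{0..1::real} \<times> {0..1::real} \<in> sets lebesgue" by (intro sets_completionI_sets) simp
  qed (use true_parameter in auto)
  obtain \<psi>' where homeo: "homeomorphism (interior \<Theta>) (\<phi> ` interior \<Theta>) \<phi> \<psi>'" using \<phi>_homeo by blast
  have diff: "\<phi> differentiable (at \<theta>\<^sub>0)" using C1(1) by blast
  note inverse = moment_equation_inverse_derivative[OF homeo \<theta>\<^sub>0 diff C1(2), of \<theta>', folded \<psi>_def]
  have "prob_space N" using W by (simp add: tail_wiener_process_def centered_gaussian_process_def)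
  moreover have "filterlim (\<lambda>n. sqrt (real (k n))) at_top sequentially"
    by (intro filterlim_compose[OF sqrt_at_top] filterlim_compose[OF filterlim_real_sequentially] C3)
  moreover have "(\<lambda>\<omega>. \<psi> (weighted_integral g (stdf_estimator X Y n (k n) \<omega>))) \<in> borel_measurable M" for n
    by (rule rank_statistic_measurable) auto
  ultimately have "converges_in_distribution M
      (\<lambda>n \<omega>. sqrt (real (k n)) *\<^sub>R (\<psi> (weighted_integral g (stdf_estimator X Y n (k n) \<omega>)) - \<psi> (\<phi> \<theta>\<^sub>0)))
      N (\<lambda>\<omega>. matrix_inv (jacobian \<phi> (at \<theta>\<^sub>0)) *v weighted_integral g (limit_B l W \<omega>))"
    by (intro delta_method[OF \<open>prob_space M\<close> _ weighted_estimator_clt[OF refl W g, unfolded truth]] inverse(2))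
  then show ?thesis unfolding moment inverse(1) .
qed

end
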